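(* Let $q\geqslant 2$ be an integer and let $R(q),a(q)$ be real numbers with $2\leqslant R(q)<a(q)\leqslant q$. Let $N$ be an integer with \[ \frac{qR(q)}{a(q)}<N<\frac{q}{R(q)}\left(1-\frac{R(q)}{a(q)}\right). \] Then for every even primitive Dirichlet character $\chi$ modulo $q$, \begin{align*} \sum_{n=1}^N \chi(n) \leqslant{}& 2\sqrt{q}\left( \frac{2}{\pi} \log a(q) +\frac{2}{\pi}\left( C +\log 2 +\frac{3}{a(q)}\right)\right)\\ &+O \left(\sqrt{q}\max\left(\log \frac{\log q}{\log a(q)},\ \frac{(\log R(q))^{3/2}}{\sqrt{R(q)}}\log \frac{q}{a(q)}\right) \right), \end{align*} with an absolute implied constant.
   Context: $C$ denotes the Euler–Mascheroni constant. A Dirichlet character $\chi$ is even if $\chi(-1)=1$. *)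

theory Defs
  imports "HOL-Analysis.Analysis" "HOL-Number_Theory.Number_Theory"
begin

text \<open>
  Dirichlet characters modulo \<open>q\<close> are viewed as functions on all integers, extended by zero
  to the integers not coprime to \<open>q\<close>.
\<close>

definition dirichlet_character :: "nat \<Rightarrow> (int \<Rightarrow> complex) \<Rightarrow> bool" where
  "dirichlet_character q chi \<longleftrightarrow>
     (\<forall>m n. [m = n] (mod int q) \<longrightarrow> chi m = chi n) \<and>
     (\<forall>m n. chi (m * n) = chi m * chi n) \<and>
     (\<forall>n. chi n \<noteq> 0 \<longleftrightarrow> coprime n (int q))"

definition even_character :: "(int \<Rightarrow> complex) \<Rightarrow> bool" where
  "even_character chi \<longleftrightarrow> chi (-1) = 1"

text \<open>
  A divisor \<open>d\<close> of \<open>q\<close> is an induced modulus of a character modulo \<open>q\<close> if the character is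
  trivial on the units modulo \<open>q\<close> that are congruent to 1 modulo \<open>d\<close>, that is, if on the
  integers coprime to \<open>q\<close> it comes from a character modulo \<open>d\<close>.
\<close>

definition induced_modulus :: "nat \<Rightarrow> (int \<Rightarrow> complex) \<Rightarrow> nat \<Rightarrow> bool" where
  "induced_modulus q chi d \<longleftrightarrow>
     d dvd q \<and> (\<forall>n. coprime n (int q) \<longrightarrow> [n = 1] (mod int d) \<longrightarrow> chi n = 1)"

definition primitive_character :: "nat \<Rightarrow> (int \<Rightarrow> complex) \<Rightarrow> bool" where
  "primitive_character q chi \<longleftrightarrow>
     dirichlet_character q chi \<and> (\<forall>d<q. \<not> induced_modulus q chi d)"

end

(* Expand the character sum into additive characters by Gauss sums: since chi is even, it is at most
   sqrt q / pi times |sum_{c <= q} chi(c) sin(2 pi c alpha) / c| + O(sqrt q), where alpha = N / q.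
   The terms c <= a^4 are bounded trivially by 1 + 4 ln a, which is exactly the main term; if
   ln q <= 4 ln a, nothing remains. Otherwise ln (ln q / ln a) >= 1, so bounded factors are harmless
   and the terms a^4 < c <= q have to show cancellation.

   This is the method of Montgomery and Vaughan: from ln n = sum_{d | n} Lambda(d) and
   multiplicativity the sum becomes bilinear in (d, m) with n = d m, and is cut into dyadic boxes
   d ~ 2^i, m ~ 2^j. By Cauchy-Schwarz over m, a box is controlled by the correlations
   sum_d Lambda(d) Lambda(d + h) <= K 2^i sum_{d | h} 1/d (an upper bound sieve) weighted by
   min(1, 1 / (2^j ||h alpha||)). The divisor sum is replaced by 1 + ln D up to an error 2/D on
   average. The bounds on N force every good rational approximation of alpha to have denominator at
   least R, so the numbers h alpha are well distributed modulo 1. A box with i + j = k then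
   contributes O(1/k) ((ln R)^(3/2) / sqrt R + 2^(-i/8) + 2^(-j/8)), and summation over all boxes
   gives the error term. *)
theory Submission
  imports Defs "HOL-Computational_Algebra.Squarefree" "HOL-Real_Asymp.Real_Asymp"
begin

section \<open>An upper bound sieve\<close>

text \<open>For \<open>a = q\<close> the error term is 0, so in the range
  \<open>ln q <= 4 * ln a\<close> every lower order constant has to fit below C + log 2. In the
  other range absolute constants are free and crude sieve constants suffice. What is not free there
  is a logarithm. A box with i + j = k is trivially O(1/k), so a loss growing with k would spoil the
  result. Hence the sieve has dimension two: it saves both logarithms that Lambda(d) Lambda(d + h)
  costs. The divisor sum is averaged over h so that ln R is lost and not the logarithm of the box
  length, and the sums of geometric series are bounded without a logarithm of the denominator. The
  factor 1/k stems from the division by ln n. The parts 2^(-i/8) and 2^(-j/8) are summable along i +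
  j = k and leave a sum of 1/k over k between about ln a and ln q, which is the double logarithm.
  The part independent of i and j occurs in all k + 1 boxes and is therefore multiplied by ln q in
  the end.\<close>

lemma sum_prod_residues:
  fixes f :: "nat \<Rightarrow> nat \<Rightarrow> real"
  assumes "finite S" "\<And>p. p \<in> S \<Longrightarrow> prime p"
    and "\<And>p n. p \<in> S \<Longrightarrow> f p (n mod p) = f p n"
  shows "(\<Sum>n<\<Prod>S. \<Prod>p\<in>S. f p n) = (\<Prod>p\<in>S. \<Sum>n<p. f p n)"
  using assms
proof (induction S rule: finite_induct)
  case empty
  then show ?case by simp
next
  case (insert p S)
  define D where "D = \<Prod>S"
  have cop: "coprime p D"
    unfolding D_def using insert by (intro prod_coprime_right) (metis insertCI primes_coprime)
  have Dpos: "D > 0" and ppos: "p > 0"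
    unfolding D_def using insert.prems(1) insert.hyps(1) by (auto intro!: prod_pos prime_gt_0_nat)
  have per: "(\<Prod>r\<in>S. f r (n mod D)) = (\<Prod>r\<in>S. f r n)" for n
  proof (rule prod.cong[OF refl])
    fix r assume r: "r \<in> S"
    then have "r dvd D" unfolding D_def using insert.hyps(1) by (intro dvd_prodI)
    then have "n mod D mod r = n mod r" by (rule mod_mod_cancel)
    then show "f r (n mod D) = f r n"
      using insert.prems(2)[of r "n mod D"] insert.prems(2)[of r n] r by (metis insertCI)
  qed
  \<comment> \<open>The Chinese remainder theorem for the coprime moduli \<open>p\<close> and
    \<open>D\<close> separates the new prime from the others.\<close>
  let ?g = "\<lambda>n. (n mod p, n mod D)"
  have inj: "inj_on ?g {..<p * D}"
  proof (rule inj_onI)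
    fix x y assume "x \<in> {..<p * D}" "y \<in> {..<p * D}" "?g x = ?g y"
    then have "[x = y] (mod p)" "[x = y] (mod D)" "x < p * D" "y < p * D"
      by (auto simp: cong_def)
    then show "x = y" using cop coprime_cong_mult_nat cong_less_modulus_unique_nat by blast
  qed
  have "?g ` {..<p * D} = {..<p} \<times> {..<D}"
    using inj Dpos ppos by (intro card_subset_eq) (auto simp: card_image)
  with inj have bij: "bij_betw ?g {..<p * D} ({..<p} \<times> {..<D})"
    by (simp add: bij_betw_def)
  have "(\<Sum>n<\<Prod>(insert p S). \<Prod>r\<in>insert p S. f r n) = (\<Sum>n<p*D. f p n * (\<Prod>r\<in>S. f r n))"
    using insert by (simp add: D_def)
  also have "\<dots> = (\<Sum>n<p*D. (\<lambda>(x,y). f p x * (\<Prod>r\<in>S. f r y)) (?g n))"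
    using insert.prems(2)[of p] by (simp add: per)
  also have "\<dots> = (\<Sum>(x,y)\<in>{..<p} \<times> {..<D}. f p x * (\<Prod>r\<in>S. f r y))"
    using bij by (rule sum.reindex_bij_betw)
  also have "\<dots> = (\<Sum>n<p. f p n) * (\<Sum>n<D. \<Prod>r\<in>S. f r n)"
    by (simp add: sum_product sum.cartesian_product)
  also have "(\<Sum>n<D. \<Prod>r\<in>S. f r n) = (\<Prod>r\<in>S. \<Sum>n<r. f r n)"
    unfolding D_def using insert by auto
  finally show ?case using insert by simp
qed

lemma sum_full_period:
  fixes g :: "nat \<Rightarrow> 'a :: comm_monoid_add"
  assumes "D > 0" "\<And>n. g (n mod D) = g n"
  shows "sum g {a..<a+D} = sum g {..<D}"
proof -
  have inj: "inj_on (\<lambda>n. n mod D) {a..<a+D}"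
  proof (rule inj_onI)
    fix x y assume xy: "x \<in> {a..<a+D}" "y \<in> {a..<a+D}" "x mod D = y mod D"
    have *: "u = v" if "u \<le> v" "v < u + D" "u mod D = v mod D" for u v :: nat
    proof -
      have "D dvd v - u" using that(1,3) mod_eq_dvd_iff_nat[of u v D] by simp
      moreover have "v - u < D" using that by simp
      ultimately have "v - u = 0" by (meson dvd_imp_le gr0I leD)
      then show ?thesis using that by simp
    qed
    show "x = y" using *[of x y] *[of y x] xy by fastforce
  qed
  have "(\<lambda>n. n mod D) ` {a..<a+D} = {..<D}"
    using inj assms(1) by (intro card_subset_eq) (auto simp: card_image)
  then have "bij_betw (\<lambda>n. n mod D) {a..<a+D} {..<D}" using inj by (simp add: bij_betw_def)
  from sum.reindex_bij_betw[OF this, of g] show ?thesis using assms(2) by simp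
qed

lemma sum_periodic_le:
  fixes g :: "nat \<Rightarrow> real"
  assumes "D > 0" "\<And>n. g (n mod D) = g n" "\<And>n. \<bar>g n\<bar> \<le> G" "sum g {..<D} \<ge> 0"
  shows "sum g {a..<a+P} \<le> real P / real D * sum g {..<D} + real D * G"
proof -
  define t s where "t = P div D" and "s = P mod D"
  have P: "P = t * D + s" and s: "s < D" using assms(1) by (auto simp: t_def s_def)
  have full: "sum g {a..<a+t*D} = real t * sum g {..<D}" for a
  proof (induction t)
    case (Suc t)
    have "sum g {a..<a+Suc t*D} = sum g {a..<a+t*D} + sum g {a+t*D..<a+t*D+D}"
      by (subst sum.atLeastLessThan_concat) (auto simp: algebra_simps)
    then show ?case using Suc sum_full_period[of D g "a+t*D", OF assms(1,2)] by (simp add: algebra_simps)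
  qed simp
  have "sum g {a..<a+P} = sum g {a..<a+t*D} + sum g {a+t*D..<a+P}"
    by (subst sum.atLeastLessThan_concat) (auto simp: P)
  moreover have "sum g {a+t*D..<a+P} \<le> real D * G"
  proof -
    have "G \<ge> 0" using assms(3)[of 0] by linarith
    have "sum g {a+t*D..<a+P} \<le> real (card {a+t*D..<a+P}) * G"
      using assms(3) by (intro sum_bounded_above) (meson abs_le_D1)
    also have "\<dots> \<le> real D * G" using \<open>G \<ge> 0\<close> s by (intro mult_right_mono) (auto simp: P)
    finally show ?thesis .
  qed
  \<comment> \<open>Replacing the number of full periods by the larger quotient \<open>P / D\<close>
    is allowed because the sum over one period is nonnegative.\<close>
  moreover have "real t * sum g {..<D} \<le> real P / real D * sum g {..<D}"
  proof (rule mult_right_mono[OF _ assms(4)])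
    have "real t * real D \<le> real P" by (simp add: P flip: of_nat_mult)
    then show "real t \<le> real P / real D" using assms(1) by (simp add: field_simps)
  qed
  ultimately show ?thesis using full[of a] by linarith
qed

text \<open>
  Selberg's upper bound in dual form: each \<open>\<psi>\<close> below has mean zero over a full period, so the
  products of the \<open>\<psi>\<close> over different sets of primes are almost orthogonal, while all of them are 1
  on the sifted set.
\<close>

lemma sifted_set_upper_bound:
  fixes bad :: "nat \<Rightarrow> nat \<Rightarrow> bool" and c :: "nat \<Rightarrow> real"
  assumes fin: "finite \<A>" "\<And>A. A \<in> \<A> \<Longrightarrow> finite A"
    and pr: "\<And>A p. A \<in> \<A> \<Longrightarrow> p \<in> A \<Longrightarrow> prime p"
    and Q: "\<And>A. A \<in> \<A> \<Longrightarrow> \<Prod>A \<le> Q"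
    and bad: "\<And>p n. bad p (n mod p) = bad p n"
    and c: "\<And>A p. A \<in> \<A> \<Longrightarrow> p \<in> A \<Longrightarrow> c p > 0"
    and om: "\<And>A p. A \<in> \<A> \<Longrightarrow> p \<in> A \<Longrightarrow> card {n\<in>{..<p}. bad p n} \<ge> 1"
    and com: "\<And>A p. A \<in> \<A> \<Longrightarrow> p \<in> A \<Longrightarrow> 
       c p * (real p - card {n\<in>{..<p}. bad p n}) \<le> card {n\<in>{..<p}. bad p n}"
    and X: "X \<subseteq> {a..<a+P}" "\<And>A p n. A \<in> \<A> \<Longrightarrow> p \<in> A \<Longrightarrow> n \<in> X \<Longrightarrow> \<not> bad p n"
  defines "L \<equiv> (\<Sum>A\<in>\<A>. \<Prod>p\<in>A. c p)"
  shows "real (card X) * L^2 \<le> real P * L + L^2 * real Q ^ 4"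
proof -
  define \<omega> where "\<omega> p = real (card {n\<in>{..<p}. bad p n})" for p
  define \<psi> where "\<psi> p n = (if bad p n then - (real p - \<omega> p) / \<omega> p else 1)" for p n
  define \<Psi> where "\<Psi> A n = (\<Prod>p\<in>A. \<psi> p n)" for A n
  define C where "C A = (\<Prod>p\<in>A. c p)" for A
  define F where "F n = (\<Sum>A\<in>\<A>. C A * \<Psi> A n)" for n
  have Cpos: "C A > 0" if "A \<in> \<A>" for A unfolding C_def using c that by (intro prod_pos) auto
  have \<omega>1: "\<omega> p \<ge> 1" if "A \<in> \<A>" "p \<in> A" for A p
    using om[OF that] unfolding \<omega>_def by linarith
  have \<omega>p: "\<omega> p \<le> real p" for p
    unfolding \<omega>_def using card_mono[of "{..<p}" "{n\<in>{..<p}. bad p n}"] by auto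
  have \<psi>per: "\<psi> p (n mod p) = \<psi> p n" for p n by (simp add: \<psi>_def bad)
  have sumsplit: "(\<Sum>n<p. if bad p n then u else v) = \<omega> p * u + (real p - \<omega> p) * v" for p u v
  proof -
    have "(\<Sum>n<p. if bad p n then u else v) 
        = real (card {n\<in>{..<p}. bad p n}) * u + real (card {n\<in>{..<p}. \<not> bad p n}) * v"
      by (subst sum.If_cases) (auto simp: Int_def)
    moreover have "real (card {n\<in>{..<p}. \<not> bad p n}) = real p - \<omega> p"
    proof -
      have "card {..<p} = card ({n\<in>{..<p}. bad p n} \<union> {n\<in>{..<p}. \<not> bad p n})"
        by (rule arg_cong[where f = card]) auto
      also have "\<dots> = card {n\<in>{..<p}. bad p n} + card {n\<in>{..<p}. \<not> bad p n}"
        by (rule card_Un_disjoint) auto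
      finally show ?thesis by (simp add: \<omega>_def)
    qed
    ultimately show ?thesis by (simp add: \<omega>_def)
  qed
  have mean0: "(\<Sum>n<p. \<psi> p n) = 0" if "A \<in> \<A>" "p \<in> A" for A p
    unfolding \<psi>_def sumsplit using \<omega>1[OF that] by (simp add: field_simps)
  \<comment> \<open>The value of \<open>\<psi>\<close> on the bad classes makes its mean vanish, and
    its mean square is then \<open>(p - \<omega>) / \<omega>\<close>. The hypothesis on
    \<open>c\<close> bounds this by \<open>1 / c p\<close>.\<close>
  have meansq: "(\<Sum>n<p. \<psi> p n ^ 2) \<le> real p / c p" if "A \<in> \<A>" "p \<in> A" for A p
  proof -
    have "(\<Sum>n<p. \<psi> p n ^ 2) = (\<Sum>n<p. if bad p n then ((real p - \<omega> p) / \<omega> p)^2 else 1)"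
      by (intro sum.cong) (auto simp: \<psi>_def power_divide power2_commute)
    also have "\<dots> = real p * ((real p - \<omega> p) / \<omega> p)"
      unfolding sumsplit using \<omega>1[OF that] by (simp add: field_simps power2_eq_square)
    also have "\<dots> \<le> real p * (1 / c p)"
      using com[OF that] \<omega>1[OF that] c[OF that]
      by (intro mult_left_mono) (auto simp: field_simps \<omega>_def)
    finally show ?thesis by simp
  qed
  have \<psi>bd: "\<bar>\<psi> p n\<bar> \<le> real p" if "A \<in> \<A>" "p \<in> A" for A p n
  proof -
    have p1: "real p \<ge> 1" using prime_ge_1_nat[OF pr[OF that]] by linarith
    have "(real p - \<omega> p) / \<omega> p \<le> (real p - \<omega> p) / 1"
      using \<omega>1[OF that] \<omega>p[of p] by (intro divide_left_mono) auto
    also have "\<dots> \<le> real p" using \<omega>1[OF that] by simp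
    finally have "(real p - \<omega> p) / \<omega> p \<le> real p" .
    moreover have "\<bar>- (real p - \<omega> p) / \<omega> p\<bar> = (real p - \<omega> p) / \<omega> p"
      using \<omega>1[OF that] \<omega>p[of p] by (simp add: abs_if field_simps)
    ultimately show ?thesis using p1 unfolding \<psi>_def by auto
  qed
  have \<Psi>bd: "\<bar>\<Psi> A n\<bar> \<le> real Q" if "A \<in> \<A>" for A n
  proof -
    have "\<bar>\<Psi> A n\<bar> = (\<Prod>p\<in>A. \<bar>\<psi> p n\<bar>)" unfolding \<Psi>_def by (rule abs_prod)
    also have "\<dots> \<le> (\<Prod>p\<in>A. real p)" using \<psi>bd that by (intro prod_mono) auto
    also have "\<dots> = real (\<Prod>A)" by simp
    also have "\<dots> \<le> real Q" using Q[OF that] by (rule of_nat_mono)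
    finally show ?thesis .
  qed
  \<comment> \<open>If \<open>A\<close> and \<open>B\<close> differ, a prime in exactly one of them
    contributes a factor of mean zero, and the sum over a full period \<open>D\<close> vanishes. The
    incomplete period costs at most \<open>D\<close> times the maximum of the product, and both are
    at most \<open>Q^2\<close>.\<close>
  have pair: "(\<Sum>n\<in>{a..<a+P}. \<Psi> A n * \<Psi> B n) 
      \<le> (if A = B then real P / C A else 0) + real Q ^ 4"
    if A: "A \<in> \<A>" and B: "B \<in> \<A>" for A B
  proof -
    define S where "S = A \<union> B"
    define f where "f p n = (if p \<in> A then \<psi> p n else 1) * (if p \<in> B then \<psi> p n else 1)" for p n
    have finS: "finite S" and prS: "\<And>p. p \<in> S \<Longrightarrow> prime p"
      unfolding S_def using fin pr A B by auto
    have fper: "f p (n mod p) = f p n" for p n by (simp add: f_def \<psi>per)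
    have eq: "\<Psi> A n * \<Psi> B n = (\<Prod>p\<in>S. f p n)" for n
    proof -
      have "(\<Prod>p\<in>S. f p n) = (\<Prod>p\<in>S. if p \<in> A then \<psi> p n else 1) * (\<Prod>p\<in>S. if p \<in> B then \<psi> p n else 1)"
        unfolding f_def by (rule prod.distrib)
      also have "(\<Prod>p\<in>S. if p \<in> A then \<psi> p n else 1) = \<Psi> A n" unfolding \<Psi>_def
        using finS by (intro prod.mono_neutral_cong_right) (auto simp: S_def)
      also have "(\<Prod>p\<in>S. if p \<in> B then \<psi> p n else 1) = \<Psi> B n" unfolding \<Psi>_def
        using finS by (intro prod.mono_neutral_cong_right) (auto simp: S_def)
      finally show ?thesis by simp
    qed
    define D where "D = \<Prod>S"
    have Dpos: "D > 0" unfolding D_def using prS prime_gt_0_nat by (intro prod_pos) auto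
    have DQ: "real D \<le> real Q ^ 2"
    proof -
      have "D * \<Prod>(A \<inter> B) = \<Prod>A * \<Prod>B"
        unfolding D_def S_def using fin A B by (intro prod.union_inter) auto
      moreover have "\<Prod>(A \<inter> B) \<ge> 1" 
        by (rule prod_ge_1) (use pr A prime_ge_1_nat in blast)
      ultimately have "D \<le> \<Prod>A * \<Prod>B" by (metis mult_le_mono2 mult.right_neutral)
      also have "\<dots> \<le> Q * Q" using Q A B by (intro mult_mono) auto
      finally show ?thesis by (simp add: power2_eq_square flip: of_nat_mult)
    qed
    have val: "(\<Sum>n<D. \<Psi> A n * \<Psi> B n) = (\<Prod>p\<in>S. \<Sum>n<p. f p n)"
      unfolding eq D_def by (rule sum_prod_residues) (use finS prS fper in auto)
    have val2: "(\<Sum>n<D. \<Psi> A n * \<Psi> B n) \<ge> 0 \<and> real P / real D * (\<Sum>n<D. \<Psi> A n * \<Psi> B n) 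
        \<le> (if A = B then real P / C A else 0)"
    proof (cases "A = B")
      case True
      have "(\<Sum>n<D. \<Psi> A n * \<Psi> B n) = (\<Prod>p\<in>A. \<Sum>n<p. \<psi> p n ^ 2)"
        unfolding val using True by (intro prod.cong) (auto simp: S_def f_def power2_eq_square)
      also have "\<dots> \<le> (\<Prod>p\<in>A. real p / c p)"
        using meansq A by (intro prod_mono) (auto intro: sum_nonneg)
      also have "\<dots> = real D / C A"
        using True by (simp add: prod_dividef D_def S_def C_def)
      finally have le: "(\<Sum>n<D. \<Psi> A n * \<Psi> B n) \<le> real D / C A" .
      have "real P / real D * (\<Sum>n<D. \<Psi> A n * \<Psi> B n) \<le> real P / real D * (real D / C A)"
        using le by (intro mult_left_mono) auto
      also have "\<dots> = real P / C A" using Dpos by simp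
      finally show ?thesis using True by (auto intro!: sum_nonneg)
    next
      case False
      then obtain p where p: "p \<in> S" "p \<in> A \<longleftrightarrow> p \<notin> B" unfolding S_def by auto
      have "(\<Sum>n<p. f p n) = (\<Sum>n<p. \<psi> p n)"
        using p by (intro sum.cong) (auto simp: f_def)
      also have "\<dots> = 0" using mean0 p A B by (auto simp: S_def)
      finally have "(\<Prod>p\<in>S. \<Sum>n<p. f p n) = 0" using p finS by (auto intro!: prod_zero)
      then show ?thesis using False val by simp
    qed
    have per: "\<Psi> A (n mod D) * \<Psi> B (n mod D) = \<Psi> A n * \<Psi> B n" for n
      unfolding eq
    proof (rule prod.cong[OF refl])
      fix r assume r: "r \<in> S"
      then have "r dvd D" unfolding D_def using finS by (intro dvd_prodI)
      then have "n mod D mod r = n mod r" by (rule mod_mod_cancel)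
      then show "f r (n mod D) = f r n" using fper[of r "n mod D"] fper[of r n] by metis
    qed
    have bd: "\<bar>\<Psi> A n * \<Psi> B n\<bar> \<le> real Q ^ 2" for n
      unfolding abs_mult power2_eq_square using \<Psi>bd A B by (intro mult_mono) auto
    have "(\<Sum>n\<in>{a..<a+P}. \<Psi> A n * \<Psi> B n) 
        \<le> real P / real D * (\<Sum>n<D. \<Psi> A n * \<Psi> B n) + real D * real Q ^ 2"
      using val2 by (intro sum_periodic_le[where g = "\<lambda>n. \<Psi> A n * \<Psi> B n"] Dpos per bd) auto
    also have "real D * real Q ^ 2 \<le> real Q ^ 2 * real Q ^ 2" using DQ by (intro mult_right_mono) auto
    also have "\<dots> = real Q ^ 4" by (simp flip: power_add)
    finally show ?thesis using val2 by linarith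
  qed
  have FX: "F n = L" if "n \<in> X" for n
  proof -
    have "\<Psi> A n = 1" if "A \<in> \<A>" for A
      unfolding \<Psi>_def using X(2)[OF that _ \<open>n \<in> X\<close>] by (intro prod.neutral) (auto simp: \<psi>_def)
    then show ?thesis unfolding F_def L_def C_def by simp
  qed
  \<comment> \<open>\<open>F\<close> equals \<open>L\<close> on the sifted set, so its second moment
    over the whole interval is an upper bound. With the coefficients \<open>C A\<close> each
    diagonal term becomes \<open>C A ^ 2 * (P / C A)\<close>, and these add up to
    \<open>P * L\<close>.\<close>
  have "real (card X) * L^2 = (\<Sum>n\<in>X. F n ^ 2)" using FX by simp
  also have "\<dots> \<le> (\<Sum>n\<in>{a..<a+P}. F n ^ 2)" using X by (intro sum_mono2) auto
  also have "\<dots> = (\<Sum>n\<in>{a..<a+P}. \<Sum>A\<in>\<A>. \<Sum>B\<in>\<A>. C A * C B * (\<Psi> A n * \<Psi> B n))"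
    unfolding F_def power2_eq_square by (simp add: sum_product algebra_simps)
  also have "\<dots> = (\<Sum>A\<in>\<A>. \<Sum>n\<in>{a..<a+P}. \<Sum>B\<in>\<A>. C A * C B * (\<Psi> A n * \<Psi> B n))"
    by (rule sum.swap)
  also have "\<dots> = (\<Sum>A\<in>\<A>. \<Sum>B\<in>\<A>. \<Sum>n\<in>{a..<a+P}. C A * C B * (\<Psi> A n * \<Psi> B n))"
    by (intro sum.cong refl sum.swap)
  also have "\<dots> = (\<Sum>A\<in>\<A>. \<Sum>B\<in>\<A>. C A * C B * (\<Sum>n\<in>{a..<a+P}. \<Psi> A n * \<Psi> B n))"
    by (simp add: sum_distrib_left)
  also have "\<dots> \<le> (\<Sum>A\<in>\<A>. \<Sum>B\<in>\<A>. C A * C B * ((if A = B then real P / C A else 0) + real Q ^ 4))"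
    using pair Cpos by (intro sum_mono mult_left_mono) (auto simp: less_imp_le)
  also have "\<dots> = (\<Sum>A\<in>\<A>. \<Sum>B\<in>\<A>. (if A = B then real P * C A else 0) + C A * C B * real Q ^ 4)"
    using Cpos by (intro sum.cong refl) (auto simp: field_simps less_imp_neq[symmetric])
  also have "\<dots> = real P * L + L^2 * real Q ^ 4"
    by (simp add: sum.distrib fin L_def C_def power2_eq_square sum_product sum_distrib_left sum_distrib_right algebra_simps)
  finally show ?thesis .
qed

section \<open>Squarefree numbers as sets of primes, and a lower bound for the sieve sum\<close>

definition prime_sets :: "nat \<Rightarrow> nat set set" where
  "prime_sets z = {A. finite A \<and> (\<forall>p\<in>A. prime p) \<and> \<Prod>A \<le> z}"

lemma prime_setsD:
  assumes "A \<in> prime_sets z"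
  shows "finite A" "p \<in> A \<Longrightarrow> prime p" "\<Prod>A \<le> z" "\<Prod>A > 0" "p \<in> A \<Longrightarrow> p \<le> z"
proof -
  show 1: "finite A" "p \<in> A \<Longrightarrow> prime p" "\<Prod>A \<le> z" for p
    using assms by (auto simp: prime_sets_def)
  show 2: "\<Prod>A > 0" using 1(2) prime_gt_0_nat by (intro prod_pos) auto
  show "p \<le> z" if "p \<in> A"
  proof -
    have "p dvd \<Prod>A" using 1(1) that by (intro dvd_prodI)
    then show ?thesis using dvd_imp_le[OF _ 2] 1(3) le_trans by blast
  qed
qed

lemma finite_prime_sets: "finite (prime_sets z)"
  by (rule finite_subset[of _ "Pow {..z}"]) (use prime_setsD(5) in blast, simp)

lemma prime_factors_prod_primes:
  fixes A :: "nat set"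
  assumes "finite A" "\<forall>p\<in>A. prime p"
  shows "prime_factors (\<Prod>A) = A"
proof -
  have "prime_factors (\<Prod>p\<in>A. p) = (\<Union>p\<in>A. prime_factors p)"
    using assms by (subst prime_factors_prod) auto
  also have "\<dots> = A" using assms by (auto simp: prime_factorization_prime)
  finally show ?thesis by simp
qed

lemma prod_prime_factors_squarefree:
  fixes n :: nat
  assumes "squarefree n"
  shows "\<Prod>(prime_factors n) = n"
proof -
  have n0: "n \<noteq> 0" using assms not_squarefree_0 by metis
  have "n = (\<Prod>p\<in>prime_factors n. p ^ multiplicity p n)"
    using n0 prime_factorization_nat by auto
  also have "\<dots> = (\<Prod>p\<in>prime_factors n. p)"
    using assms n0 by (intro prod.cong refl) (auto simp: squarefree_factorial_semiring')
  finally show ?thesis by simp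
qed

lemma sum_inverse_squares_le: "(\<Sum>u=1..z. 1 / real u ^ 2) \<le> 2"
proof -
  have "(\<Sum>u=1..z. 1 / real u ^ 2) \<le> 2 - 1 / real z"
  proof (induction z)
    case (Suc z)
    show ?case
    proof (cases "z = 0")
      case False
      then have "1 / (real z + 1)^2 + 1 / (real z + 1) \<le> 1 / real z"
        by (simp add: divide_simps) (simp add: algebra_simps power2_eq_square)
      then show ?thesis using Suc by (simp add: algebra_simps)
    qed simp
  qed simp
  also have "\<dots> \<le> 2" by simp
  finally show ?thesis .
qed

lemma prod_real_nonneg: "prod real A \<ge> 0"
  by (rule prod_nonneg) simp

text \<open>A set of primes stands for the squarefree number that is its product, so that sieve
  weights become products over the set. Every \<open>n\<close> is a squarefree number times a square
  \<open>u^2\<close>, and the sum of \<open>1 / u^2\<close> is at most 2.\<close>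

lemma harm_le_sum_prime_sets: "harm z \<le> 2 * (\<Sum>A\<in>prime_sets z. 1 / real (\<Prod>A))"
proof -
  have "(harm z :: real) = (\<Sum>n=1..z. 1 / real n)" by (simp add: harm_def divide_inverse)
  also have "\<dots> \<le> (\<Sum>(A,u)\<in>prime_sets z \<times> {1..z}. 1 / real (\<Prod>A) * (1 / real u ^ 2))"
  proof (rule sum_le_included[where i = "\<lambda>(A,u). \<Prod>A * u^2"])
    show "\<forall>n\<in>{1..z}. \<exists>y\<in>prime_sets z \<times> {1..z}. (case y of (A, u) \<Rightarrow> \<Prod>A * u^2) = n \<and>
      1 / real n \<le> (case y of (A, u) \<Rightarrow> 1 / real (\<Prod>A) * (1 / real u ^ 2))"
    proof
      fix n assume n: "n \<in> {1..z}"
      define s u where "s = squarefree_part n" and "u = square_part n"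
      have nsu: "n = s * u^2" unfolding s_def u_def by (rule squarefree_decompose)
      have s: "\<Prod>(prime_factors s) = s" 
        unfolding s_def by (intro prod_prime_factors_squarefree squarefree_squarefree_part)
      have pos: "s > 0" "u > 0" using n nsu by (auto intro!: Nat.gr0I)
      have "s \<le> n" "u \<le> n" unfolding nsu using pos
        by (auto simp: power2_eq_square)
      then have "(prime_factors s, u) \<in> prime_sets z \<times> {1..z}"
        using n pos s by (auto simp: prime_sets_def)
      then show "\<exists>y\<in>prime_sets z \<times> {1..z}. (case y of (A, u) \<Rightarrow> \<Prod>A * u^2) = n \<and>
        1 / real n \<le> (case y of (A, u) \<Rightarrow> 1 / real (\<Prod>A) * (1 / real u ^ 2))"
        using s nsu by (intro bexI[of _ "(prime_factors s, u)"]) (auto simp del: of_nat_prod)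
    qed
  qed (auto simp: finite_prime_sets prod_real_nonneg)
  also have "\<dots> = (\<Sum>A\<in>prime_sets z. 1 / real (\<Prod>A)) * (\<Sum>u=1..z. 1 / real u ^ 2)"
    by (simp only: sum_product sum.cartesian_product)
  also have "\<dots> \<le> (\<Sum>A\<in>prime_sets z. 1 / real (\<Prod>A)) * 2"
    by (intro mult_left_mono sum_inverse_squares_le sum_nonneg) (simp add: prod_real_nonneg)
  finally show ?thesis by simp
qed

text \<open>A pair \<open>S\<close>, \<open>T\<close> is recovered from its intersection
  \<open>G\<close>, its symmetric difference \<open>A\<close> and the part \<open>B\<close> of
  \<open>A\<close> that belongs to \<open>S\<close>. The product of the two numbers is
  \<open>\<Prod>G ^ 2 * \<Prod>A\<close>. The \<open>2 ^ card A\<close> choices of \<open>B\<close>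
  give the numerator, and the sum over \<open>G\<close> is at most 2. This is how the sieve reaches
  the second power of the logarithm.\<close>

lemma square_sum_prime_sets_le:
  "(\<Sum>A\<in>prime_sets z. 1 / real (\<Prod>A))^2 \<le> 2 * (\<Sum>A\<in>prime_sets (z^2). 2 ^ card A / real (\<Prod>A))"
proof -
  let ?t = "prime_sets z \<times> Sigma (prime_sets (z^2)) Pow"
  have "(\<Sum>A\<in>prime_sets z. 1 / real (\<Prod>A))^2 
      = (\<Sum>(S,T)\<in>prime_sets z \<times> prime_sets z. 1 / real (\<Prod>S) * (1 / real (\<Prod>T)))"
    by (simp only: power2_eq_square sum_product sum.cartesian_product)
  also have "\<dots> \<le> (\<Sum>(G,A,B)\<in>?t. 1 / real (\<Prod>G)^2 * (1 / real (\<Prod>A)))"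
  proof (rule sum_le_included[where i = "\<lambda>(G,A,B). (G \<union> B, G \<union> (A - B))"])
    show "finite ?t"
      using finite_prime_sets prime_setsD(1) by (intro finite_cartesian_product finite_SigmaI) auto
    show "\<forall>x\<in>prime_sets z \<times> prime_sets z. \<exists>y\<in>?t. (case y of (G,A,B) \<Rightarrow> (G \<union> B, G \<union> (A - B))) = x \<and>
       (case x of (S,T) \<Rightarrow> 1 / real (\<Prod>S) * (1 / real (\<Prod>T))) 
        \<le> (case y of (G,A,B) \<Rightarrow> 1 / real (\<Prod>G)^2 * (1 / real (\<Prod>A)))"
    proof safe
      fix S T assume S: "S \<in> prime_sets z" and T: "T \<in> prime_sets z"
      define G B A where "G = S \<inter> T" and "B = S - T" and "A = (S - T) \<union> (T - S)"
      note finS = prime_setsD(1)[OF S] and finT = prime_setsD(1)[OF T]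
      have pS: "\<Prod>S = \<Prod>G * \<Prod>(S - T)" unfolding G_def
        using finS prod.Int_Diff[of S "\<lambda>x. x" T] by simp
      have pT: "\<Prod>T = \<Prod>G * \<Prod>(T - S)" unfolding G_def
        using finT prod.Int_Diff[of T "\<lambda>x. x" S] by (simp add: Int_commute)
      have pA: "\<Prod>A = \<Prod>(S - T) * \<Prod>(T - S)" unfolding A_def
        using finS finT by (intro prod.union_disjoint) auto
      have le: "\<Prod>X \<le> \<Prod>Y" if "X \<subseteq> Y" "Y \<in> prime_sets z" for X Y
      proof -
        have "\<Prod>X dvd \<Prod>Y" using that prime_setsD(1)[OF that(2)] by (intro prod_dvd_prod_subset) auto
        then show ?thesis using prime_setsD(4)[OF that(2)] by (intro dvd_imp_le)
      qed
      have "\<Prod>A \<le> \<Prod>S * \<Prod>T" unfolding pA using S T by (intro mult_mono le) auto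
      also have "\<dots> \<le> z^2" unfolding power2_eq_square using prime_setsD(3) S T by (intro mult_mono) auto
      finally have 1: "\<Prod>A \<le> z^2" .
      have "finite A \<and> (\<forall>p\<in>A. prime p)"
        unfolding A_def using finS finT prime_setsD(2)[OF S] prime_setsD(2)[OF T] by blast
      with 1 have "A \<in> prime_sets (z^2)" by (simp add: prime_sets_def)
      moreover have "G \<in> prime_sets z"
      proof -
        have "\<Prod>G \<le> \<Prod>S" by (rule le[OF _ S]) (simp add: G_def)
        moreover have "finite G \<and> (\<forall>p\<in>G. prime p)"
          unfolding G_def using finS prime_setsD(2)[OF S] by blast
        ultimately show ?thesis using prime_setsD(3)[OF S] by (simp add: prime_sets_def)
      qed
      moreover have "real (\<Prod>S) * real (\<Prod>T) = real (\<Prod>G)^2 * real (\<Prod>A)"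
        by (simp only: pS pT pA of_nat_mult power2_eq_square mult.assoc mult.left_commute)
      moreover have "G \<union> B = S" "G \<union> (A - B) = T" "B \<subseteq> A" unfolding G_def A_def B_def by auto
      ultimately show "\<exists>y\<in>?t. (case y of (G,A,B) \<Rightarrow> (G \<union> B, G \<union> (A - B))) = (S,T) \<and>
         1 / real (\<Prod>S) * (1 / real (\<Prod>T)) \<le> (case y of (G,A,B) \<Rightarrow> 1 / real (\<Prod>G)^2 * (1 / real (\<Prod>A)))"
        by (intro bexI[of _ "(G,A,B)"]) (auto simp del: of_nat_prod)
    qed
  qed (auto simp: finite_prime_sets prod_real_nonneg)
  also have "\<dots> = (\<Sum>G\<in>prime_sets z. 1 / real (\<Prod>G)^2) * (\<Sum>A\<in>prime_sets (z^2). \<Sum>B\<in>Pow A. 1 / real (\<Prod>A))"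
  proof -
    have "(\<Sum>A\<in>prime_sets (z^2). \<Sum>B\<in>Pow A. 1 / real (\<Prod>A)) 
        = (\<Sum>(A,B)\<in>Sigma (prime_sets (z^2)) Pow. 1 / real (\<Prod>A))"
      using finite_prime_sets prime_setsD(1) by (intro sum.Sigma) auto
    then show ?thesis
      by (simp only: sum_product sum.cartesian_product) (intro sum.cong, auto)
  qed
  also have "(\<Sum>A\<in>prime_sets (z^2). \<Sum>B\<in>Pow A. 1 / real (\<Prod>A)) 
      = (\<Sum>A\<in>prime_sets (z^2). 2 ^ card A / real (\<Prod>A))"
    using prime_setsD(1) by (intro sum.cong refl) (auto simp: card_Pow)
  also have "(\<Sum>G\<in>prime_sets z. 1 / real (\<Prod>G)^2) \<le> (\<Sum>u=1..z. 1 / real u ^ 2)"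
  proof (rule sum_le_included[where i = prime_factors])
    show "\<forall>G\<in>prime_sets z. \<exists>u\<in>{1..z}. prime_factors u = G \<and> 1 / real (\<Prod>G)^2 \<le> 1 / real u ^ 2"
    proof
      fix G assume G: "G \<in> prime_sets z"
      then show "\<exists>u\<in>{1..z}. prime_factors u = G \<and> 1 / real (\<Prod>G)^2 \<le> 1 / real u ^ 2"
        using prime_setsD[OF G] by (intro bexI[of _ "\<Prod>G"]) (auto simp: prime_factors_prod_primes Suc_le_eq)
    qed
  qed (auto simp: finite_prime_sets)
  also have "\<dots> \<le> 2" by (rule sum_inverse_squares_le)
  finally show ?thesis by (simp add: mult_right_mono sum_nonneg prod_real_nonneg)
qed

lemma prod_primes_dvd_iff:
  fixes A :: "nat set"
  assumes "finite A" "\<forall>p\<in>A. prime p"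
  shows "\<Prod>A dvd h \<longleftrightarrow> (\<forall>p\<in>A. p dvd h)"
  using assms
proof (induction A rule: finite_induct)
  case (insert p A)
  have "coprime p (\<Prod>A)"
    using insert by (intro prod_coprime_right) (metis insertCI primes_coprime)
  then have "p * \<Prod>A dvd h \<longleftrightarrow> p dvd h \<and> \<Prod>A dvd h" 
    by (meson divides_mult dvd_mult_left dvd_mult_right)
  then show ?case using insert by auto
qed simp

text \<open>A lower bound for the Selberg weight \<open>\<omega> / (p - \<omega>)\<close>, where
  \<open>\<omega>\<close> counts the classes sifted out modulo \<open>p\<close>: in general 0 and
  \<open>-h\<close>, which coincide when \<open>p\<close> divides \<open>h\<close>.\<close>

definition pair_weight :: "nat \<Rightarrow> nat \<Rightarrow> real" where
  "pair_weight h p = (if p dvd h then 1 / real p else 2 / real p)"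

text \<open>For primes dividing \<open>h\<close> the factor 2 is missing in
  \<open>pair_weight\<close>. Writing it as 1 + 1 for each of them yields a sum over subsets
  \<open>E\<close> of these primes: the primes in \<open>E\<close> form a divisor of
  \<open>h\<close>, all others keep their weight. The divisor sum is thus the price for the primes
  dividing \<open>h\<close>.\<close>

lemma sum_prime_sets_le_pair_weight:
  assumes "h > 0"
  shows "(\<Sum>A\<in>prime_sets Q. 2 ^ card A / real (\<Prod>A)) 
    \<le> (\<Sum>d | d dvd h. 1 / real d) * (\<Sum>A\<in>prime_sets Q. \<Prod>p\<in>A. pair_weight h p)"
proof -
  define H where "H A = {p\<in>A. p dvd h}" for A
  have finH: "finite {d. d dvd h}" using assms by simp
  have "(\<Sum>A\<in>prime_sets Q. 2 ^ card A / real (\<Prod>A)) 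
     = (\<Sum>A\<in>prime_sets Q. \<Sum>E\<in>Pow (H A). 1 / real (\<Prod>E) * (\<Prod>p\<in>A-E. pair_weight h p))"
  proof (intro sum.cong refl)
    fix A assume A: "A \<in> prime_sets Q"
    note fin = prime_setsD(1)[OF A]
    have "1 / real (\<Prod>E) * (\<Prod>p\<in>A-E. pair_weight h p) = 2 ^ card (A - H A) / real (\<Prod>A)"
      if E: "E \<in> Pow (H A)" for E
    proof -
      have HA: "E \<subseteq> H A" "H A \<subseteq> A" using E by (auto simp: H_def)
      have "(\<Prod>p\<in>A-E. pair_weight h p) = (\<Prod>p\<in>A-E. (if p \<in> A - H A then 2 else 1) / real p)"
        by (intro prod.cong refl) (auto simp: pair_weight_def H_def)
      also have "\<dots> = (\<Prod>p\<in>A-E. if p \<in> A - H A then 2 else 1) / real (\<Prod>(A-E))"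
        by (simp add: prod_dividef)
      also have "(\<Prod>p\<in>A-E. if p \<in> A - H A then 2 else 1) = (\<Prod>p\<in>A-H A. 2::real)"
        using HA fin by (intro prod.mono_neutral_cong_right) auto
      finally have 1: "(\<Prod>p\<in>A-E. pair_weight h p) = 2 ^ card (A - H A) / real (\<Prod>(A-E))" by simp
      have "E \<subseteq> A" using HA by auto
      have "\<Prod>A = \<Prod>(A-E) * \<Prod>E"
        using prod.subset_diff[OF \<open>E \<subseteq> A\<close> fin, of "\<lambda>x. x"] by simp
      then have "real (\<Prod>A) = real (\<Prod>(A-E)) * real (\<Prod>E)" by (simp only: of_nat_mult)
      then show ?thesis unfolding 1 by simp
    qed
    then have "(\<Sum>E\<in>Pow (H A). 1 / real (\<Prod>E) * (\<Prod>p\<in>A-E. pair_weight h p)) 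
       = (\<Sum>E\<in>Pow (H A). 2 ^ card (A - H A) / real (\<Prod>A))"
      by (intro sum.cong refl)
    also have "\<dots> = 2 ^ card (H A) * (2 ^ card (A - H A) / real (\<Prod>A))"
      using fin by (simp add: card_Pow H_def)
    also have "\<dots> = 2 ^ card A / real (\<Prod>A)"
    proof -
      have "card A = card (H A \<union> (A - H A))" by (rule arg_cong[where f = card]) (auto simp: H_def)
      also have "\<dots> = card (H A) + card (A - H A)" 
        using fin by (intro card_Un_disjoint) (auto simp: H_def)
      finally show ?thesis by (simp add: power_add)
    qed
    finally show "2 ^ card A / real (\<Prod>A) 
        = (\<Sum>E\<in>Pow (H A). 1 / real (\<Prod>E) * (\<Prod>p\<in>A-E. pair_weight h p))" by simp
  qed
  also have "\<dots> = (\<Sum>(A,E)\<in>Sigma (prime_sets Q) (\<lambda>A. Pow (H A)). 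
      1 / real (\<Prod>E) * (\<Prod>p\<in>A-E. pair_weight h p))"
    using finite_prime_sets prime_setsD(1) by (subst sum.Sigma) (auto simp: H_def)
  also have "\<dots> \<le> (\<Sum>(d,A)\<in>{d. d dvd h} \<times> prime_sets Q. 1 / real d * (\<Prod>p\<in>A. pair_weight h p))"
  proof (rule sum_le_included[where i = "\<lambda>(d,A). (A \<union> prime_factors d, prime_factors d)"])
    show "\<forall>x\<in>Sigma (prime_sets Q) (\<lambda>A. Pow (H A)). \<exists>y\<in>{d. d dvd h} \<times> prime_sets Q.
       (case y of (d, A) \<Rightarrow> (A \<union> prime_factors d, prime_factors d)) = x \<and>
       (case x of (A, E) \<Rightarrow> 1 / real (\<Prod>E) * (\<Prod>p\<in>A-E. pair_weight h p))
       \<le> (case y of (d, A) \<Rightarrow> 1 / real d * (\<Prod>p\<in>A. pair_weight h p))"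
    proof safe
      fix A E assume A: "A \<in> prime_sets Q" and E: "E \<subseteq> H A"
      have fE: "finite E" "\<forall>p\<in>E. prime p" "\<forall>p\<in>E. p dvd h" "E \<subseteq> A"
        using prime_setsD(1,2)[OF A] E finite_subset[of E A] by (auto simp: H_def)
      have "\<Prod>E dvd h" using prod_primes_dvd_iff fE by auto
      moreover have "A - E \<in> prime_sets Q"
      proof -
        have "\<Prod>(A - E) dvd \<Prod>A" using prime_setsD(1)[OF A] by (intro prod_dvd_prod_subset) auto
        then have "\<Prod>(A - E) \<le> Q" using prime_setsD(3,4)[OF A] dvd_imp_le le_trans by blast
        then show ?thesis using prime_setsD(1,2)[OF A] by (simp add: prime_sets_def)
      qed
      moreover have "prime_factors (\<Prod>E) = E" using fE by (intro prime_factors_prod_primes)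
      ultimately have y: "(\<Prod>E, A - E) \<in> {d. d dvd h} \<times> prime_sets Q" and pf: "prime_factors (\<Prod>E) = E"
        by simp_all
      have "A - E \<union> E = A" using fE(4) by auto
      then show "\<exists>y\<in>{d. d dvd h} \<times> prime_sets Q.
         (case y of (d, A) \<Rightarrow> (A \<union> prime_factors d, prime_factors d)) = (A, E) \<and>
         1 / real (\<Prod>E) * (\<Prod>p\<in>A-E. pair_weight h p) \<le> (case y of (d, A) \<Rightarrow> 1 / real d * (\<Prod>p\<in>A. pair_weight h p))"
        using y by (intro bexI[OF _ y]) (simp only: prod.case pf order.refl simp_thms)
    qed
  qed (use finH finite_prime_sets prime_setsD(1) in \<open>auto simp: H_def pair_weight_def intro!: divide_nonneg_nonneg prod_nonneg\<close>)
  also have "\<dots> = (\<Sum>d | d dvd h. 1 / real d) * (\<Sum>A\<in>prime_sets Q. \<Prod>p\<in>A. pair_weight h p)"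
    by (simp only: sum_product sum.cartesian_product)
  finally show ?thesis .
qed

text \<open>Squaring raises the level from \<open>2^u\<close> to \<open>4^u\<close>. The constant is
  72 = 2 * 6^2: the bound \<open>(u + 1) / 3\<close> for the harmonic number is halved by the
  passage to squarefree numbers, squared, and halved again.\<close>

lemma pair_weight_sum_ge:
  assumes "h > 0"
  shows "(real u + 1)^2 / 72 \<le> (\<Sum>d | d dvd h. 1 / real d) * (\<Sum>A\<in>prime_sets (4^u). \<Prod>p\<in>A. pair_weight h p)"
proof -
  have l2: "ln (2::real) \<ge> 2/3" using ln2_ge_two_thirds .
  have "real u * ln 2 = ln (2 ^ u)" by (simp add: ln_realpow)
  also have "\<dots> \<le> ln (real (2^u) + 1)" by (subst ln_le_cancel_iff) (auto simp: add_pos_pos)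
  also have "\<dots> \<le> harm (2^u)" by (rule ln_le_harm)
  finally have "real u * (2/3) \<le> harm (2^u)" using l2 mult_left_mono[of "2/3" "ln 2" "real u"] by simp
  moreover have "1 \<le> (harm (2^u) :: real)" using harm_mono[of 1 "2^u", where ?'a = real] by (simp add: harm_expand)
  ultimately have "(real u + 1) / 3 \<le> harm (2^u)" by argo
  also have "\<dots> \<le> 2 * (\<Sum>A\<in>prime_sets (2^u). 1 / real (\<Prod>A))" by (rule harm_le_sum_prime_sets)
  finally have "(real u + 1) / 6 \<le> (\<Sum>A\<in>prime_sets (2^u). 1 / real (\<Prod>A))" by simp
  then have "((real u + 1) / 6)^2 \<le> (\<Sum>A\<in>prime_sets (2^u). 1 / real (\<Prod>A))^2" by (intro power_mono) auto
  also have "\<dots> \<le> 2 * (\<Sum>A\<in>prime_sets ((2^u)^2). 2 ^ card A / real (\<Prod>A))"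
    by (rule square_sum_prime_sets_le)
  also have "((2::nat)^u)^2 = 4^u" by (simp add: power2_eq_square flip: power_mult_distrib)
  finally have "(real u + 1)^2 / 72 \<le> (\<Sum>A\<in>prime_sets (4^u). 2 ^ card A / real (\<Prod>A))"
    by (simp add: power_divide)
  also have "\<dots> \<le> (\<Sum>d | d dvd h. 1 / real d) * (\<Sum>A\<in>prime_sets (4^u). \<Prod>p\<in>A. pair_weight h p)"
    by (rule sum_prime_sets_le_pair_weight[OF assms])
  finally show ?thesis .
qed

section \<open>Correlations of the von Mangoldt function\<close>

text \<open>The upper end \<open>2 * P - h\<close> keeps \<open>d + h\<close> in the same dyadic
  interval as \<open>d\<close>; for \<open>h \<ge> P\<close> the range is empty.\<close>

definition mangoldt_pairs :: "nat \<Rightarrow> nat \<Rightarrow> real" where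
  "mangoldt_pairs P h = (\<Sum>d\<in>{P..<2*P-h}. mangoldt d * mangoldt (d + h))"

text \<open>These are the prime powers that a sieve by the primes up to \<open>Q\<close> removes
  although \<open>mangoldt\<close> does not vanish on them. Base and exponent determine them, and
  the exponent is at most \<open>i\<close>.\<close>

lemma card_small_primepows:
  "card {n. n < 2^(i+1) \<and> primepow n \<and> (\<exists>p\<le>Q. prime p \<and> p dvd n)} \<le> (Q+1) * (i+1)" (is "card ?Y \<le> _")
    and finite_small_primepows: "finite {n::nat. n < 2^(i+1) \<and> primepow n \<and> (\<exists>p\<le>Q. prime p \<and> p dvd n)}"
proof -
  have "?Y \<subseteq> (\<lambda>(p,k). p ^ k) ` ({..Q} \<times> {..i})"
  proof
    fix n assume "n \<in> ?Y"
    then obtain p where n: "n < 2^(i+1)" "primepow n" and p: "p \<le> Q" "prime p" "p dvd n" by auto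
    from n(2) obtain r k where r: "prime r" "n = r ^ k" by (auto simp: primepow_def)
    with p have "p = r" using prime_dvd_power primes_dvd_imp_eq by blast
    have "2 ^ k \<le> r ^ k" using prime_ge_2_nat[OF r(1)] by (rule power_mono) simp
    then have "(2::nat) ^ k < 2 ^ (i+1)" using n r by linarith
    then have "k < i + 1" by (rule power_less_imp_less_exp[rotated]) simp
    then have "k \<le> i" by simp
    then show "n \<in> (\<lambda>(p,k). p ^ k) ` ({..Q} \<times> {..i})" using p r \<open>p = r\<close> by auto
  qed
  then have "card ?Y \<le> card ((\<lambda>(p,k). p ^ k) ` ({..Q} \<times> {..i}))" by (intro card_mono) auto
  also have "\<dots> \<le> card ({..Q} \<times> {..i})" by (intro card_image_le) auto
  finally show "card ?Y \<le> (Q+1) * (i+1)" by simp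
  show "finite ?Y" by (rule finite_subset[of _ "{..<2^(i+1)}"]) auto
qed

lemma card_pair_sifted_le:
  fixes h u P a :: nat
  assumes h: "h > 0"
  defines "X \<equiv> {n\<in>{a..<a+P}. \<forall>p\<le>4^u. prime p \<longrightarrow> \<not> p dvd n \<and> \<not> p dvd n + h}"
  shows "real (card X) \<le> 72 * real P * (\<Sum>d | d dvd h. 1 / real d) / (real u + 1)^2 + (2 ^ (8 * u))"
proof -
  \<comment> \<open>For \<open>p = 2\<close> and odd \<open>h\<close> the two conditions together
    would forbid every class. With the first one alone a single class is bad, and this still
    supports the weight 2/2 = 1.\<close>
  define bad where "bad p n \<longleftrightarrow> p dvd n \<or> (p \<noteq> 2 \<and> p dvd n + h)" for p n :: nat
  define L where "L = (\<Sum>A\<in>prime_sets (4^u). \<Prod>p\<in>A. pair_weight h p)"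
  define \<sigma> where "\<sigma> = (\<Sum>d | d dvd h. 1 / real d)"
  have Ls: "(real u + 1)^2 / 72 \<le> \<sigma> * L"
    unfolding \<sigma>_def L_def by (rule pair_weight_sum_ge[OF h])
  have "\<sigma> \<ge> 0" unfolding \<sigma>_def by (intro sum_nonneg) auto
  moreover have "(real u + 1)^2 / 72 > 0" by simp
  ultimately have Lpos: "L > 0" "\<sigma> > 0" using Ls
    by (smt (verit) mult_nonneg_nonpos mult_eq_0_iff)+
  have om: "card {n\<in>{..<p}. bad p n} \<ge> 1" if "prime p" for p
  proof -
    have "0 \<in> {n\<in>{..<p}. bad p n}" using prime_gt_0_nat[OF that] by (auto simp: bad_def)
    then show ?thesis by (metis (no_types, lifting) One_nat_def Suc_leI card_gt_0_iff empty_iff finite_lessThan finite_Collect_conjI finite_subset mem_Collect_eq subsetI)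
  qed
  have com: "pair_weight h p * (real p - card {n\<in>{..<p}. bad p n}) \<le> card {n\<in>{..<p}. bad p n}"
    if p: "prime p" for p
  proof -
    define \<omega> where "\<omega> = real (card {n\<in>{..<p}. bad p n})"
    have p2: "real p \<ge> 2" using prime_ge_2_nat[OF p] by linarith
    have \<omega>1: "\<omega> \<ge> 1" using om[OF p] unfolding \<omega>_def by linarith
    consider "p dvd h" | "\<not> p dvd h" "p = 2" | "\<not> p dvd h" "p \<noteq> 2" by blast
    then have "pair_weight h p * (real p - \<omega>) \<le> \<omega>"
    proof cases
      case 1
      have "(real p - \<omega>) \<le> \<omega> * real p"
        using \<omega>1 p2 mult_right_mono[of 1 \<omega> "real p"] by linarith
      then show ?thesis using 1 p2 by (simp add: pair_weight_def field_simps)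
    next
      case 2
      then show ?thesis using \<omega>1 by (simp add: pair_weight_def)
    next
      case 3
      \<comment> \<open>The class of \<open>-h\<close>, which differs from 0 because
        \<open>p\<close> does not divide \<open>h\<close>.\<close>
      define m where "m = p - h mod p"
      have hm: "h mod p < p" "h mod p \<noteq> 0" using 3 p2 by (auto simp: mod_eq_0_iff_dvd)
      have "p dvd m + h"
      proof -
        have "m + h = p + (h - h mod p)" using hm(1) by (simp add: m_def)
        moreover have "p dvd h - h mod p" by (rule dvd_minus_mod)
        ultimately show ?thesis by (metis dvd_add dvd_refl)
      qed
      then have "{0, m} \<subseteq> {n\<in>{..<p}. bad p n}"
        using 3 hm p2 by (auto simp: bad_def m_def)
      then have "card {0, m} \<le> card {n\<in>{..<p}. bad p n}" by (intro card_mono) auto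
      moreover have "card {0, m} = 2" using hm by (auto simp: m_def)
      ultimately have "\<omega> \<ge> 2" unfolding \<omega>_def by linarith
      then have "2 * (real p - \<omega>) \<le> \<omega> * real p" 
        using mult_right_mono[OF \<open>\<omega> \<ge> 2\<close>, of "real p"] \<omega>1 by simp
      then show ?thesis using 3 p2 by (simp add: pair_weight_def field_simps)
    qed
    then show ?thesis by (simp add: \<omega>_def)
  qed
  have "real (card X) * L^2 \<le> real P * L + L^2 * real (4^u) ^ 4"
    unfolding L_def
  proof (rule sifted_set_upper_bound[where bad = bad and a = a])
    show "finite (prime_sets (4^u))" by (rule finite_prime_sets)
    show "bad p (n mod p) = bad p n" for p n
    proof -
      have "(n mod p + h) mod p = (n + h) mod p" by (rule mod_add_left_eq)
      then show ?thesis by (simp add: bad_def dvd_eq_mod_eq_0)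
    qed
    fix A assume A: "A \<in> prime_sets (4^u)"
    show "finite A" "\<Prod>A \<le> 4^u" using prime_setsD[OF A] by auto
    fix p assume p: "p \<in> A"
    then have pp: "prime p" "p \<le> 4^u" using prime_setsD[OF A] by auto
    show "prime p" by fact
    show "pair_weight h p > 0" using prime_gt_0_nat[OF pp(1)] by (simp add: pair_weight_def)
    show "1 \<le> card {n \<in> {..<p}. bad p n}" by (rule om[OF pp(1)])
    show "pair_weight h p * (real p - real (card {n \<in> {..<p}. bad p n})) \<le> real (card {n \<in> {..<p}. bad p n})"
      by (rule com[OF pp(1)])
    show "\<not> bad p n" if "n \<in> X" for n using that pp by (auto simp: X_def bad_def)
  qed (auto simp: X_def)
  also have "\<dots> = (real P / L + real (4^u) ^ 4) * L^2" using Lpos by (simp add: field_simps power2_eq_square)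
  finally have "real (card X) \<le> real P / L + real (4^u) ^ 4" using Lpos by (simp add: mult_le_cancel_right)
  also have "real P / L \<le> 72 * real P * \<sigma> / (real u + 1)^2"
  proof -
    have "1 / L \<le> 72 * \<sigma> / (real u + 1)^2" using Ls Lpos by (simp add: field_simps)
    then have "real P * (1 / L) \<le> real P * (72 * \<sigma> / (real u + 1)^2)" by (intro mult_left_mono) auto
    then show ?thesis by (simp add: field_simps)
  qed
  also have "real (4^u) ^ 4 = 2 ^ (8 * u)"
  proof -
    have "(4::real) = 2 ^ 2" by simp
    then show ?thesis by (simp only: of_nat_power of_nat_numeral flip: power_mult) (simp add: mult.commute)
  qed
  finally show ?thesis unfolding \<sigma>_def by simp
qed

lemma cube_le_exp_half: "\<exists>K>0. \<forall>i::nat. (real i + 1)^3 \<le> K * sqrt (2 ^ i)"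
proof -
  have "((\<lambda>i::nat. (real i + 1)^3 / sqrt (2 ^ i)) \<longlongrightarrow> 0) sequentially" by real_asymp
  then have "Bseq (\<lambda>i::nat. (real i + 1)^3 / sqrt (2 ^ i))" 
    by (intro convergent_imp_Bseq) (auto simp: convergent_def)
  then obtain K where K: "K > 0" "\<And>i::nat. norm ((real i + 1)^3 / sqrt (2 ^ i)) \<le> K"
    by (auto simp: Bseq_def)
  have "(real i + 1)^3 \<le> K * sqrt (2 ^ i)" for i
    using K(2)[of i] by (simp add: field_simps abs_if split: if_splits)
  then show ?thesis using K(1) by blast
qed

text \<open>The two factors \<open>mangoldt\<close> cost \<open>(i + 1)^2\<close>, which is
  cancelled by the saving \<open>(u + 1)^2\<close> of the sieve as soon as \<open>u\<close> is
  proportional to \<open>i\<close>.\<close>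

lemma mangoldt_pairs_le:
  "\<exists>K>0. \<forall>i h::nat. h > 0 \<longrightarrow> mangoldt_pairs (2^i) h \<le> K * 2^i * (\<Sum>d | d dvd h. 1 / real d)"
proof -
  obtain K0 where K0: "K0 > 0" "\<And>i::nat. (real i + 1)^3 \<le> K0 * sqrt (2 ^ i)"
    using cube_le_exp_half by blast
  have "mangoldt_pairs (2^i) h \<le> (72 * 256 + 5 * K0) * 2^i * (\<Sum>d | d dvd h. 1 / real d)"
    if h: "h > 0" for i h
  proof -
    define \<sigma> where "\<sigma> = (\<Sum>d | d dvd h. 1 / real d)"
    \<comment> \<open>Dividing by 16 keeps the sieve error \<open>2 ^ (8 * u)\<close> below
      \<open>sqrt (2 ^ i)\<close>. The quotient \<open>(i + 1) / (u + 1)\<close> is then at most 16,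
      whence the factor 256.\<close>
    define u where "u = i div 16"
    define P :: nat where "P = 2^i"
    define X where "X = {n\<in>{P..<P+P}. \<forall>p\<le>4^u. prime p \<longrightarrow> \<not> p dvd n \<and> \<not> p dvd n + h}"
    define Y where "Y = {n::nat. n < 2^(i+1) \<and> primepow n \<and> (\<exists>p\<le>4^u. prime p \<and> p dvd n)}"
    define Z where "Z = {d\<in>{P..<2*P-h}. primepow d \<and> primepow (d + h)}"
    have \<sigma>1: "\<sigma> \<ge> 1" unfolding \<sigma>_def using h member_le_sum[of 1 "{d. d dvd h}" "\<lambda>d. 1 / real d"] by auto
    have Yc: "card Y \<le> (4^u+1) * (i+1)" and Yf: "finite Y" unfolding Y_def 
      by (rule card_small_primepows, rule finite_small_primepows)
    \<comment> \<open>A pair of prime powers either survives the sieve or contains a power of a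
      prime up to \<open>4^u\<close>. The latter are so few that counting them suffices.\<close>
    have "Z \<subseteq> X \<union> (Y \<union> (\<lambda>n. n - h) ` Y)"
    proof
      fix d assume d: "d \<in> Z"
      then have lt: "d + h < 2^(i+1)" "P \<le> d" "d < 2*P" unfolding Z_def P_def by auto
      show "d \<in> X \<union> (Y \<union> (\<lambda>n. n - h) ` Y)"
      proof (cases "d \<in> X")
        case False
        then obtain p where p: "p \<le> 4^u" "prime p" "p dvd d \<or> p dvd d + h"
          using lt unfolding X_def by auto
        from p(3) show ?thesis
        proof
          assume "p dvd d"
          then have "d \<in> Y" using d p lt unfolding Y_def Z_def by auto
          then show ?thesis by simp
        next
          assume "p dvd d + h"
          then have "d + h \<in> Y" using d p lt unfolding Y_def Z_def by auto
          then have "d + h - h \<in> (\<lambda>n. n - h) ` Y" by (rule imageI)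
          then show ?thesis by simp
        qed
      qed simp
    qed
    then have "card Z \<le> card (X \<union> (Y \<union> (\<lambda>n. n - h) ` Y))"
      using Yf by (intro card_mono) (auto simp: X_def)
    also have "\<dots> \<le> card X + (card Y + card ((\<lambda>n. n - h) ` Y))"
      by (meson add_left_mono card_Un_le le_trans)
    also have "\<dots> \<le> card X + 2 * ((4^u+1) * (i+1))"
      using Yc card_image_le[OF Yf, of "\<lambda>n. n - h"] by linarith
    finally have "real (card Z) \<le> real (card X + 2 * ((4^u+1) * (i+1)))" by (rule of_nat_mono)
    then have "real (card Z) \<le> real (card X) + 2 * (4^u+1) * (real i+1)"
      by (simp add: algebra_simps) 
    moreover have "real (card X) \<le> 72 * real P * \<sigma> / (real u + 1)^2 + 2 ^ (8 * u)"
      unfolding \<sigma>_def X_def by (rule card_pair_sifted_le[OF h])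
    ultimately have Zc: "real (card Z) \<le> 72 * real P * \<sigma> / (real u + 1)^2 + 2 ^ (8 * u) + 2 * (4^u+1) * (real i+1)"
      by linarith
    have \<Lambda>: "mangoldt n \<le> real i + 1" if "n < 2^(i+1)" "n > 0" for n :: nat
    proof -
      have "mangoldt n \<le> ln (real n)" using that by (intro mangoldt_le)
      also have "\<dots> \<le> ln (2^(i+1))"
      proof -
        have "real n \<le> real (2^(i+1))" using that(1) by (intro of_nat_mono) simp
        then show ?thesis using that(2) by (subst ln_le_cancel_iff) auto
      qed
      also have "\<dots> = (real i + 1) * ln 2" by (subst ln_realpow) auto
      also have "\<dots> \<le> (real i + 1) * 1" using ln_2_less_1 by (intro mult_left_mono) auto
      finally show ?thesis by simp
    qed
    have "mangoldt_pairs P h = (\<Sum>d\<in>Z. mangoldt d * mangoldt (d + h))"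
      unfolding mangoldt_pairs_def Z_def by (intro sum.mono_neutral_right) (auto simp: mangoldt_def)
    also have "\<dots> \<le> (\<Sum>d\<in>Z. (real i + 1) * (real i + 1))"
    proof (intro sum_mono mult_mono \<Lambda> mangoldt_nonneg)
      fix d assume "d \<in> Z"
      then show "d < 2^(i+1)" "d > 0" "d + h < 2^(i+1)" "d + h > 0" using h
        by (auto simp: Z_def P_def intro: primepow_gt_0_nat)
    qed simp
    also have "\<dots> = real (card Z) * (real i + 1)^2" by (simp add: power2_eq_square)
    also have "\<dots> \<le> (72 * real P * \<sigma> / (real u + 1)^2 + 2 ^ (8 * u) + 2 * (4^u+1) * (real i+1)) * (real i + 1)^2"
      using Zc by (intro mult_right_mono) auto
    also have "\<dots> = 72 * real P * \<sigma> * ((real i + 1) / (real u + 1))^2 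
       + (2 ^ (8 * u) + 2 * (4^u+1) * (real i+1)) * (real i + 1)^2"
      by (simp add: power_divide field_simps)
    also have "\<dots> \<le> 72 * real P * \<sigma> * 256 + 5 * K0 * real P * \<sigma>"
    proof (rule add_mono)
      have "(real i + 1) / (real u + 1) \<le> 16"
      proof -
        have "i < 16 * (u + 1)" unfolding u_def by presburger
        then have "real (i + 1) \<le> real (16 * (u + 1))" by (intro of_nat_mono) simp
        then show ?thesis by (simp add: field_simps)
      qed
      then have "((real i + 1) / (real u + 1))^2 \<le> 16^2" by (intro power_mono) auto
      then show "72 * real P * \<sigma> * ((real i + 1) / (real u + 1))^2 \<le> 72 * real P * \<sigma> * 256"
        using \<sigma>1 by (intro mult_left_mono) auto
      have s: "2 ^ (8 * u) \<le> sqrt (2 ^ i)"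
      proof (rule real_le_rsqrt)
        have "((2::real) ^ (8 * u))^2 = 2 ^ (16 * u)" by (simp flip: power_mult)
        also have "\<dots> \<le> 2 ^ i" by (intro power_increasing) (auto simp: u_def)
        finally show "((2::real) ^ (8 * u))^2 \<le> 2 ^ i" .
      qed
      have "(4::real)^u \<le> 2 ^ (8 * u)"
      proof -
        have "(4::real)^u = 2 ^ (2 * u)" by (simp add: power_mult)
        also have "\<dots> \<le> 2 ^ (8 * u)" by (intro power_increasing) auto
        finally show ?thesis .
      qed
      moreover have "(1::real) \<le> 2 ^ (8 * u)" by simp
      ultimately have "4^u + 1 \<le> 2 * sqrt (2 ^ i)" using s by linarith
      then have "2 * (4^u + 1) * (real i + 1) \<le> 4 * sqrt (2 ^ i) * (real i + 1)"
        by (intro mult_right_mono) auto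
      moreover have "2 ^ (8 * u) \<le> sqrt (2 ^ i) * (real i + 1)"
      proof -
        have "sqrt (2 ^ i) * 1 \<le> sqrt (2 ^ i) * (real i + 1)" by (intro mult_left_mono) auto
        then show ?thesis using s by linarith
      qed
      ultimately have "(2 ^ (8 * u) + 2 * (4^u + 1) * (real i + 1)) \<le> 5 * sqrt (2 ^ i) * (real i + 1)"
        by (simp add: algebra_simps)
      then have "(2 ^ (8 * u) + 2 * (4^u + 1) * (real i + 1)) * (real i + 1)^2 \<le> 5 * sqrt (2 ^ i) * (real i + 1) * (real i + 1)^2"
        by (intro mult_right_mono) auto
      also have "\<dots> = 5 * sqrt (2 ^ i) * (real i + 1)^3" by (simp add: power3_eq_cube power2_eq_square)
      also have "\<dots> \<le> 5 * sqrt (2 ^ i) * (K0 * sqrt (2 ^ i))" using K0(2) by (intro mult_left_mono) auto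
      also have "\<dots> = 5 * K0 * real P * 1" by (simp add: P_def)
      also have "\<dots> \<le> 5 * K0 * real P * \<sigma>" using \<sigma>1 K0 by (intro mult_left_mono) auto
      finally show "(2 ^ (8 * u) + 2 * (4^u + 1) * (real i + 1)) * (real i + 1)^2 \<le> 5 * K0 * real P * \<sigma>" .
    qed
    also have "\<dots> = (72 * 256 + 5 * K0) * 2^i * \<sigma>" by (simp add: P_def algebra_simps)
    finally show ?thesis unfolding \<sigma>_def P_def .
  qed
  moreover have "72 * 256 + 5 * K0 > 0" using K0 by simp
  ultimately show ?thesis by blast
qed

section \<open>Distribution of multiples modulo 1\<close>

lemma mult_cos_le_sin:
  assumes "0 \<le> x" "x \<le> pi"
  shows "x * cos x \<le> sin (x::real)"
proof -
  have "(\<lambda>x. sin x - x * cos x) 0 \<le> (\<lambda>x. sin x - x * cos x) x"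
  proof (rule DERIV_nonneg_imp_nondecreasing[OF assms(1)])
    fix t assume t: "0 \<le> t" "t \<le> x"
    have "((\<lambda>x. sin x - x * cos x) has_real_derivative t * sin t) (at t)"
      by (auto intro!: derivative_eq_intros)
    moreover have "t * sin t \<ge> 0" using t assms by (intro mult_nonneg_nonneg sin_ge_zero) auto
    ultimately show "\<exists>y. ((\<lambda>x. sin x - x * cos x) has_real_derivative y) (at t) \<and> 0 \<le> y" by blast
  qed
  then show ?thesis by simp
qed

text \<open>Concavity would give \<open>2 * x\<close>, but a constant factor is harmless here. Up to
  1/6 the cosine is at least 1/2; beyond that the sine is at least
  \<open>sin (pi / 6) = 1/2\<close>.\<close>

lemma le_sin_pi_mult:
  assumes "0 \<le> x" "x \<le> 1/2"
  shows "x \<le> sin (pi * x)"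
proof (cases "x \<le> 1/6")
  case True
  have "cos (pi * x) \<ge> cos (pi / 3)" using assms True by (intro cos_monotone_0_pi_le) auto
  then have "1/2 \<le> cos (pi * x)" by (simp add: cos_60)
  then have "pi * x * (1/2) \<le> pi * x * cos (pi * x)" using assms by (intro mult_left_mono) auto
  also have "\<dots> \<le> sin (pi * x)" using assms by (intro mult_cos_le_sin) (auto intro: mult_left_le)
  finally have "pi * x * (1/2) \<le> sin (pi * x)" .
  moreover have "2 * x \<le> pi * x" using assms pi_ge_two by (intro mult_right_mono) auto
  ultimately show ?thesis by simp
next
  case False
  have "sin (pi / 6) \<le> sin (pi * x)" using assms False by (intro sin_monotone_2pi_le) auto
  then show ?thesis using assms by (simp add: sin_30)
qed

definition dist_int :: "real \<Rightarrow> real" where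
  "dist_int t = \<bar>t - of_int (round t)\<bar>"

lemma dist_int_le: "dist_int t \<le> \<bar>t - of_int n\<bar>"
  unfolding dist_int_def using round_diff_minimal[of t n] by simp

lemma dist_int_bounds: "0 \<le> dist_int t" "dist_int t \<le> 1/2"
  using of_int_round_abs_le[of t] by (auto simp: dist_int_def abs_minus_commute)

lemma dist_int_minus: "dist_int (- t) = dist_int t"
proof -
  have "dist_int (- t) \<le> dist_int t" for t
    using dist_int_le[of "-t" "- round t"] by (simp add: dist_int_def abs_if split: if_splits)
  from this[of t] this[of "-t"] show ?thesis by simp
qed

lemma norm_cis_minus_one: "norm (cis (2 * pi * t) - 1) \<ge> 2 * dist_int t"
proof -
  define s where "s = t - of_int (round t)"
  have "cis (2 * pi * t) = cis (2 * pi * s) * cis (2 * pi * of_int (round t))"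
    by (simp add: s_def cis_mult algebra_simps)
  also have "cis (2 * pi * of_int (round t)) = 1" by (rule cis_multiple_2pi) simp
  finally have "norm (cis (2 * pi * t) - 1) = norm (exp (\<i> * of_real (2 * pi * s)) - 1)"
    by (simp add: cis_conv_exp)
  also have "\<dots> = 2 * \<bar>sin (pi * s)\<bar>" by (subst dist_exp_i_1) simp
  also have "\<bar>sin (pi * s)\<bar> = \<bar>sin (pi * \<bar>s\<bar>)\<bar>" by (simp add: abs_if)
  finally show ?thesis
    using le_sin_pi_mult[of "\<bar>s\<bar>"] dist_int_bounds[of t] by (simp add: dist_int_def s_def)
qed

lemma norm_sum_cis_le:
  assumes "dist_int t > 0"
  shows "norm (\<Sum>m\<in>{a..<b::nat}. cis (2 * pi * (real m * t))) \<le> 1 / dist_int t"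
proof (cases "a \<le> b")
  case True
  define z where "z = cis (2 * pi * t)"
  have z: "cis (2 * pi * (real m * t)) = z ^ m" for m
    by (simp only: z_def Complex.DeMoivre mult_ac)
  have "(z - 1) * (\<Sum>m\<in>{a..<b}. z ^ m) = z ^ b - z ^ a"
  proof -
    have "(\<Sum>m\<in>{a..<b}. z ^ Suc m - z ^ m) = z ^ b - z ^ a" using True by (rule sum_Suc_diff')
    then show ?thesis by (simp add: sum_distrib_left algebra_simps sum_subtractf)
  qed
  then have "norm (z - 1) * norm (\<Sum>m\<in>{a..<b}. z ^ m) = norm (z ^ b - z ^ a)"
    by (metis norm_mult)
  also have "\<dots> \<le> norm (z ^ b) + norm (z ^ a)" by (rule norm_triangle_ineq4)
  also have "\<dots> = 2" by (simp add: z_def norm_power)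
  finally have "norm (z - 1) * norm (\<Sum>m\<in>{a..<b}. z ^ m) \<le> 2" .
  moreover have "2 * dist_int t * norm (\<Sum>m\<in>{a..<b}. z ^ m) \<le> norm (z - 1) * norm (\<Sum>m\<in>{a..<b}. z ^ m)"
    using norm_cis_minus_one[of t] by (intro mult_right_mono) (auto simp: z_def)
  ultimately show ?thesis using assms unfolding z by (simp add: field_simps)
qed (use assms in auto)

text \<open>Summation by parts: the differences of the decreasing weights telescope to
  \<open>v a - v b\<close>. The bound \<open>B\<close> is also required for \<open>n < a\<close>,
  where the sum is empty, and so it is nonnegative.\<close>

lemma abel_inequality:
  fixes z :: "nat \<Rightarrow> complex" and v :: "nat \<Rightarrow> real"
  assumes "\<And>m. a \<le> m \<Longrightarrow> v m \<ge> 0" "\<And>m. a \<le> m \<Longrightarrow> v (Suc m) \<le> v m"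
    and B: "\<And>n. n \<le> b \<Longrightarrow> norm (\<Sum>m\<in>{a..<n}. z m) \<le> B"
  shows "norm (\<Sum>m\<in>{a..<b}. of_real (v m) * z m) \<le> v a * B"
proof (cases "a \<le> b")
  case True
  define Z where "Z n = (\<Sum>m\<in>{a..<n}. z m)" for n
  have eq: "(\<Sum>m\<in>{a..<n}. of_real (v m) * z m) 
      = (\<Sum>m\<in>{a..<n}. of_real (v m - v (Suc m)) * Z (Suc m)) + of_real (v n) * Z n" if "a \<le> n" for n
    using that
  proof (induction n rule: dec_induct)
    case (step n)
    have "Z (Suc n) = Z n + z n" using step by (simp add: Z_def)
    then show ?case using step by (simp add: algebra_simps)
  qed (simp add: Z_def)
  have tel: "(\<Sum>m\<in>{a..<b}. v m - v (Suc m)) = v a - v b"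
    using sum_Suc_diff'[OF True, of "\<lambda>m. - v m"] by simp
  have "norm (\<Sum>m\<in>{a..<b}. of_real (v m) * z m) 
     \<le> norm (\<Sum>m\<in>{a..<b}. of_real (v m - v (Suc m)) * Z (Suc m)) + norm (of_real (v b) * Z b)"
    unfolding eq[OF True] by (rule norm_triangle_ineq)
  also have "norm (\<Sum>m\<in>{a..<b}. of_real (v m - v (Suc m)) * Z (Suc m)) \<le> (\<Sum>m\<in>{a..<b}. (v m - v (Suc m)) * B)"
  proof (rule sum_norm_le)
    fix m assume m: "m \<in> {a..<b}"
    then have "v m - v (Suc m) \<ge> 0" using assms(2) by simp
    moreover have "norm (Z (Suc m)) \<le> B" unfolding Z_def using m by (intro B) auto
    ultimately show "norm (of_real (v m - v (Suc m)) * Z (Suc m)) \<le> (v m - v (Suc m)) * B"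
      by (simp only: norm_mult norm_of_real abs_of_nonneg mult_left_mono)
  qed
  also have "\<dots> = (v a - v b) * B" by (simp add: tel flip: sum_distrib_right)
  also have "norm (of_real (v b) * Z b) \<le> v b * B"
    using assms(1)[OF True] B[of b] by (auto simp: norm_mult Z_def intro!: mult_left_mono)
  finally show ?thesis by (simp add: algebra_simps)
next
  case False
  have "0 \<le> v a * B" using assms(1)[of a] B[of 0] by simp
  then show ?thesis using False by simp
qed

text \<open>The minimum of 1 and \<open>1 / (M * dist_int t)\<close>. The case distinction takes
  care of integers \<open>t\<close>, where the quotient is 0 by the convention for division by zero
  and a literal minimum would be wrong.\<close>

definition geometric_weight :: "real \<Rightarrow> real \<Rightarrow> real" where
  "geometric_weight M t = (if M * dist_int t \<le> 1 then 1 else 1 / (M * dist_int t))"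

lemma geometric_weight_bounds: "0 \<le> geometric_weight M t" "geometric_weight M t \<le> 1"
  by (auto simp: geometric_weight_def divide_simps)

lemma geometric_weight_zero: "geometric_weight M 0 = 1"
  by (simp add: geometric_weight_def dist_int_def)

lemma geometric_weight_minus: "geometric_weight M (- t) = geometric_weight M t"
  by (simp add: geometric_weight_def dist_int_minus)

lemma norm_weighted_sum_cis_le:
  fixes v :: "nat \<Rightarrow> real"
  assumes "\<And>m. a \<le> m \<Longrightarrow> v m \<ge> 0" "\<And>m. a \<le> m \<Longrightarrow> v (Suc m) \<le> v m"
    and M: "real (b - a) \<le> M" "M > 0"
  shows "norm (\<Sum>m\<in>{a..<b}. of_real (v m) * cis (2 * pi * (real m * t))) \<le> v a * (M * geometric_weight M t)"
proof (rule abel_inequality)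
  fix n assume n: "n \<le> b"
  show "norm (\<Sum>m\<in>{a..<n}. cis (2 * pi * (real m * t))) \<le> M * geometric_weight M t"
  proof (cases "M * dist_int t \<le> 1")
    case True
    have "norm (\<Sum>m\<in>{a..<n}. cis (2 * pi * (real m * t))) \<le> (\<Sum>m\<in>{a..<n}. norm (cis (2 * pi * (real m * t))))"
      by (rule norm_sum)
    also have "\<dots> = real (n - a)" by simp
    also have "\<dots> \<le> M" using n M by linarith
    finally show ?thesis using True by (simp add: geometric_weight_def)
  next
    case False
    then have "dist_int t > 0" using dist_int_bounds[of t] M by (cases "dist_int t = 0") auto
    then show ?thesis using False M norm_sum_cis_le[of t a n] by (simp add: geometric_weight_def)
  qed
qed (use assms in auto)

text \<open>As \<open>0 < j < r\<close>, the integer \<open>j * b - n * r\<close> is nonzero for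
  every \<open>n\<close>. Replacing \<open>b\<close> by \<open>r * \<alpha>\<close> in it costs at
  most \<open>j / r\<close>, which is at most 1/2, and leaves at least 1/2 for \<open>r\<close>
  times the distance of \<open>j * \<alpha>\<close> to \<open>n\<close>.\<close>

lemma dist_int_spacing:
  fixes \<alpha> :: real and b r j :: int
  assumes "coprime b r" "r > 0" "\<bar>of_int r * \<alpha> - of_int b\<bar> \<le> 1 / of_int r" "0 < j" "2 * j \<le> r"
  shows "dist_int (of_int j * \<alpha>) \<ge> 1 / (2 * of_int r)"
proof -
  define n where "n = round (of_int j * \<alpha>)"
  have "j * b - n * r \<noteq> 0"
  proof
    assume "j * b - n * r = 0"
    then have "r dvd j * b" by (metis dvd_triv_right eq_iff_diff_eq_0)
    then have "r dvd j" using assms(1) coprime_commute coprime_dvd_mult_left_iff by blast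
    then have "r \<le> j" using assms(4) by (simp add: zdvd_imp_le)
    then show False using assms by linarith
  qed
  then have "1 \<le> \<bar>of_int (j * b - n * r) :: real\<bar>" by linarith
  also have "of_int (j * b - n * r) = (of_int j * \<alpha> - of_int n) * of_int r - of_int j * (of_int r * \<alpha> - of_int b)"
    by (simp add: algebra_simps)
  also have "\<bar>\<dots>\<bar> \<le> \<bar>(of_int j * \<alpha> - of_int n) * of_int r\<bar> + \<bar>of_int j * (of_int r * \<alpha> - of_int b)\<bar>"
    by (rule abs_triangle_ineq4)
  also have "\<dots> = \<bar>of_int j * \<alpha> - of_int n\<bar> * of_int r + of_int j * \<bar>of_int r * \<alpha> - of_int b\<bar>"
    using assms by (simp add: abs_mult)
  also have "of_int j * \<bar>of_int r * \<alpha> - of_int b\<bar> \<le> (of_int r / 2) * (1 / of_int r)"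
    using assms by (intro mult_mono) auto
  also have "(of_int r / 2) * (1 / of_int r) = (1/2 :: real)" using assms by simp
  finally have "1/2 \<le> \<bar>of_int j * \<alpha> - of_int n\<bar> * of_int r" by simp
  then show ?thesis using assms by (simp add: dist_int_def n_def field_simps)
qed

lemma sum_inverse_sqrt_le: "(\<Sum>k=1..n. 1 / sqrt (real k)) \<le> 2 * sqrt (real n)"
proof (induction n)
  case (Suc n)
  have "1 / sqrt (real (Suc n)) \<le> 2 * (sqrt (real (Suc n)) - sqrt (real n))"
  proof -
    have "(sqrt (real (Suc n)) - sqrt (real n)) * (sqrt (real (Suc n)) + sqrt (real n)) = 1"
      by (simp add: algebra_simps)
    moreover have "sqrt (real (Suc n)) + sqrt (real n) > 0" by (intro add_pos_nonneg) auto
    ultimately have "sqrt (real (Suc n)) - sqrt (real n) = 1 / (sqrt (real (Suc n)) + sqrt (real n))"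
      by (simp add: field_simps)
    also have "\<dots> \<ge> 1 / (2 * sqrt (real (Suc n)))" by (intro divide_left_mono) (auto intro!: mult_pos_pos add_pos_nonneg)
    finally show ?thesis by simp
  qed
  then show ?case using Suc by simp
qed simp

text \<open>
  On a block of about \<open>r / 2\<close> consecutive integers the points \<open>h * \<alpha>\<close> are \<open>1 / (2 * r)\<close>-separated
  modulo 1. Bounding the weight by its square root costs a power of \<open>M\<close> but no logarithm of \<open>r\<close>.
\<close>

lemma sum_geometric_weight_block_le:
  fixes \<alpha> M :: real and b r :: int
  assumes ab: "coprime b r" "r > 0" "\<bar>of_int r * \<alpha> - of_int b\<bar> \<le> 1 / of_int r" and M: "M > 0"
  shows "(\<Sum>h\<in>{a..<a + Suc (nat r div 2)}. geometric_weight M (real h * \<alpha>)) \<le> 2 + 6 * of_int r / sqrt M"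
proof -
  define rn where "rn = nat r"
  have r: "real_of_int r = real rn" "rn > 0" using ab(2) by (auto simp: rn_def)
  define w where "w j = (if j = 0 then 1 else sqrt (2 * real rn / M) * (1 / sqrt (real j)))" for j :: nat
  \<comment> \<open>\<open>T h\<close> is the signed distance of \<open>h * \<alpha>\<close> to the
    nearest integer, and \<open>J h\<close> is the number of its cell of width
    \<open>1 / (2 * r)\<close>. Equal sign and equal cell would bring two points closer together
    than \<open>dist_int_spacing\<close> permits, since indices in a block differ by at most
    \<open>r / 2\<close>.\<close>
  define T where "T h = real h * \<alpha> - of_int (round (real h * \<alpha>))" for h :: nat
  define J where "J h = nat \<lfloor>2 * real rn * \<bar>T h\<bar>\<rfloor>" for h
  have Tabs: "dist_int (real h * \<alpha>) = \<bar>T h\<bar>" for h by (simp add: dist_int_def T_def)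
  let ?H = "{a..<a + Suc (rn div 2)}"
  have Jle: "real (J h) \<le> 2 * real rn * \<bar>T h\<bar>" for h unfolding J_def by (simp add: of_nat_floor)
  have Jlt: "2 * real rn * \<bar>T h\<bar> < real (J h) + 1" for h unfolding J_def by linarith
  have inj: "inj_on (\<lambda>h. (0 \<le> T h, J h)) ?H"
  proof (rule linorder_inj_onI)
    fix g h assume gh: "g < h" "g \<in> ?H" "h \<in> ?H"
    show "(0 \<le> T g, J g) \<noteq> (0 \<le> T h, J h)"
    proof
      assume "(0 \<le> T g, J g) = (0 \<le> T h, J h)"
      then have sg: "0 \<le> T g \<longleftrightarrow> 0 \<le> T h" and J: "J g = J h" by auto
      have "2 * real rn * \<bar>T h\<bar> - 2 * real rn * \<bar>T g\<bar> < 1" 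
           "2 * real rn * \<bar>T g\<bar> - 2 * real rn * \<bar>T h\<bar> < 1"
        using Jle[of g] Jle[of h] Jlt[of g] Jlt[of h] J by linarith+
      then have "2 * real rn * \<bar>T h - T g\<bar> < 1" 
        using sg by (cases "0 \<le> T g"; cases "T h \<le> T g") (auto simp: algebra_simps abs_if)
      then have lt: "\<bar>T h - T g\<bar> < 1 / (2 * real rn)" using r by (simp add: field_simps)
      have "1 / (2 * of_int r) \<le> dist_int (of_int (int (h - g)) * \<alpha>)"
        using gh by (intro dist_int_spacing[OF ab]) (auto simp: rn_def)
      also have "\<dots> \<le> \<bar>of_int (int (h - g)) * \<alpha> - of_int (round (real h * \<alpha>) - round (real g * \<alpha>))\<bar>"
        by (rule dist_int_le)
      also have "of_int (int (h - g)) * \<alpha> - of_int (round (real h * \<alpha>) - round (real g * \<alpha>)) = T h - T g"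
        using gh by (simp add: T_def of_nat_diff algebra_simps)
      finally show False using lt r by simp
    qed
  qed auto
  \<comment> \<open>Cell 0 yields only the trivial bound 1, once for each sign; this is the 2 in the
    result. In cell \<open>j > 0\<close> the distance is at least
    \<open>j / (2 * r)\<close>.\<close>
  have le: "geometric_weight M (real h * \<alpha>) \<le> w (J h)" for h
  proof (cases "J h = 0")
    case True
    then show ?thesis using geometric_weight_bounds by (simp add: w_def)
  next
    case False
    define d where "d = dist_int (real h * \<alpha>)"
    have Jd: "real (J h) \<le> 2 * real rn * d" using Jle[of h] by (simp add: d_def Tabs)
    have J1: "real (J h) \<ge> 1" using False by linarith
    then have d0: "d > 0" using Jd r(2) by (smt (verit) mult_nonneg_nonpos of_nat_0_le_iff)
    have "geometric_weight M (real h * \<alpha>) \<le> sqrt (1 / (M * d))"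
    proof (cases "M * d \<le> 1")
      case True
      have "1 \<le> 1 / (M * d)" using True d0 M by (simp add: field_simps)
      then have "1 \<le> sqrt (1 / (M * d))" by simp
      then show ?thesis using True by (simp add: geometric_weight_def d_def)
    next
      case False
      define x where "x = 1 / (M * d)"
      have x: "0 \<le> x" "x \<le> 1" using False by (auto simp: x_def divide_simps)
      have "x * x \<le> x" using x by (intro mult_left_le_one_le)
      then have "x \<le> sqrt x" by (intro real_le_rsqrt) (simp add: power2_eq_square)
      then show ?thesis using False by (simp add: geometric_weight_def d_def x_def)
    qed
    also have "\<dots> \<le> sqrt (2 * real rn / M * (1 / real (J h)))"
    proof (rule real_sqrt_le_mono)
      have "M * real (J h) \<le> M * (2 * real rn * d)" using Jd M by (intro mult_left_mono) auto
      then show "1 / (M * d) \<le> 2 * real rn / M * (1 / real (J h))"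
        using d0 M J1 r(2) by (simp add: field_simps)
    qed
    also have "\<dots> = w (J h)" using False by (simp add: w_def real_sqrt_mult real_sqrt_divide)
    finally show ?thesis .
  qed
  have "(\<Sum>h\<in>?H. geometric_weight M (real h * \<alpha>)) \<le> (\<Sum>h\<in>?H. w (J h))" by (intro sum_mono le)
  also have "\<dots> = (\<Sum>x\<in>(\<lambda>h. (0 \<le> T h, J h)) ` ?H. w (snd x))" using inj by (simp add: sum.reindex)
  also have "\<dots> \<le> (\<Sum>x\<in>(UNIV :: bool set) \<times> {..rn}. w (snd x))"
  proof (rule sum_mono2)
    show "(\<lambda>h. (0 \<le> T h, J h)) ` ?H \<subseteq> (UNIV :: bool set) \<times> {..rn}"
    proof safe
      fix h
      have "2 * real rn * \<bar>T h\<bar> \<le> 2 * real rn * (1/2)"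
        using dist_int_bounds(2)[of "real h * \<alpha>"] unfolding Tabs by (intro mult_left_mono) auto
      then have "real (J h) \<le> real rn" using Jle[of h] by simp
      then show "J h \<le> rn" by simp
    qed simp
  qed (use M in \<open>auto simp: w_def\<close>)
  also have "\<dots> = (\<Sum>x\<in>(UNIV :: bool set). \<Sum>j\<in>{..rn}. w j)" by (simp only: sum.cartesian_product split_def snd_conv)
  also have "\<dots> = 2 * (\<Sum>j\<in>{..rn}. w j)" by simp
  also have "(\<Sum>j\<in>{..rn}. w j) = 1 + sqrt (2 * real rn / M) * (\<Sum>j=1..rn. 1 / sqrt (real j))"
  proof -
    have "(\<Sum>j\<in>{..rn}. w j) = w 0 + (\<Sum>j\<in>{1..rn}. w j)"
      by (simp add: sum.atLeast_Suc_atMost atMost_atLeast0)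
    also have "(\<Sum>j\<in>{1..rn}. w j) = (\<Sum>j\<in>{1..rn}. sqrt (2 * real rn / M) * (1 / sqrt (real j)))"
      by (intro sum.cong) (auto simp: w_def)
    finally show ?thesis by (simp add: w_def sum_distrib_left)
  qed
  also have "\<dots> \<le> 1 + sqrt (2 * real rn / M) * (2 * sqrt (real rn))"
    using M by (intro add_left_mono mult_left_mono sum_inverse_sqrt_le) auto
  also have "sqrt (2 * real rn / M) * (2 * sqrt (real rn)) = 2 * sqrt 2 * real rn / sqrt M"
    by (simp add: real_sqrt_mult real_sqrt_divide field_simps)
  also have "\<dots> \<le> 3 * real rn / sqrt M"
  proof -
    have "sqrt 2 \<le> 3/2" by (rule real_le_lsqrt) (auto simp: power2_eq_square)
    then show ?thesis using M by (intro divide_right_mono mult_right_mono) auto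
  qed
  finally show ?thesis unfolding rn_def[symmetric] r(1) by simp
qed

lemma sum_geometric_weight_le:
  fixes \<alpha> M :: real and b r :: int and P :: nat
  assumes ab: "coprime b r" "r > 0" "\<bar>of_int r * \<alpha> - of_int b\<bar> \<le> 1 / of_int r" and M: "M > 0"
  shows "(\<Sum>h=1..P. geometric_weight M (real h * \<alpha>)) \<le> (2 * real P / of_int r + 1) * (2 + 6 * of_int r / sqrt M)"
proof -
  define s where "s = Suc (nat r div 2)"
  define n where "n = Suc (P div s)"
  have Pn: "P < n * s" unfolding n_def s_def 
    by (metis dividend_less_div_times mult.commute mult_Suc zero_less_Suc add.commute)
  have "(\<Sum>h=1..P. geometric_weight M (real h * \<alpha>)) \<le> (\<Sum>h\<in>{..<n * s}. geometric_weight M (real h * \<alpha>))"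
    using Pn by (intro sum_mono2) (auto simp: geometric_weight_bounds)
  also have "\<dots> = (\<Sum>j<n. \<Sum>h\<in>{j * s..<j * s + s}. geometric_weight M (real h * \<alpha>))"
    by (rule sum.nat_group[symmetric])
  also have "\<dots> \<le> (\<Sum>j<n. 2 + 6 * of_int r / sqrt M)"
    unfolding s_def by (intro sum_mono sum_geometric_weight_block_le[OF ab M])
  also have "\<dots> = real n * (2 + 6 * of_int r / sqrt M)" by simp
  also have "\<dots> \<le> (2 * real P / of_int r + 1) * (2 + 6 * of_int r / sqrt M)"
  proof (rule mult_right_mono)
    have "real (P div s) \<le> real P / real s" by (rule of_nat_div_le_of_nat)
    also have "\<dots> \<le> real P / (of_int r / 2)"
    proof (rule divide_left_mono)
      have "r \<le> 2 * int s" using ab(2) by (simp add: s_def)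
      then have "real_of_int r \<le> of_int (2 * int s)" by (simp only: of_int_le_iff)
      then show "of_int r / 2 \<le> real s" by simp
    qed (use ab(2) in \<open>auto simp: s_def\<close>)
    finally show "real n \<le> 2 * real P / of_int r + 1" by (simp add: n_def mult.commute)
  qed (use ab(2) M in auto)
  finally show ?thesis .
qed

section \<open>Divisor sums on average\<close>

lemma harm_le_one_plus_ln: "n > 0 \<Longrightarrow> harm n \<le> 1 + ln (real n)"
  using euler_mascheroni_sequence_decreasing[of 1 n] by (simp add: harm_expand)

lemma sum_inverse_squares_tail_le:
  assumes "n > 0"
  shows "(\<Sum>d=n..P. 1 / real d ^ 2) \<le> 2 / real n"
proof (cases "n \<le> P")
  case True
  have "(\<Sum>d=n..P. 1 / real d ^ 2) \<le> 2 / real n - 2 / real (Suc P)"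
    using True
  proof (induction P rule: dec_induct)
    case base
    show ?case using assms by (simp add: divide_simps) (simp add: algebra_simps power2_eq_square)
  next
    case (step P)
    have "1 / real (Suc P) ^ 2 \<le> 2 / real (Suc P) - 2 / real (Suc (Suc P))"
      by (simp add: divide_simps) (simp add: algebra_simps power2_eq_square)
    then show ?case using step by simp
  qed
  also have "\<dots> \<le> 2 / real n" by simp
  finally show ?thesis .
qed simp

text \<open>Divisors up to \<open>D\<close> contribute at most \<open>harm n\<close>, hence
  \<open>1 + ln D\<close>, for each single \<open>h\<close>. A larger \<open>d\<close> divides at
  most \<open>P / d\<close> of the \<open>h\<close>, so that with \<open>\<kappa> h \<le> 1\<close>
  these divisors are bounded on average by the sum of \<open>P / d^2\<close> over
  \<open>d > D\<close>. The parameter \<open>D\<close> stays free, so that the logarithm can later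
  be compared with that of \<open>R\<close>.\<close>

lemma sum_divisor_weight_le:
  fixes \<kappa> :: "nat \<Rightarrow> real" and D :: real
  assumes "\<And>h. 0 \<le> \<kappa> h" "\<And>h. \<kappa> h \<le> 1" and D: "D \<ge> 1"
  shows "(\<Sum>h=1..P. (\<Sum>d | d dvd h. 1 / real d) * \<kappa> h) 
    \<le> (1 + ln D) * (\<Sum>h=1..P. \<kappa> h) + 2 * real P / D"
proof -
  define n where "n = nat \<lfloor>D\<rfloor>"
  have n: "n \<ge> 1" "real n \<le> D" "D < real n + 1" 
    using D le_nat_floor[of 1 D] of_nat_floor[of D] by (simp_all add: n_def)
  have split: "(\<Sum>d | d dvd h. 1 / real d) * \<kappa> h 
      \<le> (1 + ln D) * \<kappa> h + (\<Sum>d=Suc n..P. if d dvd h then 1 / real d else 0)" if h: "h \<in> {1..P}" for h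
  proof -
    have "(\<Sum>d | d dvd h. 1 / real d) 
        \<le> (\<Sum>d\<in>{1..n} \<union> {d\<in>{Suc n..P}. d dvd h}. 1 / real d)"
    proof (rule sum_mono2)
      show "{d. d dvd h} \<subseteq> {1..n} \<union> {d \<in> {Suc n..P}. d dvd h}"
      proof
        fix d assume d: "d \<in> {d. d dvd h}"
        then have "d \<le> h" "d \<ge> 1" using h dvd_imp_le[of d h] by (auto intro: Nat.gr0I)
        then show "d \<in> {1..n} \<union> {d \<in> {Suc n..P}. d dvd h}" using d h by auto
      qed
    qed auto
    also have "\<dots> = (\<Sum>d=1..n. 1 / real d) + (\<Sum>d | d \<in> {Suc n..P} \<and> d dvd h. 1 / real d)"
      by (rule sum.union_disjoint) auto
    also have "(\<Sum>d=1..n. 1 / real d) = harm n" by (simp add: harm_def divide_inverse)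
    also have "harm n \<le> 1 + ln D"
    proof -
      have "ln (real n) \<le> ln D" using n D by (subst ln_le_cancel_iff) auto
      then show ?thesis using harm_le_one_plus_ln[of n] n(1) by linarith
    qed
    also have "(\<Sum>d | d \<in> {Suc n..P} \<and> d dvd h. 1 / real d) = (\<Sum>d=Suc n..P. if d dvd h then 1 / real d else 0)"
      by (rule sum.inter_filter) simp
    finally have "(\<Sum>d | d dvd h. 1 / real d) \<le> 1 + ln D + (\<Sum>d=Suc n..P. if d dvd h then 1 / real d else 0)"
      by simp
    then have "(\<Sum>d | d dvd h. 1 / real d) * \<kappa> h \<le> (1 + ln D + (\<Sum>d=Suc n..P. if d dvd h then 1 / real d else 0)) * \<kappa> h"
      using assms(1) by (intro mult_right_mono)
    also have "\<dots> = (1 + ln D) * \<kappa> h + (\<Sum>d=Suc n..P. if d dvd h then 1 / real d else 0) * \<kappa> h"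
      by (simp add: algebra_simps)
    also have "(\<Sum>d=Suc n..P. if d dvd h then 1 / real d else 0) * \<kappa> h \<le> (\<Sum>d=Suc n..P. if d dvd h then 1 / real d else 0)"
      using assms(1,2) by (intro mult_right_le_one_le sum_nonneg) auto
    finally show ?thesis by simp
  qed
  have "(\<Sum>h=1..P. (\<Sum>d | d dvd h. 1 / real d) * \<kappa> h) 
     \<le> (\<Sum>h=1..P. (1 + ln D) * \<kappa> h + (\<Sum>d=Suc n..P. if d dvd h then 1 / real d else 0))"
    by (intro sum_mono split)
  also have "\<dots> = (1 + ln D) * (\<Sum>h=1..P. \<kappa> h) + (\<Sum>h=1..P. \<Sum>d=Suc n..P. if d dvd h then 1 / real d else 0)"
    by (simp add: sum.distrib sum_distrib_left)
  also have "(\<Sum>h=1..P. \<Sum>d=Suc n..P. if d dvd h then 1 / real d else 0) 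
      = (\<Sum>d=Suc n..P. \<Sum>h=1..P. if d dvd h then 1 / real d else 0)" by (rule sum.swap)
  also have "\<dots> \<le> (\<Sum>d=Suc n..P. real P * (1 / real d ^ 2))"
  proof (rule sum_mono)
    fix d assume d: "d \<in> {Suc n..P}"
    have "(\<Sum>h=1..P. if d dvd h then 1 / real d else 0) = real (card {h\<in>{1..P}. d dvd h}) / real d"
      by (subst sum.inter_filter[symmetric]) simp_all
    also have "card {h\<in>{1..P}. d dvd h} \<le> card ((\<lambda>k. k * d) ` {1..P div d})"
    proof (rule card_mono)
      show "{h\<in>{1..P}. d dvd h} \<subseteq> (\<lambda>k. k * d) ` {1..P div d}"
      proof
        fix h assume h: "h \<in> {h\<in>{1..P}. d dvd h}"
        then have "h = (h div d) * d" by simp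
        moreover have "h div d \<in> {1..P div d}" using h d by (auto simp: div_le_mono Suc_le_eq div_greater_zero_iff dvd_imp_le)
        ultimately show "h \<in> (\<lambda>k. k * d) ` {1..P div d}" by blast
      qed
    qed simp
    also have "\<dots> \<le> P div d" using card_image_le[of "{1..P div d}" "\<lambda>k. k * d"] by simp
    also have "real (P div d) \<le> real P / real d" by (rule of_nat_div_le_of_nat)
    finally show "(\<Sum>h=1..P. if d dvd h then 1 / real d else 0) \<le> real P * (1 / real d ^ 2)"
      using d by (simp add: divide_right_mono power2_eq_square field_simps)
  qed
  also have "\<dots> = real P * (\<Sum>d=Suc n..P. 1 / real d ^ 2)" by (simp add: sum_distrib_left)
  also have "\<dots> \<le> real P * (2 / real (Suc n))"
    by (intro mult_left_mono sum_inverse_squares_tail_le) auto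
  also have "\<dots> \<le> real P * (2 / D)" using n D by (intro mult_left_mono divide_left_mono) auto
  finally show ?thesis by (simp add: mult_ac)
qed

section \<open>The dyadic boxes\<close>

text \<open>For \<open>n \<ge> 2\<close> one has
  \<open>1 / n = (\<Sum>d | d dvd n. mangoldt d) * log_weight n\<close>, the identity that brings in
  the von Mangoldt function.\<close>

definition log_weight :: "nat \<Rightarrow> real" where
  "log_weight n = 1 / (real n * ln (real n))"

lemma log_weight_nonneg: "log_weight n \<ge> 0"
  by (cases "n = 0") (auto simp: log_weight_def)

text \<open>Monotonicity starts at 2 because \<open>log_weight 1\<close> divides by
  \<open>ln 1 = 0\<close> and is therefore 0. The condition \<open>y \<ge> 2\<close> on the cut-off
  keeps all arguments in this range.\<close>

lemma log_weight_antimono: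
  assumes "2 \<le> m" "m \<le> n"
  shows "log_weight n \<le> log_weight m"
proof -
  have "real m * ln (real m) \<le> real n * ln (real n)"
    using assms by (intro mult_mono) auto
  moreover have "real m * ln (real m) > 0" using assms by simp
  ultimately show ?thesis unfolding log_weight_def by (intro divide_left_mono) auto
qed

lemma double_sum_symmetric:
  fixes g :: "nat \<Rightarrow> nat \<Rightarrow> real"
  assumes sym: "\<And>d e. g d e = g e d"
  shows "(\<Sum>d\<in>{P..<2*P}. \<Sum>e\<in>{P..<2*P}. g d e) 
    = (\<Sum>d\<in>{P..<2*P}. g d d) + 2 * (\<Sum>h=1..P. \<Sum>d\<in>{P..<2*P-h}. g d (d+h))"
proof -
  let ?A = "{P..<2*P}"
  define S where "S = (\<Sum>d\<in>?A. \<Sum>e\<in>?A. if d < e then g d e else 0)"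
  have "(\<Sum>d\<in>?A. \<Sum>e\<in>?A. g d e) = (\<Sum>d\<in>?A. \<Sum>e\<in>?A. (if d = e then g d e else 0) 
     + (if d < e then g d e else 0) + (if e < d then g d e else 0))"
    by (intro sum.cong refl) auto
  also have "\<dots> = (\<Sum>d\<in>?A. \<Sum>e\<in>?A. if d = e then g d e else 0) + S 
      + (\<Sum>d\<in>?A. \<Sum>e\<in>?A. if e < d then g d e else 0)"
    by (simp only: sum.distrib S_def)
  also have "(\<Sum>d\<in>?A. \<Sum>e\<in>?A. if d = e then g d e else 0) = (\<Sum>d\<in>?A. g d d)"
    by (intro sum.cong refl) simp
  also have "(\<Sum>d\<in>?A. \<Sum>e\<in>?A. if e < d then g d e else 0) = S"
    unfolding S_def by (subst sum.swap) (intro sum.cong refl if_cong sym)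
  also have "S = (\<Sum>(d,e)\<in>{(d,e)\<in>?A \<times> ?A. d < e}. g d e)"
    unfolding S_def sum.cartesian_product
    by (rule sum.mono_neutral_cong_right) (auto split: if_splits)
  also have "\<dots> = (\<Sum>(h,d)\<in>Sigma {1..P} (\<lambda>h. {P..<2*P-h}). g d (d+h))"
    by (rule sum.reindex_bij_witness[where i = "\<lambda>(h,d). (d,d+h)" and j = "\<lambda>(d,e). (e-d,d)"]) auto
  also have "\<dots> = (\<Sum>h=1..P. \<Sum>d\<in>{P..<2*P-h}. g d (d+h))"
    by (subst sum.Sigma) auto
  finally show ?thesis by simp
qed

text \<open>A bilinear sum with coefficients \<open>mangoldt d * f d\<close> and \<open>f m\<close>.
  The cut-off is kept inside, although it couples \<open>d\<close> and \<open>m\<close>, so that the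
  boxes add up exactly to the sum over \<open>y < n \<le> X\<close>.\<close>

definition dyadic_box :: "(nat \<Rightarrow> complex) \<Rightarrow> real \<Rightarrow> real \<Rightarrow> real \<Rightarrow> nat \<Rightarrow> nat \<Rightarrow> complex" where
  "dyadic_box f \<alpha> y X P M = (\<Sum>m\<in>{M..<2*M}. \<Sum>d\<in>{P..<2*P}. 
     if y < real (d * m) \<and> real (d * m) \<le> X 
     then mangoldt d * f d * f m * cis (2 * pi * (real (d * m) * \<alpha>)) * of_real (log_weight (d * m)) else 0)"

text \<open>For fixed \<open>d\<close> and \<open>e\<close> the two cut-offs leave an interval of
  \<open>m\<close>, on which the product of the weights decreases. Partial summation therefore
  removes both and replaces the weights by their largest possible value, the one at
  \<open>P * M\<close>.\<close>

lemma norm_correlation_le: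
  fixes \<alpha> y X :: real and d e M P :: nat
  assumes y: "y \<ge> 2" and P: "P \<le> d" "P \<le> e" and PM: "P * M \<ge> 2"
  defines "B \<equiv> \<lambda>m d. if y < real (d * m) \<and> real (d * m) \<le> X then log_weight (d * m) else 0"
  shows "norm (\<Sum>m\<in>{M..<2*M}. of_real (B m d * B m e) * cis (2 * pi * (real m * t))) 
    \<le> log_weight (P * M) ^ 2 * (real M * geometric_weight M t)"
proof -
  have M: "M > 0" and P0: "P > 0" using PM by (auto intro!: Nat.gr0I)
  define S where "S = {m\<in>{M..<2*M}. (y < real (d * m) \<and> real (d * m) \<le> X) \<and> (y < real (e * m) \<and> real (e * m) \<le> X)}"
  have finS: "finite S" by (simp add: S_def)
  have eq: "(\<Sum>m\<in>{M..<2*M}. of_real (B m d * B m e) * cis (2 * pi * (real m * t)))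
     = (\<Sum>m\<in>S. of_real (log_weight (d * m) * log_weight (e * m)) * cis (2 * pi * (real m * t)))"
    by (intro sum.mono_neutral_cong_right) (auto simp: S_def B_def)
  show ?thesis
  proof (cases "S = {}")
    case True
    then show ?thesis unfolding eq by (simp add: geometric_weight_bounds)
  next
    case False
    define a b where "a = Min S" and "b = Suc (Max S)"
    have aS: "a \<in> S" and bS: "Max S \<in> S" using finS False by (auto simp: a_def)
    have Seq: "S = {a..<b}"
    proof (intro equalityI subsetI)
      fix m assume "m \<in> S"
      then show "m \<in> {a..<b}" using finS by (auto simp: a_def b_def less_Suc_eq_le)
    next
      fix m assume m: "m \<in> {a..<b}"
      then have am: "a \<le> m" "m \<le> Max S" by (auto simp: b_def)
      have "real (d * a) \<le> real (d * m)" "real (e * a) \<le> real (e * m)"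
        "real (d * m) \<le> real (d * Max S)" "real (e * m) \<le> real (e * Max S)"
        using am by (auto simp only: of_nat_le_iff intro: mult_le_mono2)
      then show "m \<in> S" using aS bS am unfolding S_def by auto
    qed
    have da: "d * a \<ge> 2" "e * a \<ge> 2" 
    proof -
      have "2 < real (d * a)" "2 < real (e * a)" using aS y unfolding S_def by auto
      then show "d * a \<ge> 2" "e * a \<ge> 2" by linarith+
    qed
    have dm: "d * m \<ge> 2" "e * m \<ge> 2" if "a \<le> m" for m
      using da le_trans mult_le_mono2[OF that] by blast+
    have "norm (\<Sum>m\<in>{a..<b}. of_real (log_weight (d * m) * log_weight (e * m)) * cis (2 * pi * (real m * t)))
       \<le> (log_weight (d * a) * log_weight (e * a)) * (real M * geometric_weight M t)"
    proof (rule norm_weighted_sum_cis_le[where v = "\<lambda>m. log_weight (d * m) * log_weight (e * m)"])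
      fix m assume "a \<le> m"
      show "0 \<le> log_weight (d * m) * log_weight (e * m)" by (intro mult_nonneg_nonneg log_weight_nonneg)
      show "log_weight (d * Suc m) * log_weight (e * Suc m) \<le> log_weight (d * m) * log_weight (e * m)"
        using dm[OF \<open>a \<le> m\<close>] by (intro mult_mono log_weight_antimono log_weight_nonneg) auto
    next
      have "a \<ge> M" "b \<le> 2 * M" using aS bS by (auto simp: S_def b_def)
      then show "real (b - a) \<le> real M" by simp
    qed (use M in auto)
    also have "\<dots> \<le> (log_weight (P * M) * log_weight (P * M)) * (real M * geometric_weight M t)"
      by (intro mult_right_mono mult_mono log_weight_antimono log_weight_nonneg PM)
        (use aS P in \<open>auto simp: S_def geometric_weight_bounds log_weight_nonneg\<close>)
    finally show ?thesis unfolding eq Seq by (simp add: power2_eq_square)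
  qed
qed

text \<open>Bounding \<open>f m\<close> by 1 before Cauchy-Schwarz leaves inner sums over
  \<open>m\<close> whose coefficients are explicit and monotone. Of the factor \<open>M^2\<close>,
  one \<open>M\<close> comes from Cauchy-Schwarz and one from the inner sum. As
  \<open>geometric_weight\<close> is even, the pairs \<open>(d, e)\<close> and \<open>(e, d)\<close>
  agree and can be indexed by their positive difference \<open>h\<close>.\<close>

lemma norm_dyadic_box_square_le:
  fixes f :: "nat \<Rightarrow> complex"
  assumes f: "\<And>n. norm (f n) \<le> 1" and y: "y \<ge> 2" and PM: "P * M \<ge> 2"
  shows "norm (dyadic_box f \<alpha> y X P M) ^ 2 \<le> (real M * log_weight (P * M)) ^ 2 * 
    ((\<Sum>d\<in>{P..<2*P}. mangoldt d ^ 2) + 2 * (\<Sum>h=1..P. mangoldt_pairs P h * geometric_weight M (real h * \<alpha>)))"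
proof -
  define B where "B m d = (if y < real (d * m) \<and> real (d * m) \<le> X then log_weight (d * m) else 0)" for m d :: nat
  define c where "c d = mangoldt d * f d" for d
  define T where "T m = (\<Sum>d\<in>{P..<2*P}. c d * of_real (B m d) * cis (2 * pi * (real (d * m) * \<alpha>)))" for m
  define \<kappa> where "\<kappa> d e = geometric_weight M ((real d - real e) * \<alpha>)" for d e
  have c: "norm (c d) \<le> mangoldt d" for d
    using f[of d] mangoldt_nonneg[of d] mult_left_mono[of "norm (f d)" 1 "mangoldt d :: real"] 
    by (simp add: c_def norm_mult)
  have "dyadic_box f \<alpha> y X P M = (\<Sum>m\<in>{M..<2*M}. f m * T m)"
    unfolding dyadic_box_def T_def sum_distrib_left
    by (intro sum.cong refl) (auto simp: B_def c_def)
  then have "norm (dyadic_box f \<alpha> y X P M) \<le> (\<Sum>m\<in>{M..<2*M}. norm (f m * T m))"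
    by (simp add: norm_sum)
  also have "\<dots> \<le> (\<Sum>m\<in>{M..<2*M}. norm (T m))"
    using f by (intro sum_mono) (simp add: norm_mult mult_left_le_one_le)
  finally have "norm (dyadic_box f \<alpha> y X P M) ^ 2 \<le> (\<Sum>m\<in>{M..<2*M}. norm (T m)) ^ 2"
    by (intro power_mono) auto
  also have "\<dots> \<le> real M * (\<Sum>m\<in>{M..<2*M}. norm (T m) ^ 2)"
    using sum_squared_le_sum_of_squares[of "\<lambda>m. norm (T m)" "{M..<2*M}"] by (simp add: mult.commute)
  also have "(\<Sum>m\<in>{M..<2*M}. norm (T m) ^ 2) \<le> 
     (\<Sum>d\<in>{P..<2*P}. \<Sum>e\<in>{P..<2*P}. mangoldt d * mangoldt e * (log_weight (P * M) ^ 2 * (real M * \<kappa> d e)))"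
  proof -
    have "complex_of_real (\<Sum>m\<in>{M..<2*M}. norm (T m) ^ 2) = (\<Sum>m\<in>{M..<2*M}. T m * cnj (T m))"
      by (simp only: of_real_sum complex_norm_square)
    also have "\<dots> = (\<Sum>m\<in>{M..<2*M}. \<Sum>d\<in>{P..<2*P}. \<Sum>e\<in>{P..<2*P}. 
        c d * cnj (c e) * (of_real (B m d * B m e) * cis (2 * pi * (real m * ((real d - real e) * \<alpha>)))))"
    proof (rule sum.cong[OF refl])
      fix m
      have "cis (2 * pi * (real m * ((real d - real e) * \<alpha>))) 
          = cis (2 * pi * (real (d * m) * \<alpha>)) * cnj (cis (2 * pi * (real (e * m) * \<alpha>)))" for d e
        by (simp add: cis_cnj cis_mult algebra_simps)
      then show "T m * cnj (T m) = (\<Sum>d\<in>{P..<2*P}. \<Sum>e\<in>{P..<2*P}. 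
        c d * cnj (c e) * (of_real (B m d * B m e) * cis (2 * pi * (real m * ((real d - real e) * \<alpha>)))))"
        by (simp add: T_def sum_product mult_ac)
    qed
    also have "\<dots> = (\<Sum>d\<in>{P..<2*P}. \<Sum>m\<in>{M..<2*M}. \<Sum>e\<in>{P..<2*P}. 
        c d * cnj (c e) * (of_real (B m d * B m e) * cis (2 * pi * (real m * ((real d - real e) * \<alpha>)))))"
      by (rule sum.swap)
    also have "\<dots> = (\<Sum>d\<in>{P..<2*P}. \<Sum>e\<in>{P..<2*P}. \<Sum>m\<in>{M..<2*M}. 
        c d * cnj (c e) * (of_real (B m d * B m e) * cis (2 * pi * (real m * ((real d - real e) * \<alpha>)))))"
      by (intro sum.cong refl sum.swap)
    also have "\<dots> = (\<Sum>d\<in>{P..<2*P}. \<Sum>e\<in>{P..<2*P}. c d * cnj (c e) * 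
        (\<Sum>m\<in>{M..<2*M}. of_real (B m d * B m e) * cis (2 * pi * (real m * ((real d - real e) * \<alpha>)))))"
      by (simp only: sum_distrib_left)
    finally have "norm (complex_of_real (\<Sum>m\<in>{M..<2*M}. norm (T m) ^ 2)) = norm \<dots>" by simp
    also have "\<dots> \<le> (\<Sum>d\<in>{P..<2*P}. \<Sum>e\<in>{P..<2*P}. 
        mangoldt d * mangoldt e * (log_weight (P * M) ^ 2 * (real M * \<kappa> d e)))"
    proof (intro sum_norm_le)
      fix d e assume de: "d \<in> {P..<2*P}" "e \<in> {P..<2*P}"
      have "norm (\<Sum>m\<in>{M..<2*M}. of_real (B m d * B m e) * cis (2 * pi * (real m * ((real d - real e) * \<alpha>))))
         \<le> log_weight (P * M) ^ 2 * (real M * \<kappa> d e)"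
        unfolding B_def \<kappa>_def using de y PM by (intro norm_correlation_le) auto
      then show "norm (c d * cnj (c e) * (\<Sum>m\<in>{M..<2*M}. of_real (B m d * B m e) * cis (2 * pi * (real m * ((real d - real e) * \<alpha>)))))
         \<le> mangoldt d * mangoldt e * (log_weight (P * M) ^ 2 * (real M * \<kappa> d e))"
        unfolding norm_mult complex_mod_cnj using c by (intro mult_mono) (auto simp: mangoldt_nonneg)
    qed
    finally show ?thesis by (simp only: norm_of_real)
  qed
  also have "(\<Sum>d\<in>{P..<2*P}. \<Sum>e\<in>{P..<2*P}. mangoldt d * mangoldt e * (log_weight (P * M) ^ 2 * (real M * \<kappa> d e)))
     = log_weight (P * M) ^ 2 * real M * (\<Sum>d\<in>{P..<2*P}. \<Sum>e\<in>{P..<2*P}. mangoldt d * mangoldt e * \<kappa> d e)"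
    by (simp add: sum_distrib_left mult_ac)
  also have "(\<Sum>d\<in>{P..<2*P}. \<Sum>e\<in>{P..<2*P}. mangoldt d * mangoldt e * \<kappa> d e)
     = (\<Sum>d\<in>{P..<2*P}. mangoldt d * mangoldt d * \<kappa> d d) 
       + 2 * (\<Sum>h=1..P. \<Sum>d\<in>{P..<2*P-h}. mangoldt d * mangoldt (d + h) * \<kappa> d (d + h))"
  proof (rule double_sum_symmetric)
    fix d e
    have "(real d - real e) * \<alpha> = - ((real e - real d) * \<alpha>)" by (simp add: algebra_simps)
    then have "\<kappa> d e = \<kappa> e d" unfolding \<kappa>_def by (metis geometric_weight_minus)
    then show "mangoldt d * mangoldt e * \<kappa> d e = mangoldt e * mangoldt d * \<kappa> e d" by simp
  qed
  also have "(\<Sum>d\<in>{P..<2*P}. mangoldt d * mangoldt d * \<kappa> d d) = (\<Sum>d\<in>{P..<2*P}. mangoldt d ^ 2)"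
    by (simp add: \<kappa>_def geometric_weight_zero power2_eq_square)
  also have "(\<Sum>h=1..P. \<Sum>d\<in>{P..<2*P-h}. mangoldt d * mangoldt (d + h) * \<kappa> d (d + h)) 
     = (\<Sum>h=1..P. mangoldt_pairs P h * geometric_weight M (real h * \<alpha>))"
    unfolding mangoldt_pairs_def sum_distrib_right
  proof (intro sum.cong refl)
    fix h d
    have "\<kappa> d (d + h) = geometric_weight M (- (real h * \<alpha>))" by (simp add: \<kappa>_def algebra_simps)
    then show "mangoldt d * mangoldt (d + h) * \<kappa> d (d + h) = mangoldt d * mangoldt (d + h) * geometric_weight M (real h * \<alpha>)"
      by (simp add: geometric_weight_minus)
  qed
  finally show ?thesis by (simp add: power_mult_distrib power2_eq_square mult_ac mult_right_mono)
qed

text \<open>The exponent \<open>2 * i\<close> anticipates the square root in the bound for a box,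
  after which the \<open>i\<close>-th power remains. Any base strictly between
  \<open>2 powr (-1/4)\<close> and 1 would serve.\<close>

lemma square_div_exp_half_le:
  "\<exists>C>0. \<forall>i::nat. (real i + 1)^2 / sqrt (2 ^ i) \<le> C * (2 powr (-1/8)) ^ (2 * i)"
proof -
  have "((\<lambda>i::nat. (real i + 1)^2 / sqrt (2 ^ i) * 2 powr (real i / 4)) \<longlongrightarrow> 0) sequentially"
    by real_asymp
  then have "Bseq (\<lambda>i::nat. (real i + 1)^2 / sqrt (2 ^ i) * 2 powr (real i / 4))" 
    by (intro convergent_imp_Bseq) (auto simp: convergent_def)
  then obtain C where C: "C > 0" "\<And>i::nat. norm ((real i + 1)^2 / sqrt (2 ^ i) * 2 powr (real i / 4)) \<le> C"
    by (auto simp: Bseq_def)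
  have "(real i + 1)^2 / sqrt (2 ^ i) \<le> C * (2 powr (-1/8)) ^ (2 * i)" for i
  proof -
    have "(2 powr (-1/8)) ^ (2 * i) = 2 powr (- (real i / 4))"
      by (subst powr_realpow[symmetric]) (simp_all add: powr_powr)
    then have eq: "(2 powr (-1/8)) ^ (2 * i) * 2 powr (real i / 4) = 1"
      by (simp flip: powr_add)
    have "(real i + 1)^2 / sqrt (2 ^ i) * 2 powr (real i / 4) \<le> C"
      using C(2)[of i] by (simp add: abs_mult)
    also have "\<dots> = C * (2 powr (-1/8)) ^ (2 * i) * 2 powr (real i / 4)" using eq by (simp add: mult.assoc)
    finally show ?thesis by (rule mult_right_le_imp_le) simp
  qed
  then show ?thesis using C(1) by blast
qed

text \<open>The estimate of a box produces only \<open>(1 + ln R) / R\<close> and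
  \<open>1 / R\<close>. Both are absorbed in \<open>ln R ^ 3 / R\<close>, whose square root is the
  factor in the theorem, because \<open>ln R\<close> is at least \<open>ln 2\<close>, hence at least
  2/3.\<close>

lemma ln_cube_div_ge:
  assumes "2 \<le> (R::real)"
  shows "(1 + ln R) / R \<le> 6 * (ln R ^ 3 / R)" "1 / R \<le> 4 * (ln R ^ 3 / R)"
proof -
  have "ln (2::real) \<ge> 2/3" using ln2_ge_two_thirds .
  moreover have "ln 2 \<le> ln R" using assms by (subst ln_le_cancel_iff) auto
  ultimately have L: "ln R \<ge> 2/3" by linarith
  have c: "(2/3)^3 \<le> ln R ^ 3" using L by (intro power_mono) auto
  have s: "(2/3)^2 \<le> ln R ^ 2" using L by (intro power_mono) auto
  have "ln R * (2/3)^2 \<le> ln R * ln R ^ 2" using s L by (intro mult_left_mono) auto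
  then have "ln R * (4/9) \<le> ln R ^ 3" by (simp add: power3_eq_cube power2_eq_square)
  then have "1 + ln R \<le> 6 * ln R ^ 3" "1 \<le> 4 * ln R ^ 3" using c by (simp_all add: power3_eq_cube)
  then show "(1 + ln R) / R \<le> 6 * (ln R ^ 3 / R)" "1 / R \<le> 4 * (ln R ^ 3 / R)"
    using assms by (auto simp: divide_simps)
qed

lemma dyadic_box_bound:
  "\<exists>C>0. \<forall>f \<alpha> y X R i j (b::int) (r::int).
     (\<forall>n. norm (f n) \<le> 1) \<longrightarrow> 2 \<le> y \<longrightarrow> 2 \<le> R \<longrightarrow> 1 \<le> i + j \<longrightarrow>
     coprime b r \<longrightarrow> R \<le> of_int r \<longrightarrow> of_int r \<le> 2 * sqrt (2 ^ (i + j)) \<longrightarrow>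
     \<bar>of_int r * \<alpha> - of_int b\<bar> \<le> 1 / of_int r \<longrightarrow>
     norm (dyadic_box f \<alpha> y X (2 ^ i) (2 ^ j)) 
       \<le> C / real (i + j) * (sqrt (ln R ^ 3 / R) + (2 powr (-1/8)) ^ i + (2 powr (-1/8)) ^ j)"
proof -
  obtain K where K: "K > 0" "\<And>i h::nat. h > 0 \<Longrightarrow> mangoldt_pairs (2^i) h \<le> K * 2^i * (\<Sum>d | d dvd h. 1 / real d)"
    using mangoldt_pairs_le by blast
  obtain C1 where C1: "C1 > 0" "\<And>i::nat. (real i + 1)^2 / sqrt (2 ^ i) \<le> C1 * (2 powr (-1/8)) ^ (2 * i)"
    using square_div_exp_half_le by blast
  define C where "C = sqrt ((1 + 64 * K) * (1 + C1)) * 2"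
  have "norm (dyadic_box f \<alpha> y X (2 ^ i) (2 ^ j)) 
       \<le> C / real (i + j) * (sqrt (ln R ^ 3 / R) + (2 powr (-1/8)) ^ i + (2 powr (-1/8)) ^ j)"
    if f: "\<forall>n. norm (f n) \<le> 1" and y: "2 \<le> y" and R: "2 \<le> R" and ij: "1 \<le> i + j"
     and br: "coprime b r" and r: "R \<le> of_int r" "of_int r \<le> 2 * sqrt (2 ^ (i + j))"
     and app: "\<bar>of_int r * \<alpha> - of_int b\<bar> \<le> 1 / of_int r"
    for f \<alpha> y X R i j and b r :: int
  proof -
    define P M :: nat where "P = 2 ^ i" and "M = 2 ^ j"
    define q :: real where "q = 2 powr (-1/8)"
    define \<rho>2 where "\<rho>2 = ln R ^ 3 / R"
    define E where "E i = (real i + 1)^2 / sqrt (2 ^ i)" for i :: nat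
    \<comment> \<open>With this choice \<open>ln D\<close> is at most each of \<open>ln R\<close>,
      \<open>i\<close> and \<open>j\<close>, so every term below can use the bound that it can
      afford, while \<open>1 / D\<close> is still at most
      \<open>1 / R + 1 / P + 1 / M\<close>.\<close>
    define D where "D = min R (min (real P) (real M))"
    have P1: "real P \<ge> 1" and M1: "real M \<ge> 1" by (auto simp: P_def M_def)
    have D1: "D \<ge> 1" using R P1 M1 by (simp add: D_def)
    have r0: "r > 0" using r(1) R by (smt (verit) of_int_0_less_iff)
    have rR: "real_of_int r > 0" using r0 by simp
    have PM: "P * M \<ge> 2"
    proof -
      have "(2::nat) ^ 1 \<le> 2 ^ (i + j)" using ij by (rule power_increasing) simp
      then show ?thesis by (simp add: P_def M_def power_add)
    qed
    have lnD: "ln D \<ge> 0" "ln D \<le> ln R" "ln D \<le> real i" "ln D \<le> real j"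
    proof -
      show "ln D \<ge> 0" using D1 by simp
      show "ln D \<le> ln R" using D1 R by (subst ln_le_cancel_iff) (auto simp: D_def)
      have l: "ln (2 ^ k) \<le> real k" for k
        using ln_2_less_1 mult_left_le[of "ln 2" "real k"] by (simp add: ln_realpow)
      have "ln D \<le> ln (2 ^ i)" using D1 by (subst ln_le_cancel_iff) (auto simp: D_def P_def)
      with l[of i] show "ln D \<le> real i" by linarith
      have "ln D \<le> ln (2 ^ j)" using D1 by (subst ln_le_cancel_iff) (auto simp: D_def M_def)
      with l[of j] show "ln D \<le> real j" by linarith
    qed
    define \<kappa> where "\<kappa> h = geometric_weight (real M) (real h * \<alpha>)" for h :: nat
    have S1: "(\<Sum>d\<in>{P..<2*P}. mangoldt d ^ 2) \<le> real P * (real i + 1)^2"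
    proof -
      have "(mangoldt d :: real) ^ 2 \<le> (real i + 1)^2" if d: "d \<in> {P..<2*P}" for d
      proof (rule power_mono)
        have d0: "d > 0" using d P1 by auto
        then have "mangoldt d \<le> ln (real d)" by (rule mangoldt_le)
        also have "\<dots> \<le> ln (2 ^ (i + 1))"
        proof -
          have "real d \<le> real (2 ^ (i + 1))" using d by (intro of_nat_mono) (simp add: P_def)
          then show ?thesis using d0 by (subst ln_le_cancel_iff) auto
        qed
        also have "\<dots> = (real i + 1) * ln 2" by (subst ln_realpow) auto
        also have "\<dots> \<le> (real i + 1) * 1" using ln_2_less_1 by (intro mult_left_mono) auto
        finally show "(mangoldt d :: real) \<le> real i + 1" by simp
      qed (rule mangoldt_nonneg)
      then have "(\<Sum>d\<in>{P..<2*P}. mangoldt d ^ 2) \<le> (\<Sum>d\<in>{P..<2*P}. (real i + 1)^2)" by (intro sum_mono)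
      then show ?thesis by simp
    qed
    have S2: "(\<Sum>h=1..P. mangoldt_pairs P h * \<kappa> h) 
        \<le> K * real P * ((1 + ln D) * ((2 * real P / of_int r + 1) * (2 + 6 * of_int r / sqrt (real M))) + 2 * real P / D)"
    proof -
      have "(\<Sum>h=1..P. mangoldt_pairs P h * \<kappa> h) \<le> (\<Sum>h=1..P. (K * real P * (\<Sum>d | d dvd h. 1 / real d)) * \<kappa> h)"
      proof (intro sum_mono mult_right_mono)
        fix h assume "h \<in> {1..P}"
        then show "mangoldt_pairs P h \<le> K * real P * (\<Sum>d | d dvd h. 1 / real d)"
          unfolding P_def using K(2)[of h i] by simp
      qed (simp add: \<kappa>_def geometric_weight_bounds)
      also have "\<dots> = K * real P * (\<Sum>h=1..P. (\<Sum>d | d dvd h. 1 / real d) * \<kappa> h)"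
        using sum_distrib_left[of "K * real P" "\<lambda>h. (\<Sum>d | d dvd h. 1 / real d) * \<kappa> h" "{1..P}"]
        by (simp only: mult.assoc)
      also have "\<dots> \<le> K * real P * ((1 + ln D) * (\<Sum>h=1..P. \<kappa> h) + 2 * real P / D)"
        using K(1) D1 by (intro mult_left_mono sum_divisor_weight_le) (auto simp: \<kappa>_def geometric_weight_bounds)
      also have "\<dots> \<le> K * real P * ((1 + ln D) * ((2 * real P / of_int r + 1) * (2 + 6 * of_int r / sqrt (real M))) + 2 * real P / D)"
        unfolding \<kappa>_def using K(1) lnD(1) M1
        by (intro mult_left_mono add_right_mono sum_geometric_weight_le[OF br r0 app]) auto
      finally show ?thesis .
    qed
    have sqP: "sqrt (real P) > 0" "sqrt (real M) > 0" using P1 M1 by auto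
    have PP: "real P = sqrt (real P) * sqrt (real P)" "real M = sqrt (real M) * sqrt (real M)" by simp_all
    have Ei: "E i \<ge> (1 + real i) / sqrt (real P)" "E j \<ge> (1 + real j) / sqrt (real M)"
      "E i \<ge> (1 + real i) / real P" "E j \<ge> 1 / real M" "E i \<ge> 1 / real P" "E i \<ge> (real i + 1)^2 / real P"
    proof -
      have sq: "1 + real k \<le> (real k + 1)^2" "1 \<le> (real k + 1)^2" for k 
        by (simp_all add: power2_eq_square algebra_simps)
      have sP: "sqrt (real P) \<le> real P" "sqrt (real M) \<le> real M"
        using P1 M1 by (auto intro!: real_le_lsqrt simp: power2_eq_square mult_le_cancel_left1)
      have EP: "E i = (real i + 1)^2 / sqrt (real P)" "E j = (real j + 1)^2 / sqrt (real M)"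
        by (auto simp: E_def P_def M_def)
      show "E i \<ge> (1 + real i) / sqrt (real P)" "E j \<ge> (1 + real j) / sqrt (real M)"
        "E i \<ge> (1 + real i) / real P" "E j \<ge> 1 / real M" "E i \<ge> 1 / real P" "E i \<ge> (real i + 1)^2 / real P"
        unfolding EP using sq sP sqP by (auto intro!: frac_le)
    qed
    \<comment> \<open>Expanding the product gives four terms. The one with \<open>1 / r\<close> is
      paid for by \<open>R \<le> r\<close>, those with \<open>1 / sqrt M\<close> and
      \<open>1 / P\<close> by the sides of the box. In the mixed term \<open>r\<close> stands in the
      numerator; it is paid for by \<open>r \<le> 2 * sqrt P * sqrt M\<close>, the reason for the
      upper bound on the denominator.\<close>
    have br1: "(real i + 1)^2 / real P + 2 * K * ((1 + ln D) * ((2 / of_int r + 1 / real P) * (2 + 6 * of_int r / sqrt (real M))) + 2 / D)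
       \<le> (1 + 64 * K) * (\<rho>2 + E i + E j)"
    proof -
      have e1: "(1 + ln D) * (4 / of_int r) \<le> 24 * \<rho>2"
      proof -
        have "(1 + ln D) * (4 / of_int r) \<le> (1 + ln R) * (4 / R)"
          using lnD r R by (intro mult_mono divide_left_mono) auto
        also have "\<dots> = 4 * ((1 + ln R) / R)" by simp
        also have "\<dots> \<le> 4 * (6 * \<rho>2)" unfolding \<rho>2_def using ln_cube_div_ge(1)[OF R] by (intro mult_left_mono) auto
        finally show ?thesis by simp
      qed
      have e2: "(1 + ln D) * (12 / sqrt (real M)) \<le> 12 * E j"
      proof -
        have "(1 + ln D) * (12 / sqrt (real M)) \<le> (1 + real j) * (12 / sqrt (real M))"
          using lnD by (intro mult_right_mono) auto
        also have "\<dots> = 12 * ((1 + real j) / sqrt (real M))" by simp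
        finally show ?thesis using Ei(2) by linarith
      qed
      have e3: "(1 + ln D) * (2 / real P) \<le> 2 * E i"
      proof -
        have "(1 + ln D) * (2 / real P) \<le> (1 + real i) * (2 / real P)"
          using lnD by (intro mult_right_mono) auto
        also have "\<dots> = 2 * ((1 + real i) / real P)" by simp
        finally show ?thesis using Ei(3) by linarith
      qed
      have e4: "(1 + ln D) * (6 * of_int r / (real P * sqrt (real M))) \<le> 12 * E i"
      proof -
        have "6 * of_int r / (real P * sqrt (real M)) \<le> 6 * (2 * sqrt (2 ^ (i + j))) / (real P * sqrt (real M))"
          using r P1 by (intro divide_right_mono mult_left_mono) auto
        also have "sqrt (2 ^ (i + j)) = sqrt (real P) * sqrt (real M)"
          by (simp add: P_def M_def power_add real_sqrt_mult)
        also have "6 * (2 * (sqrt (real P) * sqrt (real M))) / (real P * sqrt (real M)) = 12 / sqrt (real P)"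
          using sqP by (subst PP(1)) (simp del: real_sqrt_mult_self add: field_simps)
        finally have "(1 + ln D) * (6 * of_int r / (real P * sqrt (real M))) \<le> (1 + real i) * (12 / sqrt (real P))"
          using lnD P1 rR by (intro mult_mono) auto
        also have "\<dots> = 12 * ((1 + real i) / sqrt (real P))" by simp
        finally show ?thesis using Ei(1) by linarith
      qed
      have e5: "2 / D \<le> 8 * \<rho>2 + 2 * E i + 2 * E j"
      proof -
        have "2 / D \<le> 2 / R + 2 / real P + 2 / real M"
          using R P1 M1 by (auto simp: D_def min_def intro: add_nonneg_nonneg)
        moreover have "2 / R \<le> 8 * \<rho>2" using ln_cube_div_ge(2)[OF R] unfolding \<rho>2_def by simp
        ultimately show ?thesis using Ei(4,5) by simp
      qed
      have "(2 / of_int r + 1 / real P) * (2 + 6 * of_int r / sqrt (real M)) 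
          = 4 / of_int r + 12 / sqrt (real M) + 2 / real P + 6 * of_int r / (real P * sqrt (real M))"
        using rR sqP P1 by (simp add: field_simps)
      then have "(1 + ln D) * ((2 / of_int r + 1 / real P) * (2 + 6 * of_int r / sqrt (real M)))
         = (1 + ln D) * (4 / of_int r) + (1 + ln D) * (12 / sqrt (real M)) + (1 + ln D) * (2 / real P) 
           + (1 + ln D) * (6 * of_int r / (real P * sqrt (real M)))"
        by (simp only: distrib_left)
      then have le1: "(1 + ln D) * ((2 / of_int r + 1 / real P) * (2 + 6 * of_int r / sqrt (real M))) + 2 / D
         \<le> 32 * \<rho>2 + 16 * E i + 14 * E j" using e1 e2 e3 e4 e5 by linarith
      have nn: "\<rho>2 \<ge> 0" "E i \<ge> 0" "E j \<ge> 0" using R by (auto simp: \<rho>2_def E_def)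
      have "32 * \<rho>2 + 16 * E i + 14 * E j \<le> 32 * (\<rho>2 + E i + E j)" using nn by simp
      with le1 have "(1 + ln D) * ((2 / of_int r + 1 / real P) * (2 + 6 * of_int r / sqrt (real M))) + 2 / D
         \<le> 32 * (\<rho>2 + E i + E j)" by (rule order_trans)
      then have "2 * K * ((1 + ln D) * ((2 / of_int r + 1 / real P) * (2 + 6 * of_int r / sqrt (real M))) + 2 / D)
         \<le> 2 * K * (32 * (\<rho>2 + E i + E j))" using K(1) by (intro mult_left_mono) auto
      then show ?thesis using Ei(6) nn by (simp add: algebra_simps)
    qed
    have "norm (dyadic_box f \<alpha> y X P M) ^ 2 \<le> (real M * log_weight (P * M)) ^ 2 * 
       ((\<Sum>d\<in>{P..<2*P}. mangoldt d ^ 2) + 2 * (\<Sum>h=1..P. mangoldt_pairs P h * \<kappa> h))"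
      unfolding \<kappa>_def using f y PM by (intro norm_dyadic_box_square_le) auto
    also have "\<dots> \<le> (real M * log_weight (P * M)) ^ 2 * (real P * (real i + 1)^2 + 
       2 * (K * real P * ((1 + ln D) * ((2 * real P / of_int r + 1) * (2 + 6 * of_int r / sqrt (real M))) + 2 * real P / D)))"
      using S1 S2 by (intro mult_left_mono add_mono) auto
    also have "\<dots> = (real M * log_weight (P * M) * real P) ^ 2 * ((real i + 1)^2 / real P 
       + 2 * K * ((1 + ln D) * ((2 / of_int r + 1 / real P) * (2 + 6 * of_int r / sqrt (real M))) + 2 / D))"
    proof -
      have 1: "real P * (real i + 1)^2 = real P ^ 2 * ((real i + 1)^2 / real P)"
        using P1 by (simp add: power2_eq_square)
      have 2: "2 * real P / of_int r + 1 = real P * (2 / of_int r + 1 / real P)"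
        using P1 rR by (simp add: field_simps)
      have 3: "2 * real P / D = real P * (2 / D)" by simp
      have "(m * w) ^ 2 * (p ^ 2 * x + 2 * (K * p * (l * (p * u * v) + p * t))) 
          = (m * w * p) ^ 2 * (x + 2 * K * (l * (u * v) + t))" for m w p x l u v t :: real
        by (simp add: power2_eq_square algebra_simps)
      then show ?thesis unfolding 1 2 3 .
    qed
    also have "\<dots> \<le> (real M * log_weight (P * M) * real P) ^ 2 * ((1 + 64 * K) * (\<rho>2 + E i + E j))"
      using br1 by (intro mult_left_mono) auto
    \<comment> \<open>The sides of the box cancel \<open>1 / (P * M)\<close> in the weight, and only
      \<open>1 / ln (P * M)\<close> remains: the factor \<open>1 / (i + j)\<close> of the
      result.\<close>
    also have "real M * log_weight (P * M) * real P = 1 / (real (i + j) * ln 2)"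
    proof -
      have "ln (real (P * M)) = real (i + j) * ln 2"
        by (simp add: P_def M_def ln_realpow flip: power_add)
      then show ?thesis using P1 M1 by (simp add: log_weight_def)
    qed
    \<comment> \<open>A sum of squares is dominated by the square of the sum, so that the root can
      be taken term by term at the end.\<close>
    also have "(1 / (real (i + j) * ln 2)) ^ 2 * ((1 + 64 * K) * (\<rho>2 + E i + E j)) 
       \<le> (2 / real (i + j)) ^ 2 * ((1 + 64 * K) * ((1 + C1) * (sqrt \<rho>2 + q ^ i + q ^ j) ^ 2))"
    proof (intro mult_mono power_mono)
      have "ln 2 \<ge> (1/2::real)" using ln2_ge_two_thirds by linarith
      then have "1 / (real (i + j) * ln 2) \<le> 1 / (real (i + j) * (1/2))"
        using ij by (intro divide_left_mono mult_left_mono mult_pos_pos) auto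
      then show "1 / (real (i + j) * ln 2) \<le> 2 / real (i + j)" by simp
      have nn: "\<rho>2 \<ge> 0" "q \<ge> 0" using R by (auto simp: \<rho>2_def q_def)
      have "\<rho>2 + E i + E j \<le> (1 + C1) * (\<rho>2 + q ^ (2*i) + q ^ (2*j))"
      proof -
        have "E i \<le> C1 * q ^ (2*i)" "E j \<le> C1 * q ^ (2*j)" using C1(2) by (auto simp: E_def q_def)
        moreover have "q ^ (2*i) \<ge> 0" "q ^ (2*j) \<ge> 0" "C1 * \<rho>2 \<ge> 0" using nn C1(1) by auto
        ultimately show ?thesis by (simp add: algebra_simps)
      qed
      also have "\<dots> \<le> (1 + C1) * (sqrt \<rho>2 + q ^ i + q ^ j) ^ 2"
      proof (rule mult_left_mono)
        have "(sqrt \<rho>2 + q ^ i + q ^ j) ^ 2 = \<rho>2 + q ^ (2*i) + q ^ (2*j) 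
            + 2 * (sqrt \<rho>2 * q ^ i + sqrt \<rho>2 * q ^ j + q ^ i * q ^ j)"
          using nn by (simp add: power2_eq_square algebra_simps power_mult power_mult_distrib flip: power_add)
        also have "\<dots> \<ge> \<rho>2 + q ^ (2*i) + q ^ (2*j)" using nn by simp
        finally show "\<rho>2 + q ^ (2*i) + q ^ (2*j) \<le> (sqrt \<rho>2 + q ^ i + q ^ j) ^ 2" .
      qed (use C1(1) in auto)
      finally show "\<rho>2 + E i + E j \<le> (1 + C1) * (sqrt \<rho>2 + q ^ i + q ^ j) ^ 2" .
    qed (use K(1) R in \<open>auto simp: \<rho>2_def E_def\<close>)
    also have "\<dots> = (C / real (i + j) * (sqrt \<rho>2 + q ^ i + q ^ j)) ^ 2"
    proof -
      have "C ^ 2 = 4 * ((1 + 64 * K) * (1 + C1))"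
        unfolding C_def power_mult_distrib using K(1) C1(1) by (subst real_sqrt_pow2) auto
      then show ?thesis by (simp add: power_mult_distrib power_divide)
    qed
    finally have "norm (dyadic_box f \<alpha> y X P M) \<le> C / real (i + j) * (sqrt \<rho>2 + q ^ i + q ^ j)"
      by (rule power2_le_imp_le) (use K(1) C1(1) R in \<open>auto simp: C_def \<rho>2_def q_def\<close>)
    then show ?thesis by (simp add: P_def M_def \<rho>2_def q_def)
  qed
  moreover have "C > 0" unfolding C_def using K(1) C1(1) by simp
  ultimately show ?thesis by (intro exI[of _ C] conjI allI impI) auto
qed

section \<open>Summation over all boxes\<close>

lemma sum_dyadic:
  fixes h :: "nat \<Rightarrow> 'a :: comm_monoid_add"
  shows "(\<Sum>d\<in>{1..<2^J}. h d) = (\<Sum>i<J. \<Sum>d\<in>{2^i..<2 * 2^i}. h d)"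
proof (induction J)
  case (Suc J)
  have "(\<Sum>d\<in>{1..<2^Suc J}. h d) = (\<Sum>d\<in>{1..<2^J}. h d) + (\<Sum>d\<in>{2^J..<2 * 2^J}. h d)"
    by (subst sum.atLeastLessThan_concat) auto
  then show ?case using Suc by simp
qed simp

text \<open>Complete multiplicativity gives \<open>f n = f d * f (n div d)\<close> for every divisor
  \<open>d\<close>, coprime to its cofactor or not, and the exponential depends on the product only.
  The condition \<open>X < 2 ^ J\<close> places both factors of every \<open>n\<close> in the range
  in some box.\<close>

lemma log_sum_eq_dyadic_boxes:
  fixes f :: "nat \<Rightarrow> complex"
  assumes mult: "\<And>m n. f (m * n) = f m * f n" and y: "y \<ge> 2" and X: "X < 2 ^ J"
  shows "(\<Sum>n | y < real n \<and> real n \<le> X. f n * cis (2 * pi * (real n * \<alpha>)) / of_nat n)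
    = (\<Sum>i<J. \<Sum>j<J. dyadic_box f \<alpha> y X (2^i) (2^j))"
proof -
  define N where "N = {n. y < real n \<and> real n \<le> X}"
  define g where "g d m = mangoldt d * f d * f m * cis (2 * pi * (real (d * m) * \<alpha>)) * of_real (log_weight (d * m))" for d m
  define G where "G d m = (if y < real (d * m) \<and> real (d * m) \<le> X then g d m else 0)" for d m
  let ?I = "{1..<2^J} :: nat set"
  have Nlt: "2 < n" "n < 2 ^ J" if "n \<in> N" for n
  proof -
    have "y < real n" "real n \<le> X" using that by (auto simp: N_def)
    then have "2 < real n" "real n < 2 ^ J" using y X by linarith+
    then have "2 < real n" "real n < real (2 ^ J)" by simp_all
    then show "2 < n" "n < 2 ^ J" by (linarith, linarith)
  qed
  have finN: "finite N" by (rule finite_subset[of _ "{..<2^J}"]) (use Nlt in auto)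
  have "(\<Sum>n\<in>N. f n * cis (2 * pi * (real n * \<alpha>)) / of_nat n) = (\<Sum>n\<in>N. \<Sum>d | d dvd n. g d (n div d))"
  proof (rule sum.cong[OF refl])
    fix n assume n: "n \<in> N"
    then have "real n > 2" using y by (simp add: N_def)
    then have n0: "n \<noteq> 0" and ln: "ln (real n) > 0" by auto
    have "(\<Sum>d | d dvd n. g d (n div d)) 
       = (\<Sum>d | d dvd n. mangoldt d * (f n * cis (2 * pi * (real n * \<alpha>)) * of_real (log_weight n)))"
    proof (rule sum.cong[OF refl])
      fix d assume "d \<in> {d. d dvd n}"
      then have 1: "d * (n div d) = n" by simp
      then have 2: "f n = f d * f (n div d)" by (metis mult)
      show "g d (n div d) = mangoldt d * (f n * cis (2 * pi * (real n * \<alpha>)) * of_real (log_weight n))"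
        unfolding g_def 1 2 by (simp add: mult_ac)
    qed
    also have "\<dots> = of_real (ln (real n)) * (f n * cis (2 * pi * (real n * \<alpha>)) * of_real (log_weight n))"
      unfolding sum_distrib_right[symmetric] using n0 by (subst mangoldt_sum) auto
    also have "\<dots> = of_real (ln (real n) * log_weight n) * (f n * cis (2 * pi * (real n * \<alpha>)))"
      by simp
    also have "ln (real n) * log_weight n = 1 / real n" using ln by (simp add: log_weight_def)
    finally show "f n * cis (2 * pi * (real n * \<alpha>)) / of_nat n = (\<Sum>d | d dvd n. g d (n div d))" 
      by simp
  qed
  also have "\<dots> = (\<Sum>(n,d)\<in>Sigma N (\<lambda>n. {d. d dvd n}). g d (n div d))"
  proof (subst sum.Sigma)
    show "\<forall>n\<in>N. finite {d. d dvd n}"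
    proof
      fix n assume "n \<in> N"
      then have "n > 0" using Nlt(1)[of n] by simp
      then show "finite {d. d dvd n}" by simp
    qed
  qed (use finN in auto)
  also have "\<dots> = (\<Sum>(m,d)\<in>{(m,d)\<in>?I \<times> ?I. d * m \<in> N}. g d m)"
  proof (rule sum.reindex_bij_witness[where i = "\<lambda>(m,d). (d * m, d)" and j = "\<lambda>(n,d). (n div d, d)"])
    fix x assume x: "x \<in> Sigma N (\<lambda>n. {d. d dvd n})"
    obtain n d where nd: "x = (n,d)" by fastforce
    with x have n: "n \<in> N" "d dvd n" by auto
    have n0: "n > 0" using Nlt[OF n(1)] by simp
    have "0 < d" "0 < n div d" using n n0 by (auto intro!: Nat.gr0I simp: dvd_div_eq_0_iff)
    moreover have "d < 2 ^ J" "n div d < 2 ^ J"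
      using n n0 Nlt(2)[OF n(1)] div_le_dividend[of n d] dvd_imp_le[of d n] by linarith+
    ultimately show "(case x of (n,d) \<Rightarrow> (n div d, d)) \<in> {(m,d)\<in>?I \<times> ?I. d * m \<in> N}"
      using n nd by auto
  next
    fix x assume x: "x \<in> {(m,d)\<in>?I \<times> ?I. d * m \<in> N}"
    then show "(case (case x of (m,d) \<Rightarrow> (d * m, d)) of (n,d) \<Rightarrow> (n div d, d)) = x" by auto
  qed auto
  also have "\<dots> = (\<Sum>(m,d)\<in>?I \<times> ?I. G d m)"
    by (rule sum.mono_neutral_cong_left) (auto simp: G_def N_def split: if_splits)
  also have "\<dots> = (\<Sum>m\<in>?I. \<Sum>d\<in>?I. G d m)" by (simp add: sum.cartesian_product)
  also have "\<dots> = (\<Sum>j<J. \<Sum>m\<in>{2^j..<2 * 2^j}. \<Sum>i<J. \<Sum>d\<in>{2^i..<2 * 2^i}. G d m)"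
    by (simp only: sum_dyadic)
  also have "\<dots> = (\<Sum>j<J. \<Sum>i<J. \<Sum>m\<in>{2^j..<2 * 2^j}. \<Sum>d\<in>{2^i..<2 * 2^i}. G d m)"
    by (intro sum.cong refl sum.swap)
  also have "\<dots> = (\<Sum>i<J. \<Sum>j<J. dyadic_box f \<alpha> y X (2^i) (2^j))"
    unfolding dyadic_box_def G_def g_def by (rule sum.swap)
  finally show ?thesis by (simp only: N_def)
qed

text \<open>Each factor is less than twice its lower end, so all products lie between
  \<open>2 ^ (i + j)\<close> and \<open>2 ^ (i + j + 2)\<close>.\<close>

lemma dyadic_box_eq_0:
  assumes "\<not> (y < 2 ^ (i + j + 2) \<and> 2 ^ (i + j) \<le> X)"
  shows "dyadic_box f \<alpha> y X (2^i) (2^j) = 0"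
  unfolding dyadic_box_def
proof (intro sum.neutral ballI)
  fix m d :: nat assume md: "m \<in> {2^j..<2 * 2^j}" "d \<in> {2^i..<2 * 2^i}"
  have "2^i * 2^j \<le> d * m" "d * m \<le> (2 * 2^i) * (2 * 2^j)" using md by (intro mult_le_mono; auto)+
  then have "2 ^ (i + j) \<le> d * m" "d * m \<le> 2 ^ (i + j + 2)" by (simp_all add: power_add)
  then have "real (2 ^ (i + j)) \<le> real (d * m)" "real (d * m) \<le> real (2 ^ (i + j + 2))" 
    by (simp_all only: of_nat_le_iff)
  then have "\<not> (y < real (d * m) \<and> real (d * m) \<le> X)" using assms by auto
  then show "(if y < real (d * m) \<and> real (d * m) \<le> X
     then mangoldt d * f d * f m * cis (2 * pi * (real (d * m) * \<alpha>)) * complex_of_real (log_weight (d * m)) else 0) = 0"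
    by auto
qed

lemma sum_inverse_le_ln:
  assumes "0 < a" "a \<le> b"
  shows "(\<Sum>k=a..b. 1 / real k) \<le> 1 / real a + ln (real b / real a)"
proof -
  have "{1..b} = {1..a} \<union> {Suc a..b}" using assms by auto
  then have "(harm b :: real) = harm a + (\<Sum>k=Suc a..b. 1 / real k)"
    unfolding harm_def by (simp add: sum.union_disjoint divide_inverse)
  moreover have "(\<Sum>k=a..b. 1 / real k) = 1 / real a + (\<Sum>k=Suc a..b. 1 / real k)"
    using assms by (simp add: sum.atLeast_Suc_atMost)
  ultimately have "(\<Sum>k=a..b. 1 / real k) = 1 / real a + (harm b - harm a)" by simp
  moreover have "harm b - ln (real b) \<le> harm a - ln (real a)"
    using assms by (rule euler_mascheroni_sequence_decreasing)
  moreover have "ln (real b / real a) = ln (real b) - ln (real a)" using assms by (simp add: ln_div)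
  ultimately show ?thesis by simp
qed

lemma sum_geometric_le:
  fixes q :: real
  assumes "0 \<le> q" "q < 1"
  shows "(\<Sum>i\<le>k. q ^ i) \<le> 1 / (1 - q)"
  using assms by (simp add: sum_gp0 divide_right_mono)

text \<open>Rational approximations are demanded only for those \<open>k\<close> whose boxes can
  reach beyond \<open>y\<close>. The number of relevant \<open>k\<close> is O(\<open>ln X\<close>),
  and their reciprocals add up to at most \<open>2 + ln (ln X / ln y)\<close>.\<close>

lemma log_exponential_sum_bound:
  "\<exists>C>0. \<forall>f \<alpha> y X R.
     (\<forall>m n. f (m * n) = f m * f n) \<longrightarrow> (\<forall>n. norm (f n) \<le> 1) \<longrightarrow> 16 \<le> y \<longrightarrow> y \<le> X \<longrightarrow> 2 \<le> R \<longrightarrow>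
     (\<forall>k. y < 2 ^ (k + 2) \<longrightarrow> (\<exists>b r::int. coprime b r \<and> R \<le> of_int r \<and> of_int r \<le> 2 * sqrt (2 ^ k) \<and>
        \<bar>of_int r * \<alpha> - of_int b\<bar> \<le> 1 / of_int r)) \<longrightarrow>
     norm (\<Sum>n | y < real n \<and> real n \<le> X. f n * cis (2 * pi * (real n * \<alpha>)) / of_nat n)
       \<le> C * (1 + ln (ln X / ln y) + sqrt (ln R ^ 3 / R) * ln X)"
proof -
  define q :: real where "q = 2 powr (-1/8)"
  have q: "0 \<le> q" "q < 1" 
    unfolding q_def by (simp, use powr_less_mono[of "-1/8" 0 "2::real"] in simp)
  obtain C0 where C0: "C0 > 0" "\<And>f \<alpha> y X R i j (b::int) (r::int).
     (\<forall>n. norm (f n) \<le> 1) \<Longrightarrow> 2 \<le> y \<Longrightarrow> 2 \<le> R \<Longrightarrow> 1 \<le> i + j \<Longrightarrow>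
     coprime b r \<Longrightarrow> R \<le> of_int r \<Longrightarrow> of_int r \<le> 2 * sqrt (2 ^ (i + j)) \<Longrightarrow>
     \<bar>of_int r * \<alpha> - of_int b\<bar> \<le> 1 / of_int r \<Longrightarrow>
     norm (dyadic_box f \<alpha> y X (2 ^ i) (2 ^ j)) 
       \<le> C0 / real (i + j) * (sqrt (ln R ^ 3 / R) + q ^ i + q ^ j)"
    using dyadic_box_bound unfolding q_def by blast
  define c where "c = 1 / (1 - q)"
  have c0: "c > 0" using q by (simp add: c_def)
  define C where "C = C0 * (6 + 4 * c)"
  have "norm (\<Sum>n | y < real n \<and> real n \<le> X. f n * cis (2 * pi * (real n * \<alpha>)) / of_nat n)
       \<le> C * (1 + ln (ln X / ln y) + sqrt (ln R ^ 3 / R) * ln X)"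
    if mult: "\<forall>m n. f (m * n) = f m * f n" and f: "\<forall>n. norm (f n) \<le> 1" and y: "16 \<le> y" and yX: "y \<le> X" and R: "2 \<le> R"
     and dio: "\<forall>k. y < 2 ^ (k + 2) \<longrightarrow> (\<exists>b r::int. coprime b r \<and> R \<le> of_int r \<and> of_int r \<le> 2 * sqrt (2 ^ k) \<and>
        \<bar>of_int r * \<alpha> - of_int b\<bar> \<le> 1 / of_int r)"
    for f :: "nat \<Rightarrow> complex" and \<alpha> y X R :: real
  proof -
    define \<rho> where "\<rho> = sqrt (ln R ^ 3 / R)"
    have \<rho>0: "\<rho> \<ge> 0" using R by (simp add: \<rho>_def)
    obtain J where J: "X < 2 ^ J" using real_arch_pow[of 2 X] by auto
    \<comment> \<open>Only boxes with \<open>i + j\<close> in this set meet the range of summation.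
      As \<open>y \<ge> 16\<close>, all elements are at least 3, so that \<open>k + 2\<close> is at
      most \<open>5/3 * k\<close>; this is the origin of 5/3 below.\<close>
    define Ks where "Ks = {k. y < 2 ^ (k + 2) \<and> 2 ^ k \<le> X}"
    have KsD: "k \<ge> 3" "ln y \<le> (real k + 2) * ln 2" "real k * ln 2 \<le> ln X" "k < J" if "k \<in> Ks" for k
    proof -
      have k: "y < 2 ^ (k + 2)" "2 ^ k \<le> X" using that by (auto simp: Ks_def)
      have "(2::real) ^ 4 < 2 ^ (k + 2)" using k(1) y by simp
      then have "4 < k + 2" by (rule power_less_imp_less_exp[rotated]) simp
      then show "k \<ge> 3" by simp
      have "ln y \<le> ln (2 ^ (k + 2))" using k y by (subst ln_le_cancel_iff) auto
      then show "ln y \<le> (real k + 2) * ln 2" by (subst (asm) ln_realpow) (auto simp: add.commute)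
      have "ln (2 ^ k) \<le> ln X" using k y yX by (subst ln_le_cancel_iff) auto
      then show "real k * ln 2 \<le> ln X" by (simp add: ln_realpow)
      have "(2::real) ^ k < 2 ^ J" using k J by linarith
      then show "k < J" by (rule power_less_imp_less_exp[rotated]) simp
    qed
    have finK: "finite Ks" by (rule finite_subset[of _ "{..<J}"]) (use KsD in auto)
    have lny: "ln y > 0" and lnX: "ln X \<ge> 1" and lnXy: "ln (ln X / ln y) \<ge> 0"
    proof -
      show *: "ln y > 0" using y by simp
      have "exp 1 \<le> X" using exp_le y yX by linarith
      then have "ln (exp 1) \<le> ln X" by (subst ln_le_cancel_iff) (auto intro: less_le_trans[OF exp_gt_zero])
      then show "ln X \<ge> 1" by simp
      have "ln y \<le> ln X" using y yX by (subst ln_le_cancel_iff) auto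
      then show "ln (ln X / ln y) \<ge> 0" using * by (intro ln_ge_zero) simp
    qed
    define F where "F i j = C0 / real (i + j) * (\<rho> + q ^ i + q ^ j)" for i j
    have F0: "F i j \<ge> 0" for i j using C0(1) \<rho>0 q by (simp add: F_def)
    have box: "norm (dyadic_box f \<alpha> y X (2^i) (2^j)) \<le> (if i + j \<in> Ks then F i j else 0)" for i j
    proof (cases "i + j \<in> Ks")
      case True
      then have "y < 2 ^ ((i + j) + 2)" by (simp add: Ks_def)
      with dio obtain b r :: int where "coprime b r" "R \<le> of_int r" "of_int r \<le> 2 * sqrt (2 ^ (i + j))"
        "\<bar>of_int r * \<alpha> - of_int b\<bar> \<le> 1 / of_int r" by blast
      then have "norm (dyadic_box f \<alpha> y X (2^i) (2^j)) \<le> F i j"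
        unfolding F_def \<rho>_def using f y R KsD(1)[OF True] by (intro C0(2)) auto
      then show ?thesis using True by simp
    next
      case False
      then have "dyadic_box f \<alpha> y X (2^i) (2^j) = 0" by (intro dyadic_box_eq_0) (simp add: Ks_def)
      then show ?thesis using False by simp
    qed
    \<comment> \<open>The part \<open>\<rho>\<close> is the same in all \<open>k + 1\<close> boxes
      and uses up the factor \<open>1 / k\<close>. The two geometric series converge along the
      diagonal and keep it.\<close>
    have inner: "(\<Sum>i\<le>k. F i (k - i)) \<le> C0 * (2 * \<rho> + 2 * c * (1 / real k))" if "k \<in> Ks" for k
    proof -
      have k: "real k \<ge> 3" using KsD(1)[OF that] by linarith
      have "(\<Sum>i\<le>k. F i (k - i)) = C0 / real k * (\<Sum>i\<le>k. \<rho> + q ^ i + q ^ (k - i))"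
        unfolding sum_distrib_left by (intro sum.cong) (auto simp: F_def)
      also have "(\<Sum>i\<le>k. \<rho> + q ^ i + q ^ (k - i)) = (real k + 1) * \<rho> + (\<Sum>i\<le>k. q ^ i) + (\<Sum>i\<le>k. q ^ (k - i))"
        by (simp add: sum.distrib)
      also have "(\<Sum>i\<le>k. q ^ (k - i)) = (\<Sum>i\<le>k. q ^ i)"
        by (rule sum.reindex_bij_witness[where i = "\<lambda>i. k - i" and j = "\<lambda>i. k - i"]) auto
      also have "C0 / real k * ((real k + 1) * \<rho> + (\<Sum>i\<le>k. q ^ i) + (\<Sum>i\<le>k. q ^ i)) 
          \<le> C0 / real k * ((2 * real k) * \<rho> + c + c)"
        unfolding c_def using C0(1) k \<rho>0 q
        by (intro mult_left_mono add_mono mult_right_mono sum_geometric_le) auto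
      also have "\<dots> = C0 * (2 * \<rho> + 2 * c * (1 / real k))" using k by (simp add: field_simps)
      finally show ?thesis .
    qed
    have "norm (\<Sum>n | y < real n \<and> real n \<le> X. f n * cis (2 * pi * (real n * \<alpha>)) / of_nat n)
       = norm (\<Sum>i<J. \<Sum>j<J. dyadic_box f \<alpha> y X (2^i) (2^j))"
      using mult y J by (subst log_sum_eq_dyadic_boxes) auto
    also have "\<dots> \<le> (\<Sum>i<J. \<Sum>j<J. if i + j \<in> Ks then F i j else 0)"
      by (intro sum_norm_le box)
    also have "\<dots> = (\<Sum>(i,j)\<in>{..<J} \<times> {..<J}. if i + j \<in> Ks then F i j else 0)"
      by (simp only: sum.cartesian_product)
    also have "\<dots> = (\<Sum>(i,j)\<in>{(i,j)\<in>{..<J} \<times> {..<J}. i + j \<in> Ks}. F i j)"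
      by (rule sum.mono_neutral_cong_right) (auto split: if_splits)
    also have "\<dots> \<le> (\<Sum>(k,i)\<in>Sigma Ks (\<lambda>k. {..k}). F i (k - i))"
    proof (rule sum_le_included[where i = "\<lambda>(k,i). (i, k - i)"])
      show "\<forall>x\<in>{(i,j)\<in>{..<J} \<times> {..<J}. i + j \<in> Ks}. \<exists>y\<in>Sigma Ks (\<lambda>k. {..k}).
          (case y of (k,i) \<Rightarrow> (i, k - i)) = x \<and> (case x of (i,j) \<Rightarrow> F i j) \<le> (case y of (k,i) \<Rightarrow> F i (k - i))"
      proof safe
        fix i j assume "i + j \<in> Ks"
        then show "\<exists>y\<in>Sigma Ks (\<lambda>k. {..k}). (case y of (k,i) \<Rightarrow> (i, k - i)) = (i,j) \<and> 
           F i j \<le> (case y of (k,i) \<Rightarrow> F i (k - i))"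
          by (intro bexI[of _ "(i + j, i)"]) auto
      qed
      have "finite ({..<J} \<times> {..<J})" by simp
      then show "finite {(i,j)\<in>{..<J} \<times> {..<J}. i + j \<in> Ks}" by (rule rev_finite_subset) auto
    qed (use finK F0 in auto)
    also have "\<dots> = (\<Sum>k\<in>Ks. \<Sum>i\<le>k. F i (k - i))"
      using finK by (subst sum.Sigma) auto
    also have "\<dots> \<le> (\<Sum>k\<in>Ks. C0 * (2 * \<rho> + 2 * c * (1 / real k)))" by (intro sum_mono inner)
    also have "\<dots> = C0 * (2 * \<rho> * real (card Ks) + 2 * c * (\<Sum>k\<in>Ks. 1 / real k))"
      by (simp add: sum_distrib_left sum.distrib algebra_simps)
    also have "\<dots> \<le> C0 * (2 * \<rho> * (3 * ln X) + 2 * c * (2 + ln (ln X / ln y)))"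
    proof (intro mult_left_mono add_mono)
      have l2: "ln (2::real) \<ge> 2/3" using ln2_ge_two_thirds .
      show "real (card Ks) \<le> 3 * ln X"
      proof (cases "Ks = {}")
        case False
        define k1 where "k1 = Max Ks"
        have k1: "k1 \<in> Ks" using finK False by (simp add: k1_def)
        have "Ks \<subseteq> {..k1}" using finK by (auto simp: k1_def)
        then have "card Ks \<le> card {..k1}" by (intro card_mono) auto
        then have "real (card Ks) \<le> real k1 + 1" by simp
        moreover have "real k1 * (2/3) \<le> real k1 * ln 2" using l2 by (intro mult_left_mono) auto
        ultimately show ?thesis using KsD(3)[OF k1] lnX by linarith
      qed (use lnX in auto)
      show "(\<Sum>k\<in>Ks. 1 / real k) \<le> 2 + ln (ln X / ln y)"
      proof (cases "Ks = {}")
        case False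
        define k0 k1 where "k0 = Min Ks" and "k1 = Max Ks"
        have k: "k0 \<in> Ks" "k1 \<in> Ks" using finK False by (simp_all add: k1_def k0_def)
        have k01: "k0 \<le> k1" using finK k by (simp add: k1_def)
        have sub: "Ks \<subseteq> {k0..k1}" using finK by (auto simp: k1_def k0_def)
        have k03: "real k0 \<ge> 3" using KsD(1)[OF k(1)] by linarith
        have "(\<Sum>k\<in>Ks. 1 / real k) \<le> (\<Sum>k=k0..k1. 1 / real k)" using sub by (intro sum_mono2) auto
        also have "\<dots> \<le> 1 / real k0 + ln (real k1 / real k0)" using k03 k01 by (intro sum_inverse_le_ln) auto
        also have "1 / real k0 \<le> 1" using k03 by simp
        also have "ln (real k1 / real k0) \<le> ln ((5/3) * (ln X / ln y))"
        proof (subst ln_le_cancel_iff)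
          have "real k1 * ln y \<le> real k1 * ((real k0 + 2) * ln 2)" using KsD(2)[OF k(1)] by (intro mult_left_mono) auto
          also have "\<dots> = (real k1 * ln 2) * (real k0 + 2)" by simp
          also have "\<dots> \<le> ln X * (5/3 * real k0)"
            using KsD(3)[OF k(2)] k03 lnX by (intro mult_mono) auto
          finally show "real k1 / real k0 \<le> (5/3) * (ln X / ln y)" using k03 lny by (simp add: field_simps)
          show "0 < real k1 / real k0" using k03 k01 by simp
          show "0 < (5/3) * (ln X / ln y)" using lnX lny by simp
        qed
        also have "ln ((5/3) * (ln X / ln y)) = ln (5/3) + ln (ln X / ln y)"
          using lnX lny by (subst ln_mult) auto
        also have "ln (5/3 :: real) \<le> 1" using ln_le_minus_one[of "5/3::real"] by simp
        finally show ?thesis by simp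
      qed (use lnXy in auto)
    qed (use C0(1) \<rho>0 c0 in auto)
    also have "\<dots> \<le> C * (1 + ln (ln X / ln y) + \<rho> * ln X)"
    proof -
      have "2 * \<rho> * (3 * ln X) + 2 * c * (2 + ln (ln X / ln y)) \<le> (6 + 4 * c) * (1 + ln (ln X / ln y) + \<rho> * ln X)"
      proof -
        have "c * ln (ln X / ln y) \<ge> 0" "\<rho> * ln X \<ge> 0" "c * (\<rho> * ln X) \<ge> 0"
          using c0 \<rho>0 lnX lnXy by (auto intro!: mult_nonneg_nonneg)
        then show ?thesis using lnXy by (simp add: algebra_simps)
      qed
      then show ?thesis unfolding C_def mult.assoc using C0(1) by (intro mult_left_mono) auto
    qed
    finally show ?thesis by (simp add: \<rho>_def)
  qed
  moreover have "C > 0" using C0(1) c0 by (simp add: C_def)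
  ultimately show ?thesis by (intro exI[of _ C] conjI allI impI) auto
qed

section \<open>Gauss sums and the Fourier expansion of a character sum\<close>

lemma dirichlet_characterD:
  assumes "dirichlet_character q chi"
  shows "[m = n] (mod int q) \<Longrightarrow> chi m = chi n" "chi (m * n) = chi m * chi n" 
    "chi n \<noteq> 0 \<longleftrightarrow> coprime n (int q)"
  using assms unfolding dirichlet_character_def by blast+

lemma dirichlet_character_one:
  assumes "dirichlet_character q chi"
  shows "chi 1 = 1"
proof -
  have "chi 1 * chi 1 = chi 1" using dirichlet_characterD(2)[OF assms, of 1 1] by simp
  moreover have "chi 1 \<noteq> 0" using dirichlet_characterD(3)[OF assms, of 1] by simp
  ultimately show ?thesis by simp
qed

lemma dirichlet_character_power:
  assumes "dirichlet_character q chi"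
  shows "chi (n ^ k) = chi n ^ k"
  by (induction k) (simp_all add: dirichlet_character_one[OF assms] dirichlet_characterD(2)[OF assms])

text \<open>By Euler's theorem the nonzero values are roots of unity.\<close>

lemma norm_dirichlet_character:
  assumes chi: "dirichlet_character q chi" and q: "q > 0"
  shows "norm (chi n) = (if coprime n (int q) then 1 else 0)"
proof (cases "coprime n (int q)")
  case True
  define m where "m = nat (n mod int q)"
  have m: "int m = n mod int q" using q by (simp add: m_def)
  have "coprime (int m) (int q)" unfolding m using True q by (simp add: coprime_commute)
  then have cop: "coprime m q" by simp
  have "[m ^ totient q = 1] (mod q)" using cop by (rule euler_theorem)
  then have "[int m ^ totient q = 1] (mod int q)" using cong_int_iff[of "m ^ totient q" 1 q] by simp
  then have "chi (int m ^ totient q) = chi 1" by (rule dirichlet_characterD(1)[OF chi])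
  then have "chi (int m) ^ totient q = 1" 
    using dirichlet_character_power[OF chi] dirichlet_character_one[OF chi] by simp
  then have "norm (chi (int m)) ^ totient q = 1" by (metis norm_one norm_power)
  moreover have "totient q > 0" using q by simp
  ultimately have "norm (chi (int m)) = 1" 
    using power_eq_imp_eq_base[of "norm (chi (int m))" "totient q" 1] by simp
  moreover have "chi (int m) = chi n" unfolding m by (rule dirichlet_characterD(1)[OF chi]) (simp add: cong_def)
  ultimately show ?thesis using True by simp
next
  case False
  then show ?thesis using dirichlet_characterD(3)[OF chi, of n] by simp
qed

definition gauss_sum :: "nat \<Rightarrow> (int \<Rightarrow> complex) \<Rightarrow> int \<Rightarrow> complex" where
  "gauss_sum q chi n = (\<Sum>c\<in>{0..<int q}. chi c * cis (2 * pi * (of_int (c * n) / real q)))"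

lemma cis_of_int_div_cong:
  assumes "[a = b] (mod int q)" "q > 0"
  shows "cis (2 * pi * (of_int a / real q)) = cis (2 * pi * (of_int b / real q))"
proof -
  obtain k where "a = b + int q * k" using assms(1) by (metis cong_iff_lin cong_sym)
  then have "2 * pi * (of_int a / real q) = 2 * pi * (of_int b / real q) + 2 * pi * of_int k"
    using assms(2) by (simp add: field_simps)
  then show ?thesis by (simp add: cis_mult[symmetric] cis_multiple_2pi)
qed

lemma bij_betw_mult_mod:
  fixes u :: int
  assumes "coprime u (int q)" "q > 0"
  shows "bij_betw (\<lambda>c. (c * u) mod int q) {0..<int q} {0..<int q}"
proof -
  have inj: "inj_on (\<lambda>c. (c * u) mod int q) {0..<int q}"
  proof (rule inj_onI)
    fix x y assume xy: "x \<in> {0..<int q}" "y \<in> {0..<int q}" "(x * u) mod int q = (y * u) mod int q"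
    then have "[x * u = y * u] (mod int q)" by (simp add: cong_def)
    then have "[x = y] (mod int q)" using assms(1) cong_mult_rcancel by blast
    then show "x = y" using xy by (simp add: cong_def)
  qed
  have "(\<lambda>c. (c * u) mod int q) ` {0..<int q} = {0..<int q}"
    using inj assms(2) by (intro card_subset_eq) (auto simp: card_image)
  then show ?thesis using inj by (simp add: bij_betw_def)
qed

lemma gauss_sum_mult:
  assumes chi: "dirichlet_character q chi" and q: "q > 0" and u: "coprime u (int q)"
  shows "gauss_sum q chi n = chi u * gauss_sum q chi (u * n)"
proof -
  have "gauss_sum q chi n = (\<Sum>c\<in>{0..<int q}. chi ((c * u) mod int q) * cis (2 * pi * (of_int ((c * u) mod int q * n) / real q)))"
    unfolding gauss_sum_def by (rule sum.reindex_bij_betw[OF bij_betw_mult_mod[OF u q], symmetric])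
  also have "\<dots> = (\<Sum>c\<in>{0..<int q}. chi u * (chi c * cis (2 * pi * (of_int (c * (u * n)) / real q))))"
  proof (rule sum.cong[OF refl])
    fix c
    have "chi ((c * u) mod int q) = chi (c * u)" by (rule dirichlet_characterD(1)[OF chi]) (simp add: cong_def)
    moreover have "cis (2 * pi * (of_int ((c * u) mod int q * n) / real q)) = cis (2 * pi * (of_int (c * u * n) / real q))"
      using q by (intro cis_of_int_div_cong) (auto simp: cong_def mod_mult_left_eq)
    ultimately show "chi ((c * u) mod int q) * cis (2 * pi * (of_int ((c * u) mod int q * n) / real q))
       = chi u * (chi c * cis (2 * pi * (of_int (c * (u * n)) / real q)))"
      by (simp add: dirichlet_characterD(2)[OF chi] mult_ac)
  qed
  finally show ?thesis by (simp add: gauss_sum_def sum_distrib_left)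
qed

text \<open>
  If \<open>n\<close> has a common factor with \<open>q\<close>, primitivity provides a unit \<open>u\<close> with \<open>chi u \<noteq> 1\<close> and
  \<open>u * n\<close> congruent to \<open>n\<close>, so the sum equals \<open>chi u\<close> times itself.
\<close>

lemma gauss_sum_eq:
  assumes prim: "primitive_character q chi" and q: "q > 0"
  shows "gauss_sum q chi n = cnj (chi n) * gauss_sum q chi 1"
proof -
  have chi: "dirichlet_character q chi" using prim by (simp add: primitive_character_def)
  show ?thesis
  proof (cases "coprime n (int q)")
    case True
    have "gauss_sum q chi 1 = chi n * gauss_sum q chi n"
      using gauss_sum_mult[OF chi q True, of 1] by simp
    then have "cnj (chi n) * gauss_sum q chi 1 = (chi n * cnj (chi n)) * gauss_sum q chi n" by simp
    also have "chi n * cnj (chi n) = 1" 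
      using norm_dirichlet_character[OF chi q, of n] True by (simp add: complex_norm_square[symmetric])
    finally show ?thesis by simp
  next
    case False
    define g where "g = nat (gcd n (int q))"
    have g: "int g = gcd n (int q)" by (simp add: g_def)
    have "g dvd q" using g by (metis gcd_dvd2 int_dvd_int_iff)
    have "g \<noteq> 1" using False g by (auto simp: coprime_iff_gcd_eq_1)
    have "g > 0" using \<open>g dvd q\<close> q by (auto intro!: Nat.gr0I)
    then have "g > 1" using \<open>g \<noteq> 1\<close> by simp
    define d where "d = q div g"
    have qd: "q = g * d" using \<open>g dvd q\<close> by (simp add: d_def)
    then have "d < q" "d > 0" using q \<open>g > 1\<close> by (auto intro!: Nat.gr0I)
    then have "\<not> induced_modulus q chi d" using prim by (auto simp: primitive_character_def)
    moreover have "d dvd q" using qd by simp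
    ultimately obtain u where u: "coprime u (int q)" "[u = 1] (mod int d)" "chi u \<noteq> 1"
      by (auto simp: induced_modulus_def)
    have "[u * n = n] (mod int q)"
    proof -
      obtain m where m: "n = int g * m" using g by (metis dvdE gcd_dvd1)
      have "int d dvd u - 1" using u(2) by (simp add: cong_iff_dvd_diff)
      then have "int g * int d dvd int g * (u - 1) * m" by (simp add: mult_dvd_mono dvd_mult2)
      then have "int q dvd u * n - n" unfolding qd m by (simp add: algebra_simps)
      then show ?thesis by (simp add: cong_iff_dvd_diff)
    qed
    then have "gauss_sum q chi (u * n) = gauss_sum q chi n"
      unfolding gauss_sum_def using q
      by (intro sum.cong refl arg_cong2[where f = "(*)"] cis_of_int_div_cong) (auto intro: cong_mult)
    then have "gauss_sum q chi n = chi u * gauss_sum q chi n" using gauss_sum_mult[OF chi q u(1), of n] by simp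
    then have "gauss_sum q chi n = 0" using u(3) by simp
    moreover have "chi n = 0" using False dirichlet_characterD(3)[OF chi, of n] by simp
    ultimately show ?thesis by simp
  qed
qed

lemma sum_cis_of_int_div:
  assumes "q > 0"
  shows "(\<Sum>n\<in>{0..<int q}. cis (2 * pi * (of_int (n * k) / real q))) = (if int q dvd k then of_nat q else 0)"
proof (cases "int q dvd k")
  case True
  have "cis (2 * pi * (of_int (n * k) / real q)) = 1" for n
  proof -
    have "cis (2 * pi * (of_int (n * k) / real q)) = cis (2 * pi * (of_int 0 / real q))"
      using True assms by (intro cis_of_int_div_cong) (auto simp: cong_0_iff)
    then show ?thesis by simp
  qed
  then show ?thesis using True by simp
next
  case False
  define z where "z = cis (2 * pi * (of_int k / real q))"
  have zn: "cis (2 * pi * (of_int (int n * k) / real q)) = z ^ n" for n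
    unfolding z_def Complex.DeMoivre by (simp add: mult_ac)
  have "z ^ q = 1"
  proof -
    have "cis (2 * pi * (of_int (int q * k) / real q)) = cis (2 * pi * (of_int 0 / real q))"
      using assms by (intro cis_of_int_div_cong) (auto simp: cong_0_iff)
    then show ?thesis using zn[of q] by simp
  qed
  have "z \<noteq> 1"
  proof
    assume "z = 1"
    define t where "t = of_int k / real q"
    have "norm (cis (2 * pi * t) - 1) = 0" using \<open>z = 1\<close> by (simp add: z_def t_def)
    then have "dist_int t = 0" using norm_cis_minus_one[of t] dist_int_bounds(1)[of t] by linarith
    then have "of_int k / real q = of_int (round t)" by (simp add: dist_int_def t_def)
    then have "real_of_int k = of_int (round t * int q)" using assms by (simp add: field_simps)
    then have "k = round t * int q" by linarith
    then show False using False by simp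
  qed
  have "(\<Sum>n\<in>{0..<int q}. cis (2 * pi * (of_int (n * k) / real q))) = (\<Sum>n<q. z ^ n)"
    by (rule sum.reindex_bij_witness[where i = int and j = nat]) (auto simp flip: zn)
  also have "\<dots> = 0" using \<open>z \<noteq> 1\<close> \<open>z ^ q = 1\<close> by (simp add: geometric_sum)
  finally show ?thesis using False by simp
qed

text \<open>The sum of \<open>norm (gauss_sum q chi n) ^ 2\<close> over all \<open>n\<close> modulo
  \<open>q\<close> is computed twice: orthogonality of the additive characters gives
  \<open>q * S\<close>, and \<open>gauss_sum_eq\<close> gives
  \<open>norm (gauss_sum q chi 1) ^ 2 * S\<close>.\<close>

lemma norm_gauss_sum_1:
  assumes prim: "primitive_character q chi" and q: "q > 0"
  shows "norm (gauss_sum q chi 1) = sqrt (real q)"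
proof -
  have chi: "dirichlet_character q chi" using prim by (simp add: primitive_character_def)
  let ?I = "{0..<int q}"
  define S where "S = (\<Sum>c\<in>?I. norm (chi c) ^ 2)"
  have S0: "S > 0"
  proof -
    have "norm (chi (1 mod int q)) ^ 2 \<le> S" unfolding S_def using q by (intro member_le_sum) auto
    moreover have "chi (1 mod int q) = chi 1" by (rule dirichlet_characterD(1)[OF chi]) (simp add: cong_def)
    ultimately show ?thesis using dirichlet_character_one[OF chi] by simp
  qed
  have "of_real (\<Sum>n\<in>?I. norm (gauss_sum q chi n) ^ 2) = (\<Sum>n\<in>?I. gauss_sum q chi n * cnj (gauss_sum q chi n))"
    by (simp only: of_real_sum complex_norm_square)
  also have "\<dots> = (\<Sum>n\<in>?I. \<Sum>c\<in>?I. \<Sum>d\<in>?I. chi c * cnj (chi d) * cis (2 * pi * (of_int (n * (c - d)) / real q)))"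
  proof (rule sum.cong[OF refl])
    fix n
    have "cis (2 * pi * (of_int (n * (c - d)) / real q)) 
        = cis (2 * pi * (of_int (c * n) / real q)) * cnj (cis (2 * pi * (of_int (d * n) / real q)))" for c d
      by (simp add: cis_cnj cis_mult algebra_simps diff_divide_distrib)
    then show "gauss_sum q chi n * cnj (gauss_sum q chi n) 
       = (\<Sum>c\<in>?I. \<Sum>d\<in>?I. chi c * cnj (chi d) * cis (2 * pi * (of_int (n * (c - d)) / real q)))"
      by (simp add: gauss_sum_def sum_product mult_ac)
  qed
  also have "\<dots> = (\<Sum>c\<in>?I. \<Sum>n\<in>?I. \<Sum>d\<in>?I. chi c * cnj (chi d) * cis (2 * pi * (of_int (n * (c - d)) / real q)))"
    by (rule sum.swap)
  also have "\<dots> = (\<Sum>c\<in>?I. \<Sum>d\<in>?I. \<Sum>n\<in>?I. chi c * cnj (chi d) * cis (2 * pi * (of_int (n * (c - d)) / real q)))"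
    by (intro sum.cong refl sum.swap)
  also have "\<dots> = (\<Sum>c\<in>?I. \<Sum>d\<in>?I. if c = d then chi c * cnj (chi c) * of_nat q else 0)"
  proof (intro sum.cong refl)
    fix c d assume cd: "c \<in> ?I" "d \<in> ?I"
    have "int q dvd c - d \<longleftrightarrow> c = d"
    proof
      assume "int q dvd c - d"
      then have "c mod int q = d mod int q" by (simp add: mod_eq_dvd_iff)
      then show "c = d" using cd by simp
    qed simp
    then show "(\<Sum>n\<in>?I. chi c * cnj (chi d) * cis (2 * pi * (of_int (n * (c - d)) / real q))) 
        = (if c = d then chi c * cnj (chi c) * of_nat q else 0)"
      unfolding sum_distrib_left[symmetric] sum_cis_of_int_div[OF q] by auto
  qed
  also have "\<dots> = (\<Sum>c\<in>?I. chi c * cnj (chi c) * of_nat q)" by (intro sum.cong refl) simp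
  also have "\<dots> = of_real (S * real q)"
    unfolding S_def by (simp only: of_real_mult of_real_sum complex_norm_square sum_distrib_right of_real_of_nat_eq)
  finally have "(\<Sum>n\<in>?I. norm (gauss_sum q chi n) ^ 2) = S * real q" by (simp only: of_real_eq_iff)
  moreover have "(\<Sum>n\<in>?I. norm (gauss_sum q chi n) ^ 2) = norm (gauss_sum q chi 1) ^ 2 * S"
    by (subst gauss_sum_eq[OF prim q]) (simp add: S_def norm_mult power_mult_distrib sum_distrib_left mult.commute)
  ultimately have "norm (gauss_sum q chi 1) ^ 2 = real q" using S0 by simp
  then show ?thesis by (metis norm_ge_zero real_sqrt_unique)
qed

section \<open>The cotangent kernel and a finite form of Polya's expansion\<close>

lemma sum_cos_mult_sin:
  "(\<Sum>n=1..N. cos (2 * real n * t)) * (2 * sin t) 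
     = sin (2 * real N * t) * cos t + cos (2 * real N * t) * sin t - sin t"
proof (induction N)
  case (Suc N)
  have "2 * real (Suc N) * t = 2 * real N * t + (t + t)" by (simp add: algebra_simps)
  then have c: "cos (2 * real (Suc N) * t) = cos (2 * real N * t) * cos (t + t) - sin (2 * real N * t) * sin (t + t)"
     and s: "sin (2 * real (Suc N) * t) = sin (2 * real N * t) * cos (t + t) + cos (2 * real N * t) * sin (t + t)"
    by (simp_all only: cos_add[of "2 * real N * t"] sin_add[of "2 * real N * t"])
  have d: "cos (t + t) = cos t ^ 2 - sin t ^ 2" "sin (t + t) = 2 * sin t * cos t"
    by (simp only: cos_add power2_eq_square, simp only: sin_add) simp
  have p: "cos t ^ 2 = 1 - sin t ^ 2" by (simp add: cos_squared_eq)
  define A B x y where "A = cos (2 * real N * t)" and "B = sin (2 * real N * t)" and "x = cos t" and "y = sin t"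
  have xy: "x * x = 1 - y * y" using p by (simp add: x_def y_def power2_eq_square)
  have "(\<Sum>n=1..Suc N. cos (2 * real n * t)) * (2 * sin t) 
      = B * x + A * y - y + (A * (x * x - y * y) - B * (2 * y * x)) * (2 * y)"
  proof -
    have "(\<Sum>n=1..Suc N. cos (2 * real n * t)) = (\<Sum>n=1..N. cos (2 * real n * t)) + cos (2 * real (Suc N) * t)"
      by (subst sum.nat_ivl_Suc') (simp, rule add.commute)
    then have "(\<Sum>n=1..Suc N. cos (2 * real n * t)) * (2 * sin t) 
        = (\<Sum>n=1..N. cos (2 * real n * t)) * (2 * sin t) + cos (2 * real (Suc N) * t) * (2 * sin t)"
      by (simp only: distrib_right)
    then show ?thesis unfolding Suc c d by (simp only: A_def B_def x_def y_def power2_eq_square)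
  qed
  moreover have "(B * (x * x - y * y) + A * (2 * y * x)) * x + (A * (x * x - y * y) - B * (2 * y * x)) * y - y
      = B * x + A * y - y + (A * (x * x - y * y) - B * (2 * y * x)) * (2 * y)"
  proof -
    \<comment> \<open>The two sides differ by a multiple of
      \<open>x * x + y * y - 1\<close>.\<close>
    have "((B * (x * x - y * y) + A * (2 * y * x)) * x + (A * (x * x - y * y) - B * (2 * y * x)) * y - y)
        - (B * x + A * y - y + (A * (x * x - y * y) - B * (2 * y * x)) * (2 * y))
        = (B * x + A * y) * (x * x + y * y - 1)" by (simp add: algebra_simps)
    then show ?thesis using xy by simp
  qed
  moreover have "sin (2 * real (Suc N) * t) * cos t + cos (2 * real (Suc N) * t) * sin t - sin t
    = (B * (x * x - y * y) + A * (2 * y * x)) * x + (A * (x * x - y * y) - B * (2 * y * x)) * y - y"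
    unfolding s c d A_def B_def x_def y_def by (simp add: power2_eq_square)
  ultimately show ?case by simp
qed simp

text \<open>The quotient \<open>sin ((2 * N + 1) * t) / sin t\<close> of the Dirichlet kernel
  appears split by the addition theorem: the summand with \<open>cot t\<close> carries the
  singularities, while \<open>cos (2 * N * t)\<close> later recombines into a Gauss sum.\<close>

lemma sum_cos_eq:
  assumes "sin t \<noteq> 0"
  shows "(\<Sum>n=1..N. cos (2 * real n * t)) = (sin (2 * real N * t) * cot t + cos (2 * real N * t) - 1) / 2"
  using sum_cos_mult_sin[of t N] assms by (simp add: cot_def field_simps)

lemma cot_bounds:
  assumes "0 < x" "x \<le> 1/2"
  shows "pi * cot (pi * x) \<le> 1 / x" "1 / x - pi \<le> pi * cot (pi * x)"
proof -
  define y where "y = pi * x"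
  have y: "0 < y" "y \<le> pi / 2" using assms by (auto simp: y_def)
  have s: "sin y > 0" using y by (intro sin_gt_zero) auto
  have c: "cos y \<ge> 0" using y by (intro cos_ge_zero) auto
  have x: "1 / x = pi / y" using assms by (simp add: y_def)
  have "y * cos y \<le> sin y" using y by (intro mult_cos_le_sin) auto
  then have "cot y \<le> 1 / y" using y s by (simp add: cot_def field_simps)
  then have "pi * cot y \<le> pi * (1 / y)" by (intro mult_left_mono) auto
  then show "pi * cot (pi * x) \<le> 1 / x" unfolding x by (simp add: y_def)
  \<comment> \<open>From \<open>1 \<le> sin y + cos y\<close> and \<open>sin y \<le> y\<close>
    follows \<open>(1 - y) * sin y \<le> y * cos y\<close>, which is the lower bound
    \<open>1 / y - 1\<close> for the cotangent.\<close>
  have "(sin y + cos y) ^ 2 = 1 + 2 * (sin y * cos y)"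
    using sin_cos_squared_add[of y] by (simp add: power2_sum)
  then have "1 ^ 2 \<le> (sin y + cos y) ^ 2" using s c by simp
  then have "1 \<le> sin y + cos y" by (rule power2_le_imp_le) (use s c in simp)
  then have "y * 1 \<le> y * (sin y + cos y)" using y by (intro mult_left_mono) auto
  moreover have "sin y \<le> y" using y by (intro sin_x_le_x) auto
  ultimately have "1 / y - 1 \<le> cot y" using y s by (simp add: cot_def field_simps)
  then have "pi * (1 / y - 1) \<le> pi * cot y" by (intro mult_left_mono) auto
  then show "1 / x - pi \<le> pi * cot (pi * x)" unfolding x by (simp add: y_def algebra_simps)
qed

text \<open>Subtracting the poles at both 0 and 1 leaves a bounded function on the whole interval.
  For \<open>x \<le> 1/2\<close> the difference lies between \<open>1 - pi\<close> and 2, and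
  \<open>pi \<le> 7/2\<close> gives 5/2. The other half follows because the difference changes sign
  under the reflection of \<open>x\<close> to \<open>1 - x\<close>.\<close>

lemma cot_approx:
  assumes "0 < x" "x < 1"
  shows "\<bar>pi * cot (pi * x) - (1 / x - 1 / (1 - x))\<bar> \<le> 5/2"
proof -
  have pi: "pi \<le> 7/2" using pi_approx by simp
  have *: "\<bar>pi * cot (pi * x) - (1 / x - 1 / (1 - x))\<bar> \<le> 5/2" if "0 < x" "x \<le> 1/2" for x
  proof -
    have "1 \<le> 1 / (1 - x)" "1 / (1 - x) \<le> 2" using that by (auto simp: field_simps)
    then show ?thesis using cot_bounds[OF that] pi by linarith
  qed
  show ?thesis
  proof (cases "x \<le> 1/2")
    case False
    have "cot (pi * x) = - cot (pi * (1 - x))"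
      by (simp add: cot_def algebra_simps sin_diff cos_diff)
    then have "\<bar>pi * cot (pi * x) - (1 / x - 1 / (1 - x))\<bar> = \<bar>pi * cot (pi * (1 - x)) - (1 / (1 - x) - 1 / (1 - (1 - x)))\<bar>"
      by (simp add: abs_if)
    then show ?thesis using *[of "1 - x"] False assms by simp
  qed (use * assms in auto)
qed

lemma sum_reflect:
  fixes h :: "nat \<Rightarrow> 'a :: comm_monoid_add"
  shows "(\<Sum>c\<in>{1..<q}. h c) = (\<Sum>c\<in>{1..<q}. h (q - c))"
  by (rule sum.reindex_bij_witness[where i = "\<lambda>c. q - c" and j = "\<lambda>c. q - c"]) auto

text \<open>Being finite, the expansion has no truncation error. The conjugate of the character sum
  times the Gauss sum at 1 is the sum of the Gauss sums at all \<open>n \<le> N\<close>; as the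
  character is even, these contain only cosines, and summing over \<open>n\<close> first produces
  the cotangent.\<close>

lemma polya_bound:
  assumes prim: "primitive_character q chi" and even: "even_character chi" and q: "q \<ge> 2"
  shows "norm (\<Sum>n=1..N. chi (int n)) \<le> sqrt (real q) / pi * 
      norm (\<Sum>c\<in>{1..<q}. chi (int c) * of_real (sin (2 * pi * (real c * (real N / real q))) / real c))
      + 5 / (4 * pi) * sqrt (real q) + 1/2"
proof -
  have chi: "dirichlet_character q chi" using prim by (simp add: primitive_character_def)
  have q0: "q > 0" using q by simp
  let ?I = "{1..<q}"
  define f where "f c = chi (int c)" for c
  define t where "t c = pi * (real c / real q)" for c
  define \<tau> where "\<tau> = gauss_sum q chi 1"
  have \<tau>: "norm \<tau> = sqrt (real q)" unfolding \<tau>_def by (rule norm_gauss_sum_1[OF prim q0])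
  have chi0: "chi 0 = 0"
    using dirichlet_characterD(3)[OF chi, of 0] q by auto
  have refl_f: "f (q - c) = f c" if "c \<in> ?I" for c
  proof -
    have "[int (q - c) = (-1) * int c] (mod int q)"
      using that by (simp add: cong_iff_dvd_diff of_nat_diff)
    then have "chi (int (q - c)) = chi ((-1) * int c)" by (rule dirichlet_characterD(1)[OF chi])
    also have "\<dots> = chi (int c)"
      unfolding dirichlet_characterD(2)[OF chi] using even by (simp add: even_character_def)
    finally show ?thesis by (simp add: f_def)
  qed
  have refl_t: "2 * real n * t (q - c) = 2 * pi * real n - 2 * real n * t c" if "c \<in> ?I" for c n
    using that by (simp add: t_def of_nat_diff field_simps)
  have cos_refl: "cos (2 * real n * t (q - c)) = cos (2 * real n * t c)" if "c \<in> ?I" for c n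
  proof -
    have "cos (2 * pi * real n - 2 * real n * t c) = cos (2 * real n * t c)"
      using cos_int_2pin[of "int n"] sin_int_2pin[of "int n"] by (simp add: cos_diff)
    then show ?thesis using refl_t[OF that] by simp
  qed
  have sin_refl: "sin (2 * real n * t (q - c)) = - sin (2 * real n * t c)" if "c \<in> ?I" for c n
  proof -
    have "sin (2 * pi * real n - 2 * real n * t c) = - sin (2 * real n * t c)"
      using cos_int_2pin[of "int n"] sin_int_2pin[of "int n"] by (simp add: sin_diff)
    then show ?thesis using refl_t[OF that] by simp
  qed
  have gauss: "gauss_sum q chi (int n) = (\<Sum>c\<in>?I. f c * of_real (cos (2 * real n * t c)))" for n
  proof -
    have "gauss_sum q chi (int n) = (\<Sum>c<q. f c * cis (2 * pi * (of_int (int c * int n) / real q)))"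
      unfolding gauss_sum_def f_def
      by (rule sum.reindex_bij_witness[where i = int and j = nat]) auto
    also have "\<dots> = (\<Sum>c<q. f c * cis (2 * real n * t c))" by (simp add: t_def mult_ac)
    also have "\<dots> = (\<Sum>c\<in>?I. f c * cis (2 * real n * t c))"
      by (rule sum.mono_neutral_right) (use chi0 in \<open>auto simp: f_def Suc_le_eq\<close>)
    finally have 1: "gauss_sum q chi (int n) = (\<Sum>c\<in>?I. f c * cis (2 * real n * t c))" .
    also have "\<dots> = (\<Sum>c\<in>?I. f (q - c) * cis (2 * real n * t (q - c)))" by (rule sum_reflect)
    also have "\<dots> = (\<Sum>c\<in>?I. f c * cis (- (2 * real n * t c)))"
      by (intro sum.cong refl arg_cong2[where f = "(*)"]) 
        (simp_all only: refl_f, simp add: complex_eq_iff cos_refl sin_refl)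
    finally have 2: "gauss_sum q chi (int n) = (\<Sum>c\<in>?I. f c * cis (- (2 * real n * t c)))" .
    have "2 * gauss_sum q chi (int n) = (\<Sum>c\<in>?I. f c * cis (2 * real n * t c)) + (\<Sum>c\<in>?I. f c * cis (- (2 * real n * t c)))"
      by (subst mult_2) (rule arg_cong2[where f = "(+)", OF 1 2])
    also have "\<dots> = (\<Sum>c\<in>?I. f c * (cis (2 * real n * t c) + cis (- (2 * real n * t c))))"
      by (simp only: sum.distrib distrib_left)
    also have "\<dots> = 2 * (\<Sum>c\<in>?I. f c * of_real (cos (2 * real n * t c)))"
      unfolding sum_distrib_left by (intro sum.cong refl) (simp add: complex_eq_iff)
    finally show ?thesis by simp
  qed
  define W where "W = (\<Sum>c\<in>?I. f c * of_real (sin (2 * real N * t c) / real c))"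
  define err where "err c = pi * cot (t c) - (1 / (real c / real q) - 1 / (1 - real c / real q))" for c
  have "cnj (\<Sum>n=1..N. chi (int n)) * \<tau> = (\<Sum>n=1..N. gauss_sum q chi (int n))"
    unfolding \<tau>_def by (simp add: sum_distrib_right gauss_sum_eq[OF prim q0, symmetric])
  also have "\<dots> = (\<Sum>c\<in>?I. \<Sum>n=1..N. f c * of_real (cos (2 * real n * t c)))"
    unfolding gauss by (rule sum.swap)
  also have "\<dots> = (\<Sum>c\<in>?I. f c * of_real (\<Sum>n=1..N. cos (2 * real n * t c)))"
    by (simp add: sum_distrib_left)
  \<comment> \<open>The constant 1 is written as \<open>cos (2 * real 0 * t c)\<close>, so that its
    part becomes the Gauss sum at 0, which vanishes.\<close>
  also have "\<dots> = (\<Sum>c\<in>?I. (1/2) * (f c * of_real (sin (2 * real N * t c) * cot (t c)))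
      + (1/2) * (f c * of_real (cos (2 * real N * t c))) - (1/2) * (f c * of_real (cos (2 * real 0 * t c))))"
  proof (intro sum.cong refl)
    fix c assume c: "c \<in> ?I"
    have "0 < t c" "t c < pi" using c by (auto simp: t_def field_simps)
    then have "sin (t c) \<noteq> 0" using sin_gt_zero by force
    then show "f c * of_real (\<Sum>n=1..N. cos (2 * real n * t c)) = (1/2) * (f c * of_real (sin (2 * real N * t c) * cot (t c)))
      + (1/2) * (f c * of_real (cos (2 * real N * t c))) - (1/2) * (f c * of_real (cos (2 * real 0 * t c)))"
      unfolding sum_cos_eq[OF \<open>sin (t c) \<noteq> 0\<close>] by (simp add: field_simps)
  qed
  also have "\<dots> = (1/2) * (\<Sum>c\<in>?I. f c * of_real (sin (2 * real N * t c) * cot (t c)))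
      + (1/2) * gauss_sum q chi (int N) - (1/2) * gauss_sum q chi (int 0)"
    unfolding gauss by (simp only: sum.distrib sum_subtractf sum_distrib_left)
  also have "gauss_sum q chi (int 0) = 0" using gauss_sum_eq[OF prim q0, of 0] chi0 by simp
  also have "gauss_sum q chi (int N) = cnj (f N) * \<tau>" unfolding \<tau>_def f_def by (rule gauss_sum_eq[OF prim q0])
  also have "(\<Sum>c\<in>?I. f c * of_real (sin (2 * real N * t c) * cot (t c)))
     = of_real (2 * real q / pi) * W + of_real (1 / pi) * (\<Sum>c\<in>?I. f c * of_real (sin (2 * real N * t c) * err c))"
  proof -
    have cot: "cot (t c) = real q / pi * (1 / real c) - real q / pi * (1 / real (q - c)) + 1 / pi * err c" if c: "c \<in> ?I" for c
    proof -
      have w: "1 - real c / real q = real (q - c) / real q" using c by (simp add: of_nat_diff field_simps)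
      have "err c = pi * cot (t c) - (real q / real c - real q / real (q - c))"
        unfolding err_def w by simp
      then have "cot (t c) = (real q / real c - real q / real (q - c) + err c) / pi" by simp
      also have "\<dots> = real q / pi * (1 / real c) - real q / pi * (1 / real (q - c)) + 1 / pi * err c"
        by (simp add: add_divide_distrib diff_divide_distrib mult.commute)
      finally show ?thesis .
    qed
    have "(\<Sum>c\<in>?I. f c * of_real (sin (2 * real N * t c) * cot (t c)))
       = (\<Sum>c\<in>?I. of_real (real q / pi) * (f c * of_real (sin (2 * real N * t c) / real c))
          - of_real (real q / pi) * (f c * of_real (sin (2 * real N * t c) / real (q - c)))
          + of_real (1 / pi) * (f c * of_real (sin (2 * real N * t c) * err c)))"
      by (intro sum.cong refl) (simp only: cot, simp add: algebra_simps)
    also have "\<dots> = of_real (real q / pi) * W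
          - of_real (real q / pi) * (\<Sum>c\<in>?I. f c * of_real (sin (2 * real N * t c) / real (q - c)))
          + of_real (1 / pi) * (\<Sum>c\<in>?I. f c * of_real (sin (2 * real N * t c) * err c))"
      unfolding W_def by (simp only: sum.distrib sum_subtractf sum_distrib_left)
    \<comment> \<open>The reflection of \<open>c\<close> to \<open>q - c\<close> fixes
      \<open>f\<close> and changes the sign of the sine. The pole at 1 therefore contributes as much
      as the pole at 0, and the coefficient of \<open>W\<close> doubles.\<close>
    also have "(\<Sum>c\<in>?I. f c * of_real (sin (2 * real N * t c) / real (q - c))) = - W"
    proof -
      have "(\<Sum>c\<in>?I. f c * of_real (sin (2 * real N * t c) / real (q - c)))
         = (\<Sum>c\<in>?I. f (q - c) * of_real (sin (2 * real N * t (q - c)) / real (q - (q - c))))"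
        by (rule sum_reflect)
      also have "\<dots> = (\<Sum>c\<in>?I. - (f c * of_real (sin (2 * real N * t c) / real c)))"
        by (intro sum.cong refl) (simp add: refl_f sin_refl)
      finally show ?thesis by (simp only: W_def sum_negf)
    qed
    finally show ?thesis by (simp add: field_simps)
  qed
  finally have eq: "cnj (\<Sum>n=1..N. chi (int n)) * \<tau> = of_real (real q / pi) * W 
     + of_real (1 / (2 * pi)) * (\<Sum>c\<in>?I. f c * of_real (sin (2 * real N * t c) * err c)) + (1/2) * (cnj (f N) * \<tau>)"
    by (simp add: algebra_simps)
  have f1: "norm (f c) \<le> 1" for c unfolding f_def using norm_dirichlet_character[OF chi q0] by simp
  have errb: "norm (\<Sum>c\<in>?I. f c * of_real (sin (2 * real N * t c) * err c)) \<le> real q * (5/2)"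
  proof -
    have "norm (\<Sum>c\<in>?I. f c * of_real (sin (2 * real N * t c) * err c)) \<le> (\<Sum>c\<in>?I. 5/2)"
    proof (rule sum_norm_le)
      fix c assume c: "c \<in> ?I"
      have "\<bar>err c\<bar> \<le> 5/2" unfolding err_def t_def using c q by (intro cot_approx) auto
      then have "\<bar>sin (2 * real N * t c)\<bar> * \<bar>err c\<bar> \<le> 1 * (5/2)" by (intro mult_mono) auto
      then have "norm (f c) * (\<bar>sin (2 * real N * t c)\<bar> * \<bar>err c\<bar>) \<le> 1 * (1 * (5/2))"
        by (rule mult_mono[OF f1]) simp_all
      then show "norm (f c * of_real (sin (2 * real N * t c) * err c)) \<le> 5/2" by (simp add: norm_mult abs_mult)
    qed
    also have "\<dots> \<le> real q * (5/2)" by simp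
    finally show ?thesis .
  qed
  have "norm (\<Sum>n=1..N. chi (int n)) * sqrt (real q) = norm (cnj (\<Sum>n=1..N. chi (int n)) * \<tau>)"
    by (simp only: norm_mult \<tau> complex_mod_cnj)
  also have "\<dots> \<le> norm (of_real (real q / pi) * W) 
     + norm (of_real (1 / (2 * pi)) * (\<Sum>c\<in>?I. f c * of_real (sin (2 * real N * t c) * err c))) + norm ((1/2) * (cnj (f N) * \<tau>))"
    unfolding eq by (intro order_trans[OF norm_triangle_ineq] add_right_mono norm_triangle_ineq)
  also have "norm (of_real (real q / pi) * W) = real q / pi * norm W" by (simp only: norm_mult norm_of_real) simp
  also have "norm (of_real (1 / (2 * pi)) * (\<Sum>c\<in>?I. f c * of_real (sin (2 * real N * t c) * err c))) 
     \<le> 1 / (2 * pi) * (real q * (5/2))"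
    unfolding norm_mult using errb by (intro mult_mono) (auto simp: norm_divide)
  also have "norm ((1/2) * (cnj (f N) * \<tau>)) \<le> (1/2) * (1 * sqrt (real q))"
    unfolding norm_mult \<tau> complex_mod_cnj using f1 by (intro mult_mono) auto
  finally have "norm (\<Sum>n=1..N. chi (int n)) * sqrt (real q) \<le> real q / pi * norm W + 1 / (2 * pi) * (real q * (5/2)) + (1/2) * (1 * sqrt (real q))"
    by simp
  also have "\<dots> = (sqrt (real q) / pi * norm W + 5 / (4 * pi) * sqrt (real q) + 1/2) * sqrt (real q)"
  proof -
    have "s * s / pi * w + 1 / (2 * pi) * (s * s * (5/2)) + (1/2) * (1 * s) 
        = (s / pi * w + 5 / (4 * pi) * s + 1/2) * s" for s w :: real
      by (simp add: field_simps)
    from this[of "sqrt (real q)" "norm W"] show ?thesis by (simp only: real_sqrt_mult_self abs_of_nat)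
  qed
  finally have "norm (\<Sum>n=1..N. chi (int n)) \<le> sqrt (real q) / pi * norm W + 5 / (4 * pi) * sqrt (real q) + 1/2"
    using q0 by (simp add: mult_le_cancel_right)
  moreover have "W = (\<Sum>c\<in>{1..<q}. chi (int c) * of_real (sin (2 * pi * (real c * (real N / real q))) / real c))"
    unfolding W_def f_def t_def by (simp add: mult_ac)
  ultimately show ?thesis by simp
qed

section \<open>Diophantine approximation and the final bound\<close>

text \<open>The bounds on \<open>\<alpha>\<close> place \<open>r * \<alpha>\<close> between
  \<open>R / a\<close> and \<open>1 - R / a\<close> whenever \<open>1 \<le> r < R\<close>, so its
  distance to every integer is at least \<open>R / a\<close>. Dirichlet's theorem with a parameter
  \<open>Y \<ge> a\<close> produces a distance below \<open>1 / a\<close> and thus cannot return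
  such a denominator.\<close>

lemma rational_approximation_large_denominator:
  fixes R a \<alpha> :: real
  assumes R: "2 \<le> R" "R < a" and \<alpha>: "R / a < \<alpha>" "\<alpha> < 1 / R * (1 - R / a)" and k: "a ^ 4 < 2 ^ (k + 2)"
  shows "\<exists>b r::int. coprime b r \<and> R \<le> of_int r \<and> of_int r \<le> 2 * sqrt (2 ^ k) \<and>
        \<bar>of_int r * \<alpha> - of_int b\<bar> \<le> 1 / of_int r"
proof -
  \<comment> \<open>A power of two whose square lies between \<open>2 ^ (k + 1)\<close> and
    \<open>2 ^ (k + 2)\<close>. The upper bound is \<open>Y \<le> 2 * sqrt (2 ^ k)\<close>; the
    lower one gives \<open>a \<le> Y\<close>, since
    \<open>4 * a ^ 2 \<le> a ^ 4 < 2 ^ (k + 2)\<close>.\<close>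
  define Y :: nat where "Y = 2 ^ (k div 2 + 1)"
  have Y0: "Y > 0" by (simp add: Y_def)
  have Y2: "real Y ^ 2 = 2 ^ (2 * (k div 2) + 2)" by (simp add: Y_def power_mult[symmetric] power_add power2_eq_square)
      (simp add: mult_2 power_add)
  have Yle: "real Y \<le> 2 * sqrt (2 ^ k)"
  proof (rule power2_le_imp_le)
    have "(2::real) ^ (2 * (k div 2) + 2) \<le> 2 ^ (k + 2)" by (intro power_increasing) auto
    also have "\<dots> = (2 * sqrt (2 ^ k)) ^ 2" by (simp add: power_mult_distrib)
    finally show "real Y ^ 2 \<le> (2 * sqrt (2 ^ k)) ^ 2" by (simp only: Y2)
  qed simp
  have aY: "a \<le> real Y"
  proof (rule power2_le_imp_le)
    have "2 ^ 2 \<le> a ^ 2" using R by (intro power_mono) auto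
    then have "4 * a ^ 2 \<le> a ^ 2 * a ^ 2" by (intro mult_right_mono) auto
    also have "\<dots> = a ^ 4" by (simp flip: power_add)
    finally have "2 * a ^ 2 < 2 ^ (k + 1)" using k by simp
    then have "a ^ 2 \<le> 2 ^ (k + 1)" using zero_le_power2[of a] by linarith
    also have "\<dots> \<le> 2 ^ (2 * (k div 2) + 2)" by (intro power_increasing) auto
    finally show "a ^ 2 \<le> real Y ^ 2" by (simp only: Y2)
  qed simp
  obtain b r where br: "coprime b r" "0 < r" "r \<le> int Y" "\<bar>of_int r * \<alpha> - of_int b\<bar> < 1 / real Y"
    using Dirichlet_approx_coprime[OF Y0, of \<alpha>] by blast
  have r1: "real_of_int r \<ge> 1" using br(2) by linarith
  have rY: "real_of_int r \<le> real Y" using br(3) by linarith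
  have a0: "a > 0" using R by simp
  have Ya: "1 / real Y \<le> 1 / a" using aY a0 by (intro divide_left_mono) (auto intro: mult_pos_pos)
  have \<alpha>0: "\<alpha> > 0"
  proof -
    have "R / a > 0" using R by simp
    then show ?thesis using \<alpha>(1) by linarith
  qed
  have rR: "R \<le> of_int r"
  proof (rule ccontr)
    assume "\<not> R \<le> of_int r"
    then have lt: "of_int r < R" by simp
    show False
    proof (cases "b \<le> 0")
      case True
      have "\<alpha> \<le> of_int r * \<alpha>" using r1 \<alpha>0 by (simp add: mult_le_cancel_right1)
      also have "\<dots> \<le> of_int r * \<alpha> - of_int b" using True by simp
      also have "\<dots> < 1 / a" using br(4) Ya by linarith
      also have "\<dots> \<le> R / a" using R by (intro divide_right_mono) auto
      finally show False using \<alpha>(1) by simp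
    next
      case False
      then have b1: "real_of_int b \<ge> 1" by linarith
      have "of_int r * \<alpha> \<le> R * (1 / R * (1 - R / a))"
        using lt \<alpha> \<alpha>0 r1 by (intro mult_mono) auto
      also have "\<dots> = 1 - R / a" using R by simp
      also have "\<dots> \<le> 1 - 1 / a" using R by (simp add: divide_right_mono)
      finally have "of_int r * \<alpha> \<le> 1 - 1 / a" .
      then show False using br(4) Ya b1 by linarith
    qed
  qed
  have "1 / real Y \<le> 1 / of_int r" using rY r1 by (intro divide_left_mono) auto
  then have "\<bar>of_int r * \<alpha> - of_int b\<bar> \<le> 1 / of_int r" using br(4) by linarith
  then show ?thesis using br(1) rR rY Yle by (intro exI[of _ b] exI[of _ r]) auto
qed

lemma norm_sum_inverse_le:
  fixes g :: "nat \<Rightarrow> complex"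
  assumes "\<And>c. norm (g c) \<le> 1 / real c" "0 < n"
  shows "norm (\<Sum>c=1..n. g c) \<le> 1 + ln (real n)"
proof -
  have "norm (\<Sum>c=1..n. g c) \<le> (\<Sum>c=1..n. 1 / real c)" by (intro sum_norm_le assms)
  also have "\<dots> = harm n" by (simp add: harm_def divide_inverse)
  also have "\<dots> \<le> 1 + ln (real n)" using assms(2) by (rule harm_le_one_plus_ln)
  finally show ?thesis .
qed

theorem theorem4:
  "\<exists>K::real. K > 0 \<and>
     (\<forall>(q::nat) (R::real) (a::real) (N::int) (chi :: int \<Rightarrow> complex).
        q \<ge> 2 \<longrightarrow> 2 \<le> R \<longrightarrow> R < a \<longrightarrow> a \<le> real q \<longrightarrow>
        real q * R / a < real_of_int N \<longrightarrow>
        real_of_int N < real q / R * (1 - R / a) \<longrightarrow>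
        primitive_character q chi \<longrightarrow> even_character chi \<longrightarrow>
        norm (\<Sum>n=1..N. chi n)
          \<le> 2 * sqrt (real q) *
              (2 / pi * ln a + 2 / pi * (euler_mascheroni + ln 2 + 3 / a))
            + K * (sqrt (real q) *
                max (ln (ln (real q) / ln a))
                    (ln R powr (3 / 2) / sqrt R * ln (real q / a))))"
proof -
  obtain C where C: "C > 0" and CB: "\<And>f \<alpha> y X R.
     (\<forall>m n. f (m * n) = f m * f n) \<Longrightarrow> (\<forall>n. norm (f n) \<le> 1) \<Longrightarrow> 16 \<le> y \<Longrightarrow> y \<le> X \<Longrightarrow> 2 \<le> R \<Longrightarrow>
     (\<forall>k. y < 2 ^ (k + 2) \<longrightarrow> (\<exists>b r::int. coprime b r \<and> R \<le> of_int r \<and> of_int r \<le> 2 * sqrt (2 ^ k) \<and>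
        \<bar>of_int r * \<alpha> - of_int b\<bar> \<le> 1 / of_int r)) \<Longrightarrow>
     norm (\<Sum>n | y < real n \<and> real n \<le> X. f n * cis (2 * pi * (real n * \<alpha>)) / of_nat n)
       \<le> C * (1 + ln (ln X / ln y) + sqrt (ln R ^ 3 / R) * ln X)"
    using log_exponential_sum_bound by blast
  \<comment> \<open>At the end both \<open>9 / (4 * pi) + 1/2\<close> and \<open>4 / pi\<close> are
    at most 2, and the maximum is at least 1.\<close>
  define K where "K = 2 + 2 * C"
  have "norm (\<Sum>n=1..N. chi n)
          \<le> 2 * sqrt (real q) * (2 / pi * ln a + 2 / pi * (euler_mascheroni + ln 2 + 3 / a))
            + K * (sqrt (real q) * max (ln (ln (real q) / ln a)) (ln R powr (3 / 2) / sqrt R * ln (real q / a)))"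
    if q: "q \<ge> 2" and R: "2 \<le> R" "R < a" and aq: "a \<le> real q"
      and N: "real q * R / a < real_of_int N" "real_of_int N < real q / R * (1 - R / a)"
      and prim: "primitive_character q chi" and even: "even_character chi"
    for q R a N and chi :: "int \<Rightarrow> complex"
  proof -
    have chi: "dirichlet_character q chi" using prim by (simp add: primitive_character_def)
    have q0: "real q > 0" and a0: "a > 2" using q R by auto
    define L where "L = nat N"
    have "real q * R / a > 0" using q R by simp
    then have N0: "N > 0" using N(1) by linarith
    then have L: "real L = of_int N" by (simp add: L_def)
    define \<alpha> where "\<alpha> = real L / real q"
    have \<alpha>: "R / a < \<alpha>" "\<alpha> < 1 / R * (1 - R / a)"
    proof -
      have "R / a * real q < real_of_int N" "real_of_int N < 1 / R * (1 - R / a) * real q" using N by (simp_all add: mult.commute)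
      then show "R / a < \<alpha>" "\<alpha> < 1 / R * (1 - R / a)" unfolding \<alpha>_def L using q0 
        by (simp_all only: pos_less_divide_eq pos_divide_less_eq)
    qed
    define f where "f n = chi (int n)" for n
    have f1: "norm (f n) \<le> 1" for n
      unfolding f_def using norm_dirichlet_character[OF chi, of "int n"] q by simp
    have fmult: "f (m * n) = f m * f n" for m n
      unfolding f_def using dirichlet_characterD(2)[OF chi] by simp
    define g where "g c = f c * of_real (sin (2 * pi * (real c * \<alpha>)) / real c)" for c
    have g1: "norm (g c) \<le> 1 / real c" for c
    proof -
      have "norm (f c) * \<bar>sin (2 * pi * (real c * \<alpha>))\<bar> \<le> 1 * 1" using f1 by (intro mult_mono) auto
      then have "norm (f c) * \<bar>sin (2 * pi * (real c * \<alpha>))\<bar> / real c \<le> 1 / real c" by (intro divide_right_mono) auto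
      then show ?thesis by (simp add: g_def norm_mult norm_divide)
    qed
    define W where "W = (\<Sum>c=1..q. g c)"
    \<comment> \<open>The sine vanishes at \<open>c = q\<close>, so the sum may include this term
      and matches the range \<open>y < c \<le> q\<close> of the exponential sums.\<close>
    have "g q = 0"
    proof -
      have "2 * pi * (real q * \<alpha>) = 2 * pi * of_int (int L)" using q0 by (simp add: \<alpha>_def)
      then have "sin (2 * pi * (real q * \<alpha>)) = 0" using sin_int_2pin[of "int L"] by (simp only:)
      then show ?thesis by (simp add: g_def)
    qed
    then have Weq: "W = (\<Sum>c\<in>{1..<q}. chi (int c) * of_real (sin (2 * pi * (real c * (real L / real q))) / real c))"
    proof -
      have "{1..q} = insert q {1..<q}" using q by auto
      then have "W = g q + (\<Sum>c\<in>{1..<q}. g c)" unfolding W_def by simp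
      with \<open>g q = 0\<close> show ?thesis by (simp add: g_def f_def \<alpha>_def)
    qed
    have "(\<Sum>n=1..N. chi n) = (\<Sum>n=1..L. chi (int n))"
      by (rule sum.reindex_bij_witness[where i = int and j = nat]) (auto simp: L_def)
    then have main: "norm (\<Sum>n=1..N. chi n) \<le> sqrt (real q) / pi * norm W + 5 / (4 * pi) * sqrt (real q) + 1/2"
      unfolding Weq using polya_bound[OF prim even q, of L] by simp
    have sq1: "sqrt (real q) \<ge> 1" using q by simp
    define A where "A = ln (ln (real q) / ln a)"
    define B where "B = ln R powr (3 / 2) / sqrt R * ln (real q / a)"
    have lna: "ln a > 0" using a0 by simp
    have \<rho>: "ln R powr (3 / 2) / sqrt R = sqrt (ln R ^ 3 / R)"
    proof -
      have lR: "ln R > 0" using R by simp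
      have "ln R powr (3 / 2) = (ln R powr 3) powr (1/2)" by (simp add: powr_powr)
      also have "ln R powr 3 = ln R ^ 3" using lR by (simp add: powr_numeral)
      also have "(ln R ^ 3) powr (1/2) = sqrt (ln R ^ 3)" using lR by (simp add: powr_half_sqrt)
      finally show ?thesis by (simp add: real_sqrt_divide)
    qed
    have lqa: "ln (real q / a) = ln (real q) - ln a" using q0 a0 by (simp add: ln_div)
    have B0: "B \<ge> 0" unfolding B_def \<rho> using aq a0 R by (intro mult_nonneg_nonneg) auto
    have em: "euler_mascheroni \<ge> (19/33 :: real)" using euler_mascheroni_gt_19_over_33 by simp
    have l2: "ln (2::real) \<ge> 2/3" using ln2_ge_two_thirds .
    have extra: "0 \<le> 2 / pi * (euler_mascheroni + ln 2 + 3 / a)" using em l2 a0 by simp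
    show ?thesis
    proof (cases "ln (real q) \<le> 4 * ln a")
      \<comment> \<open>Multiplied by \<open>sqrt q / pi\<close>, the bound \<open>4 * ln a\<close>
        is already the logarithmic main term. The other constants amount to
        \<open>9/16 + pi/8 < 17/16\<close>, which is less than 19/33 + 2/3, a lower bound for C + ln
        2.\<close>
      case True
      have "norm W \<le> 1 + ln (real q)" unfolding W_def using g1 q by (intro norm_sum_inverse_le) auto
      then have "norm W \<le> 1 + 4 * ln a" using True by linarith
      then have "sqrt (real q) / pi * norm W \<le> sqrt (real q) / pi * (1 + 4 * ln a)" by (intro mult_left_mono) auto
      then have "norm (\<Sum>n=1..N. chi n) \<le> sqrt (real q) / pi * (1 + 4 * ln a) + 5 / (4 * pi) * sqrt (real q) + 1/2 * sqrt (real q)"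
        using main sq1 by linarith
      also have "\<dots> = 2 * sqrt (real q) * (2 / pi * ln a + 2 / pi * (9/16 + pi/8))"
        by (simp add: field_simps)
      also have "\<dots> \<le> 2 * sqrt (real q) * (2 / pi * ln a + 2 / pi * (euler_mascheroni + ln 2 + 3 / a))"
      proof (intro mult_left_mono add_left_mono)
        have "3 / a > 0" using a0 by simp
        moreover have "pi < 4" by (rule pi_less_4)
        ultimately show "9/16 + pi/8 \<le> euler_mascheroni + ln 2 + 3 / a" using em l2 by linarith
      qed auto
      also have "\<dots> \<le> \<dots> + K * (sqrt (real q) * max A B)"
        using B0 C by (auto simp: K_def max_def intro!: mult_nonneg_nonneg)
      finally show ?thesis unfolding A_def B_def .
    next
      case False
      define y where "y = a ^ 4"
      have lny: "ln y = 4 * ln a" using a0 by (simp add: y_def ln_realpow)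
      have "2 ^ 4 \<le> a ^ 4" using a0 by (intro power_mono) auto
      then have y16: "16 \<le> y" by (simp add: y_def)
      have yq: "y \<le> real q"
      proof -
        have "ln y < ln (real q)" using False lny by simp
        then show ?thesis using y16 q0 by (subst (asm) ln_less_cancel_iff) auto
      qed
      have A1: "A \<ge> 1"
      proof -
        have "4 \<le> ln (real q) / ln a" using False lna by (simp add: field_simps)
        then have "exp 1 \<le> ln (real q) / ln a" using exp_le by linarith
        then have "ln (exp 1) \<le> A" unfolding A_def by (subst ln_le_cancel_iff) (auto intro: less_le_trans[OF exp_gt_zero])
        then show ?thesis by simp
      qed
      define n where "n = nat \<lfloor>y\<rfloor>"
      have n: "n > 0" "real n \<le> y" "y < real n + 1" using y16 by (auto simp: n_def)
      have nq: "n \<le> q" using n yq by linarith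
      define V where "V = (\<Sum>c | y < real c \<and> real c \<le> real q. g c)"
      have WV: "W = (\<Sum>c=1..n. g c) + V"
      proof -
        have "c \<in> {1..q} \<longleftrightarrow> c \<in> {1..n} \<union> {c. y < real c \<and> real c \<le> real q}" for c
        proof -
          have "real c \<le> y \<longleftrightarrow> c \<le> n" using n by linarith
          then show ?thesis using nq y16 by auto
        qed
        then have "{1..q} = {1..n} \<union> {c. y < real c \<and> real c \<le> real q}" by blast
        moreover have "{1..n} \<inter> {c. y < real c \<and> real c \<le> real q} = {}" using n by auto
        moreover have "finite {c. y < real c \<and> real c \<le> real q}"
          by (rule finite_subset[of _ "{..q}"]) auto
        ultimately show ?thesis unfolding W_def V_def by (simp add: sum.union_disjoint)
      qed
      have "norm (\<Sum>c=1..n. g c) \<le> 1 + ln (real n)" using g1 n by (intro norm_sum_inverse_le) auto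
      also have "ln (real n) \<le> ln y" using n y16 by (subst ln_le_cancel_iff) auto
      finally have W1: "norm (\<Sum>c=1..n. g c) \<le> 1 + 4 * ln a" using lny by simp
      define \<Phi> where "\<Phi> = C * (1 + ln (ln (real q) / ln y) + sqrt (ln R ^ 3 / R) * ln (real q))"
      have dio: "\<forall>k. y < 2 ^ (k + 2) \<longrightarrow> (\<exists>b r::int. coprime b r \<and> R \<le> of_int r \<and> of_int r \<le> 2 * sqrt (2 ^ k) \<and>
        \<bar>of_int r * \<alpha> - of_int b\<bar> \<le> 1 / of_int r)"
        unfolding y_def using rational_approximation_large_denominator[OF R \<alpha>] by blast
      \<comment> \<open>The sine is a difference of two exponentials. As \<open>f\<close> is
        complex, the one with negative frequency is the conjugate of the sum for
        \<open>cnj (f c)\<close>; that function is completely multiplicative as well and obeys the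
        same bound.\<close>
      define S where "S h = (\<Sum>c | y < real c \<and> real c \<le> real q. h c * cis (2 * pi * (real c * \<alpha>)) / of_nat c)" for h :: "nat \<Rightarrow> complex"
      have S1: "norm (S f) \<le> \<Phi>"
        unfolding S_def \<Phi>_def using fmult f1 y16 yq R dio by (intro CB) auto
      have S2: "norm (S (\<lambda>c. cnj (f c))) \<le> \<Phi>"
        unfolding S_def \<Phi>_def using fmult f1 y16 yq R dio by (intro CB) auto
      have "2 * \<i> * V = S f - cnj (S (\<lambda>c. cnj (f c)))"
        unfolding V_def S_def cnj_sum sum_distrib_left sum_subtractf[symmetric]
        by (intro sum.cong refl) (simp add: g_def complex_eq_iff add_divide_distrib diff_divide_distrib algebra_simps)
      then have "norm (2 * \<i> * V) \<le> norm (S f) + norm (cnj (S (\<lambda>c. cnj (f c))))"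
        by (simp only: norm_triangle_ineq4)
      then have V: "norm V \<le> \<Phi>" using S1 S2 by (simp add: norm_mult)
      \<comment> \<open>The three summands are at most \<open>A\<close>, \<open>A\<close> and
        \<open>4/3 * B\<close>, the last because \<open>ln a\<close> is less than a quarter of
        \<open>ln q\<close> in this case; 10/3 is rounded up to 4.\<close>
      have \<Phi>: "\<Phi> \<le> C * (4 * max A B)"
        unfolding \<Phi>_def
      proof (intro mult_left_mono)
        have "ln (real q) / ln y \<le> ln (real q) / ln a"
          using lna lny q by (intro divide_left_mono) auto
        moreover have "0 < ln (real q) / ln y" using lna lny q by auto
        ultimately have "ln (ln (real q) / ln y) \<le> A" unfolding A_def by (subst ln_le_cancel_iff) auto
        moreover have "sqrt (ln R ^ 3 / R) * ln (real q) \<le> 4/3 * B"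
        proof -
          have "ln (real q) \<le> 4/3 * ln (real q / a)" using False lqa by simp
          then have "sqrt (ln R ^ 3 / R) * ln (real q) \<le> sqrt (ln R ^ 3 / R) * (4/3 * ln (real q / a))"
            using R by (intro mult_left_mono) auto
          then show ?thesis unfolding B_def \<rho> by simp
        qed
        ultimately show "1 + ln (ln (real q) / ln y) + sqrt (ln R ^ 3 / R) * ln (real q) \<le> 4 * max A B"
          using A1 B0 by (simp add: max_def)
      qed (use C in auto)
      have "norm W \<le> 1 + 4 * ln a + C * (4 * max A B)"
        unfolding WV using norm_triangle_ineq[of "\<Sum>c=1..n. g c" V] W1 V \<Phi> by linarith
      then have "sqrt (real q) / pi * norm W \<le> sqrt (real q) / pi * (1 + 4 * ln a + C * (4 * max A B))"
        by (intro mult_left_mono) auto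
      then have "norm (\<Sum>n=1..N. chi n) \<le> sqrt (real q) / pi * (1 + 4 * ln a + C * (4 * max A B)) 
          + 5 / (4 * pi) * sqrt (real q) + 1/2 * sqrt (real q)"
        using main sq1 by linarith
      also have "\<dots> = 2 * sqrt (real q) * (2 / pi * ln a) + sqrt (real q) * ((9 / 4) / pi + 1/2 + (4 / pi) * (C * max A B))"
        by (simp add: field_simps)
      also have "\<dots> \<le> 2 * sqrt (real q) * (2 / pi * ln a) + sqrt (real q) * (K * max A B)"
      proof (intro add_left_mono mult_left_mono)
        have "(9/4) / pi \<le> (9/4) / 2" using pi_ge_two by (intro divide_left_mono) auto
        moreover have "(4 / pi) * (C * max A B) \<le> 2 * (C * max A B)"
          using pi_ge_two C A1 by (intro mult_right_mono) (auto simp: field_simps max_def)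
        moreover have "1 \<le> max A B" using A1 by simp
        ultimately show "(9 / 4) / pi + 1/2 + (4 / pi) * (C * max A B) \<le> K * max A B"
          unfolding K_def by (simp add: algebra_simps)
      qed auto
      also have "\<dots> \<le> 2 * sqrt (real q) * (2 / pi * ln a + 2 / pi * (euler_mascheroni + ln 2 + 3 / a)) + K * (sqrt (real q) * max A B)"
      proof -
        have "2 * sqrt (real q) * (2 / pi * ln a) \<le> 2 * sqrt (real q) * (2 / pi * ln a + 2 / pi * (euler_mascheroni + ln 2 + 3 / a))"
          using extra by (intro mult_left_mono) auto
        then show ?thesis by (simp add: mult_ac)
      qed
      finally show ?thesis unfolding A_def B_def .
    qed
  qed
  moreover have "K > 0" using C by (simp add: K_def)
  ultimately show ?thesis by (intro exI[of _ K] conjI allI impI) auto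
qed

end
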